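(* To smooth lines $\gamma$ in the projective planes $\mathbb{C}P^2$, $\mathbb{C}^1P^2$ and $\mathbb{C}^0P^2$ over the algebras of complex, double and dual numbers, there correspond three-dimensional tangentially degenerate submanifolds $S$ of rank $r=2$ in the space $\mathbb{R}P^5$. Moreover: 1. For the algebra $\mathbb{C}$, such a submanifold $S$ does not have real singular points. 2. For the algebra $\mathbb{C}^1$, such a submanifold $S$ is the join formed by the straight lines connecting the points of two plane curves that are in general position. 3. For the algebra $\mathbb{C}^0$, such a submanifold $S$ is a subfamily of the family of straight lines intersecting a plane curve. In all these cases, a submanifold $S$ depends on two functions of one variable.
   Context: **Algebras.** $\mathbb{C}=\{x+iy\}$ with $i^2=-1$, $\mathbb{C}^1=\{x+ey\}$ with $e^2=1$, $\mathbb{C}^0=\{x+\varepsilon y\}$ with $\varepsilon^2=0$, where $x,y\in\mathbb{R}$. They are identified with algebras of real $(2\times 2)$-matrices by $$x+iy\mapsto\begin{pmatrix}x&-y\\ y&x\end{pmatrix},\qquad x+ey\mapsto\begin{pmatrix}x&y\\ y&x\end{pmatrix},\qquad x+\varepsilon y\mapsto\begin{pmatrix}x&0\\ y&x\end{pmatrix}.$$ Let $A$ be one of these algebras. **Projective plane $AP^2$.** A point $X\in AP^2$ is given by three coordinates $X^0,X^1,X^2\in A$, written as a column $X=(X^0,X^1,X^2)^T$, which in the matrix representation is a real $(6\times2)$-matrix; its two columns $x_0,x_1\in\mathbb{R}^6$ are required to be linearly independent. The coordinates are defined up to simultaneous multiplication from the right by an element of $A$ which is not a zero divisor. The plane $AP^2$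 has real dimension 4. To $X$ there corresponds the straight line $x_0\wedge x_1$ of $\mathbb{R}P^5$ through the points $x_0,x_1$. Two points $X,Y$ are adjacent if the $(6\times4)$-matrix composed of their coordinates has rank less than 4; through two non-adjacent points there passes a unique straight line $X\wedge Y=\{XP+YQ : P,Q\in A\}\cap AP^2$, which has real dimension 2. **Smooth line.** A smooth line ($A$-smooth line) is a smooth submanifold $\gamma\subset AP^2$ of real dimension 2 such that at each of its points $X$ it is tangent to a straight line $U$ of $AP^2$ passing through $X$ (i.e. $T_X\gamma=T_XU$). All considerations are local on $\gamma$. **Ruled submanifold $S$.** $S$ is the ruled submanifold of $\mathbb{R}P^5$ formed by the lines $x_0\wedge x_1$ corresponding to points $X\in\gamma$; these lines are its rectilinear generators. It is the image of a map from a 3-dimensional manifold (the total space of the family of lines over $\gamma$). A point of a generator is singular (a focus) if this map has rank less than 3 there; equivalently, for some nonzero infinitesimal displacement of the generator along $\gamma$ the differential of the point belongs to the generator. The tangent subspace $T_x(S)$ is the projective tangent 3-space of $S$ at a non-singular point $x$. **Tangential degeneracy.** A three-dimensional submanifold $S\subset\mathbb{R}P^5$ is tangentially degenerate of rank $r$ (a submanifold with degenerate Gauss map of rank $r$) if its Gauss map $x\mapsto T_x(S)$, from the non-singular points of $S$ to the Grassmannian of 3-dimensional subspaces of $\mathbb{R}P^5$, has rank equal to $r$, where $r<3$; thus the tangent subspaces of $S$ form a family depending on exactly $r$ parameters. **Curves.** A plane curve is a curve contained in a 2-plane of $\mathbb{R}P^5$. Two plane curves are in general position if they lie in two 2-planes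 $\pi_1,\pi_2\subset\mathbb{R}P^5$ in general position (disjoint). The join is the union of the lines connecting points of one curve with points of the other. **Dependence on functions.** A frame in $AP^2$ is a triple of pairwise non-adjacent points $A_0,A_1,A_2$ whose $(6\times6)$ coordinate matrix is invertible; moving frames satisfy $dA_\alpha=\sum_\beta A_\beta\,\Omega_\alpha^\beta$ with $A$-valued 1-forms $\Omega_\alpha^\beta$, $\alpha,\beta=0,1,2$. Smooth lines, with frames chosen so that $A_0=X\in\gamma$ and $A_1$ lies on the tangent line $U$, are the 2-dimensional solutions of the Pfaffian system $\Omega_0^2=0$ (two real equations), the two real components of $\Omega_0^1$ being the basis (independent) forms. "$S$ depends on two functions of one variable" means, in the sense of Cartan's theory, that this system is in involution with Cartan characters $s_1=2$, $s_2=0$, so that its general solution depends on two arbitrary real functions of one real variable.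
   Formalization: Rank 2 fails for some smooth lines (for a straight line, S is an RP^3 with constant Gauss map); proved instead: S is three-dimensional and tangentially degenerate (rank < 3) for every smooth line, with rank 2 exactly when the second fundamental form of the smooth line has no kernel. *)

theory Defs
  imports "HOL-Analysis.Analysis"
begin

section \<open>The algebras of complex, double and dual numbers\<close>

class plane_algebra = comm_ring_1 + real_algebra_1 + euclidean_space +
  fixes mat_rep :: "'a \<Rightarrow> real^2^2"
  assumes mat_rep_add: "mat_rep (a + b) = mat_rep a + mat_rep b"
    and mat_rep_scaleR: "mat_rep (r *\<^sub>R a) = r *\<^sub>R mat_rep a"
    and mat_rep_one: "mat_rep 1 = mat 1"
    and mat_rep_mult: "mat_rep (a * b) = mat_rep a ** mat_rep b"
    and mat_rep_inject: "mat_rep a = mat_rep b \<Longrightarrow> a = b"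
    and DIM_plane_algebra: "card (Basis :: 'a set) = 2"

instantiation complex :: plane_algebra
begin

definition mat_rep_complex :: "complex \<Rightarrow> real^2^2" where
  "mat_rep_complex z = vector [vector [Re z, - Im z], vector [Im z, Re z]]"

instance
  by standard (simp_all add: mat_rep_complex_def vec_eq_iff forall_2 matrix_matrix_mult_def
      sum_2 mat_def complex_eq_iff algebra_simps)

end

datatype double_num = Double (d_fst: real) (d_snd: real)

lemma double_num_eq_iff: "x = y \<longleftrightarrow> d_fst x = d_fst y \<and> d_snd x = d_snd y"
  by (cases x; cases y) simp

instantiation double_num :: "{comm_ring_1, real_algebra_1}"
begin

definition "0 = Double 0 0"
definition "1 = Double 1 0"
definition "x + y = Double (d_fst x + d_fst y) (d_snd x + d_snd y)"
definition "x - y = Double (d_fst x - d_fst y) (d_snd x - d_snd y)"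
definition "- x = Double (- d_fst x) (- d_snd x)"
definition "x * y = Double (d_fst x * d_fst y + d_snd x * d_snd y)
                           (d_fst x * d_snd y + d_snd x * d_fst y)"
definition "r *\<^sub>R x = Double (r * d_fst x) (r * d_snd x)"

lemmas double_num_ring_defs = zero_double_num_def one_double_num_def plus_double_num_def
  minus_double_num_def uminus_double_num_def times_double_num_def scaleR_double_num_def

instance
  by standard (simp_all add: double_num_ring_defs algebra_simps)

end

instantiation double_num :: euclidean_space
begin

definition "inner x y = d_fst x * d_fst y + d_snd x * d_snd y"
definition "norm x = sqrt ((d_fst x)\<^sup>2 + (d_snd x)\<^sup>2)"
definition sgn_double_num_def: "sgn (x :: double_num) = x /\<^sub>R norm x"
definition dist_double_num_def: "dist (x :: double_num) y = norm (x - y)"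
definition uniformity_double_num_def [code del]:
  "(uniformity :: (double_num \<times> double_num) filter) = (INF e\<in>{0 <..}. principal {(x, y). dist x y < e})"
definition open_double_num_def [code del]:
  "open (U :: double_num set) \<longleftrightarrow> (\<forall>x\<in>U. eventually (\<lambda>(x', y). x' = x \<longrightarrow> y \<in> U) uniformity)"
definition Basis_double_num_def: "Basis = {Double 1 0, Double 0 1}"

instance
proof
  fix x y z :: double_num and r :: real and U :: "double_num set"
  show "dist x y = norm (x - y)" by (rule dist_double_num_def)
  show "sgn x = x /\<^sub>R norm x" by (rule sgn_double_num_def)
  show "(uniformity :: (double_num \<times> double_num) filter) = (INF e\<in>{0 <..}. principal {(x, y). dist x y < e})"
    by (rule uniformity_double_num_def)
  show "open U \<longleftrightarrow> (\<forall>x\<in>U. eventually (\<lambda>(x', y). x' = x \<longrightarrow> y \<in> U) uniformity)"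
    by (rule open_double_num_def)
  show "(\<forall>u\<in>Basis. inner x u = 0) \<longleftrightarrow> x = 0"
    by (cases x) (simp add: inner_double_num_def double_num_ring_defs Basis_double_num_def)
  show "inner x x = 0 \<longleftrightarrow> x = 0"
    by (simp add: inner_double_num_def double_num_ring_defs double_num_eq_iff sum_squares_eq_zero_iff)
qed (auto simp: inner_double_num_def norm_double_num_def double_num_ring_defs Basis_double_num_def double_num_eq_iff
      algebra_simps power2_eq_square)

end

instantiation double_num :: plane_algebra
begin

definition mat_rep_double_num :: "double_num \<Rightarrow> real^2^2" where
  "mat_rep_double_num z = vector [vector [d_fst z, d_snd z], vector [d_snd z, d_fst z]]"

instance
  by standard (simp_all add: mat_rep_double_num_def double_num_ring_defs Basis_double_num_def double_num_eq_iff
      vec_eq_iff forall_2 matrix_matrix_mult_def sum_2 mat_def algebra_simps)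

end

datatype dual_num = Dual (e_fst: real) (e_snd: real)

lemma dual_num_eq_iff: "x = y \<longleftrightarrow> e_fst x = e_fst y \<and> e_snd x = e_snd y"
  by (cases x; cases y) simp

instantiation dual_num :: "{comm_ring_1, real_algebra_1}"
begin

definition "0 = Dual 0 0"
definition "1 = Dual 1 0"
definition "x + y = Dual (e_fst x + e_fst y) (e_snd x + e_snd y)"
definition "x - y = Dual (e_fst x - e_fst y) (e_snd x - e_snd y)"
definition "- x = Dual (- e_fst x) (- e_snd x)"
definition "x * y = Dual (e_fst x * e_fst y) (e_fst x * e_snd y + e_snd x * e_fst y)"
definition "r *\<^sub>R x = Dual (r * e_fst x) (r * e_snd x)"

lemmas dual_num_ring_defs = zero_dual_num_def one_dual_num_def plus_dual_num_def
  minus_dual_num_def uminus_dual_num_def times_dual_num_def scaleR_dual_num_def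

instance
  by standard (simp_all add: dual_num_ring_defs algebra_simps)

end

instantiation dual_num :: euclidean_space
begin

definition "inner x y = e_fst x * e_fst y + e_snd x * e_snd y"
definition "norm x = sqrt ((e_fst x)\<^sup>2 + (e_snd x)\<^sup>2)"
definition sgn_dual_num_def: "sgn (x :: dual_num) = x /\<^sub>R norm x"
definition dist_dual_num_def: "dist (x :: dual_num) y = norm (x - y)"
definition uniformity_dual_num_def [code del]:
  "(uniformity :: (dual_num \<times> dual_num) filter) = (INF e\<in>{0 <..}. principal {(x, y). dist x y < e})"
definition open_dual_num_def [code del]:
  "open (U :: dual_num set) \<longleftrightarrow> (\<forall>x\<in>U. eventually (\<lambda>(x', y). x' = x \<longrightarrow> y \<in> U) uniformity)"
definition Basis_dual_num_def: "Basis = {Dual 1 0, Dual 0 1}"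

instance
proof
  fix x y z :: dual_num and r :: real and U :: "dual_num set"
  show "dist x y = norm (x - y)" by (rule dist_dual_num_def)
  show "sgn x = x /\<^sub>R norm x" by (rule sgn_dual_num_def)
  show "(uniformity :: (dual_num \<times> dual_num) filter) = (INF e\<in>{0 <..}. principal {(x, y). dist x y < e})"
    by (rule uniformity_dual_num_def)
  show "open U \<longleftrightarrow> (\<forall>x\<in>U. eventually (\<lambda>(x', y). x' = x \<longrightarrow> y \<in> U) uniformity)"
    by (rule open_dual_num_def)
  show "(\<forall>u\<in>Basis. inner x u = 0) \<longleftrightarrow> x = 0"
    by (cases x) (simp add: inner_dual_num_def dual_num_ring_defs Basis_dual_num_def)
  show "inner x x = 0 \<longleftrightarrow> x = 0"
    by (simp add: inner_dual_num_def dual_num_ring_defs dual_num_eq_iff sum_squares_eq_zero_iff)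
qed (auto simp: inner_dual_num_def norm_dual_num_def dual_num_ring_defs Basis_dual_num_def dual_num_eq_iff
      algebra_simps power2_eq_square)

end

instantiation dual_num :: plane_algebra
begin

definition mat_rep_dual_num :: "dual_num \<Rightarrow> real^2^2" where
  "mat_rep_dual_num z = vector [vector [e_fst z, 0], vector [e_snd z, e_fst z]]"

instance
  by standard (simp_all add: mat_rep_dual_num_def dual_num_ring_defs Basis_dual_num_def dual_num_eq_iff
      vec_eq_iff forall_2 matrix_matrix_mult_def sum_2 mat_def algebra_simps)

end


section \<open>The projective plane over an algebra\<close>

text \<open>Points of the plane are given by coordinate columns \<open>X :: 'a^3\<close>. The real
  \<open>(6 \<times> 2)\<close>-matrix of \<open>X\<close> consists of three \<open>(2 \<times> 2)\<close>-blocks, so its columns lie in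
  \<open>real^2^3\<close>, the model of \<open>\<real>\<^sup>6\<close>. The algebras are commutative, hence multiplication of the
  coordinates from the right by \<open>u\<close> is \<open>u *s X\<close>.\<close>

definition real_col :: "'a::plane_algebra^3 \<Rightarrow> 2 \<Rightarrow> real^2^3" where
  "real_col X j = (\<chi> i. column j (mat_rep (X $ i)))"

definition coord_vector :: "'a::plane_algebra^3 \<Rightarrow> bool" where
  "coord_vector X \<longleftrightarrow> real_col X 1 \<noteq> real_col X 2 \<and> independent {real_col X 1, real_col X 2}"

definition regular :: "'a::plane_algebra \<Rightarrow> bool" where
  "regular u \<longleftrightarrow> (\<forall>b. u * b = 0 \<longrightarrow> b = 0)"

definition adjacent :: "'a::plane_algebra^3 \<Rightarrow> 'a^3 \<Rightarrow> bool" where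
  "adjacent X Y \<longleftrightarrow> dim {real_col X 1, real_col X 2, real_col Y 1, real_col Y 2} < 4"

definition straight_line :: "'a::plane_algebra^3 \<Rightarrow> 'a^3 \<Rightarrow> ('a^3) set" where
  "straight_line X Y = {P *s X + Q *s Y | P Q. True}"

text \<open>A subset of the plane is represented by the set of all coordinate columns of its points,
  i.e. by a set of \<open>coord_vector\<close>s that is saturated under regular elements; it is open in
  another one iff the sets of columns are relatively open (the projection to the plane is an
  open map).\<close>

definition saturation :: "('a::plane_algebra^3) set \<Rightarrow> ('a^3) set" where
  "saturation M = {u *s X | u X. regular u \<and> X \<in> M}"

definition plane_subset :: "('a::plane_algebra^3) set \<Rightarrow> bool" where
  "plane_subset M \<longleftrightarrow> (\<forall>X\<in>M. coord_vector X) \<and> saturation M = M"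

definition open_part :: "('a::plane_algebra^3) set \<Rightarrow> ('a^3) set \<Rightarrow> bool" where
  "open_part M N \<longleftrightarrow> plane_subset N \<and> openin (top_of_set M) N"


section \<open>Smooth lines\<close>

primrec Ck_on :: "nat \<Rightarrow> ('a::real_normed_vector \<Rightarrow> 'b::real_normed_vector) \<Rightarrow> 'a set \<Rightarrow> bool" where
  "Ck_on 0 f W \<longleftrightarrow> continuous_on W f"
| "Ck_on (Suc k) f W \<longleftrightarrow> (\<forall>x\<in>W. f differentiable (at x)) \<and>
     (\<forall>v. Ck_on k (\<lambda>x. frechet_derivative f (at x) v) W)"

definition smooth_on :: "('a::real_normed_vector \<Rightarrow> 'b::real_normed_vector) \<Rightarrow> 'a set \<Rightarrow> bool" where
  "smooth_on f W \<longleftrightarrow> (\<forall>k. Ck_on k f W)"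

text \<open>\<open>local_param \<gamma> W \<phi>\<close>: the map sending \<open>w \<in> W\<close> to the point with coordinates \<open>\<phi> w\<close> is a
  smooth immersion of \<open>W\<close> into the plane and a homeomorphism onto an open part of \<open>\<gamma>\<close>. The
  kernel of the differential of the projection to the plane at \<open>X\<close> consists of the multiples
  of \<open>X\<close>.\<close>

definition local_param ::
    "('a::plane_algebra^3) set \<Rightarrow> (real^2) set \<Rightarrow> (real^2 \<Rightarrow> 'a^3) \<Rightarrow> bool" where
  "local_param \<gamma> W \<phi> \<longleftrightarrow>
     open W \<and> smooth_on \<phi> W \<and>
     (\<forall>w\<in>W. \<forall>v P. frechet_derivative \<phi> (at w) v = P *s \<phi> w \<longrightarrow> v = 0) \<and>
     (\<forall>w\<in>W. \<forall>w'\<in>W. \<forall>u. regular u \<longrightarrow> \<phi> w' = u *s \<phi> w \<longrightarrow> w' = w) \<and>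
     (\<forall>W'\<subseteq>W. open W' \<longrightarrow> open_part \<gamma> (saturation (\<phi> ` W')))"

definition smooth_surface :: "('a::plane_algebra^3) set \<Rightarrow> bool" where
  "smooth_surface \<gamma> \<longleftrightarrow> plane_subset \<gamma> \<and>
     (\<forall>X\<in>\<gamma>. \<exists>W \<phi>. local_param \<gamma> W \<phi> \<and> X \<in> saturation (\<phi> ` W))"

text \<open>The preimage in \<open>'a^3\<close> of the tangent plane of \<open>\<gamma>\<close> at \<open>X = \<phi> w\<close>. The corresponding
  preimage for a straight line \<open>U\<close> at each of its points is \<open>U\<close> itself (as a submodule).\<close>

definition tangent_space :: "(real^2 \<Rightarrow> 'a::plane_algebra^3) \<Rightarrow> real^2 \<Rightarrow> ('a^3) set" where
  "tangent_space \<phi> w = {frechet_derivative \<phi> (at w) v + P *s \<phi> w | v P. True}"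

definition smooth_line :: "('a::plane_algebra^3) set \<Rightarrow> bool" where
  "smooth_line \<gamma> \<longleftrightarrow> smooth_surface \<gamma> \<and>
     (\<forall>W \<phi>. local_param \<gamma> W \<phi> \<longrightarrow> (\<forall>w\<in>W. \<exists>Y Z.
        coord_vector Y \<and> coord_vector Z \<and> \<not> adjacent Y Z \<and>
        \<phi> w \<in> straight_line Y Z \<and> tangent_space \<phi> w = straight_line Y Z))"

text \<open>Non-degeneracy of the second fundamental form \<open>(v, u) \<mapsto> D\<^sup>2\<phi>(v, u) mod tangent_space \<phi> w\<close>
  (no dependence on the choice of \<open>\<phi>\<close>, because the tangent space is a submodule). It excludes
  straight lines, whose second fundamental form vanishes, and points of inflection.\<close>

definition nondegenerate :: "('a::plane_algebra^3) set \<Rightarrow> bool" where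
  "nondegenerate \<gamma> \<longleftrightarrow> (\<forall>W \<phi>. local_param \<gamma> W \<phi> \<longrightarrow> (\<forall>w\<in>W. \<forall>v.
     (\<forall>u. frechet_derivative (\<lambda>y. frechet_derivative \<phi> (at y) v) (at w) u \<in> tangent_space \<phi> w)
       \<longrightarrow> v = 0))"


section \<open>The ruled submanifold and its Gauss map\<close>

text \<open>Projective subspaces of \<open>\<real>P\<^sup>5\<close> are linear subspaces of \<open>real^2^3\<close> of dimension one higher,
  and subsets are sets of nonzero vectors closed under nonzero multiples.\<close>

definition generator :: "'a::plane_algebra^3 \<Rightarrow> (real^2^3) set" where
  "generator X = span {real_col X 1, real_col X 2}"

definition ruled :: "('a::plane_algebra^3) set \<Rightarrow> (real^2^3) set" where
  "ruled \<gamma> = {x. x \<noteq> 0 \<and> (\<exists>X\<in>\<gamma>. x \<in> generator X)}"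

text \<open>For a map into a projective space with nowhere vanishing lift \<open>F\<close>: the linear span of the
  projective tangent subspace of the image, and the rank of the map.\<close>

definition proj_tangent ::
    "('a::real_normed_vector \<Rightarrow> 'b::euclidean_space) \<Rightarrow> 'a \<Rightarrow> 'b set" where
  "proj_tangent F z = span (insert (F z) (range (frechet_derivative F (at z))))"

definition proj_rank :: "('a::real_normed_vector \<Rightarrow> 'b::euclidean_space) \<Rightarrow> 'a \<Rightarrow> nat" where
  "proj_rank F z = dim (proj_tangent F z) - 1"

text \<open>The total space of the family of lines is described by \<open>w \<in> W\<close> and homogeneous coordinates
  \<open>p \<noteq> 0\<close> on the generator. The scaling of \<open>p\<close> does not change the point of \<open>\<real>P\<^sup>5\<close>, so all ranks
  below equal those of the maps defined on the 3-dimensional total space.\<close>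

definition ruling :: "(real^2 \<Rightarrow> 'a::plane_algebra^3) \<Rightarrow> (real^2) \<times> (real^2) \<Rightarrow> real^2^3" where
  "ruling \<phi> = (\<lambda>(w, p). (p $ 1) *\<^sub>R real_col (\<phi> w) 1 + (p $ 2) *\<^sub>R real_col (\<phi> w) 2)"

definition singular_at :: "(real^2 \<Rightarrow> 'a::plane_algebra^3) \<Rightarrow> (real^2) \<times> (real^2) \<Rightarrow> bool" where
  "singular_at \<phi> z \<longleftrightarrow> proj_rank (ruling \<phi>) z < 3"

text \<open>The Grassmannian is embedded into the space of linear operators by sending a subspace to
  the orthogonal projection onto it.\<close>

definition gauss ::
    "(real^2 \<Rightarrow> 'a::plane_algebra^3) \<Rightarrow> (real^2) \<times> (real^2) \<Rightarrow> (real^2^3) \<Rightarrow>\<^sub>L (real^2^3)" where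
  "gauss \<phi> z = Blinfun (closest_point (proj_tangent (ruling \<phi>) z))"

definition gauss_rank :: "(real^2 \<Rightarrow> 'a::plane_algebra^3) \<Rightarrow> (real^2) \<times> (real^2) \<Rightarrow> nat" where
  "gauss_rank \<phi> z = dim (range (frechet_derivative (gauss \<phi>) (at z)))"

text \<open>Three-dimensionality of \<open>ruled \<gamma>\<close> is expressed by non-singular points on each generator.\<close>

definition tangentially_degenerate :: "('a::plane_algebra^3) set \<Rightarrow> bool" where
  "tangentially_degenerate \<gamma> \<longleftrightarrow> (\<forall>W \<phi>. local_param \<gamma> W \<phi> \<longrightarrow> (\<forall>w\<in>W.
     (\<exists>p. p \<noteq> 0 \<and> \<not> singular_at \<phi> (w, p)) \<and>
     (\<forall>p. p \<noteq> 0 \<and> \<not> singular_at \<phi> (w, p) \<longrightarrow>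
        gauss \<phi> differentiable (at (w, p)) \<and> gauss_rank \<phi> (w, p) < 3)))"

definition tangentially_degenerate_of_rank :: "nat \<Rightarrow> ('a::plane_algebra^3) set \<Rightarrow> bool" where
  "tangentially_degenerate_of_rank r \<gamma> \<longleftrightarrow> tangentially_degenerate \<gamma> \<and>
     (\<forall>W \<phi>. local_param \<gamma> W \<phi> \<longrightarrow> (\<forall>w\<in>W. \<forall>p.
        p \<noteq> 0 \<and> \<not> singular_at \<phi> (w, p) \<longrightarrow> gauss_rank \<phi> (w, p) = r))"

definition no_real_singular_points :: "('a::plane_algebra^3) set \<Rightarrow> bool" where
  "no_real_singular_points \<gamma> \<longleftrightarrow> (\<forall>W \<phi>. local_param \<gamma> W \<phi> \<longrightarrow>
     (\<forall>w\<in>W. \<forall>p. p \<noteq> 0 \<longrightarrow> \<not> singular_at \<phi> (w, p)))"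


section \<open>Plane curves\<close>

definition two_plane :: "(real^2^3) set \<Rightarrow> bool" where
  "two_plane \<pi> \<longleftrightarrow> subspace \<pi> \<and> dim \<pi> = 3"

definition plane_curve :: "(real^2^3) set \<Rightarrow> real set \<Rightarrow> (real \<Rightarrow> real^2^3) \<Rightarrow> bool" where
  "plane_curve \<pi> I c \<longleftrightarrow> two_plane \<pi> \<and> open I \<and> connected I \<and> I \<noteq> {} \<and> smooth_on c I \<and>
     (\<forall>s\<in>I. c s \<in> \<pi> \<and> c s \<noteq> 0 \<and> proj_rank c s = 1)"

definition connecting_lines ::
    "real set \<Rightarrow> (real \<Rightarrow> real^2^3) \<Rightarrow> real set \<Rightarrow> (real \<Rightarrow> real^2^3) \<Rightarrow> (real^2^3) set set" where
  "connecting_lines I c J d = {span {c s, d t} | s t. s \<in> I \<and> t \<in> J}"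

definition join_of ::
    "real set \<Rightarrow> (real \<Rightarrow> real^2^3) \<Rightarrow> real set \<Rightarrow> (real \<Rightarrow> real^2^3) \<Rightarrow> (real^2^3) set" where
  "join_of I c J d = \<Union> (connecting_lines I c J d) - {0}"

definition lines_meeting :: "real set \<Rightarrow> (real \<Rightarrow> real^2^3) \<Rightarrow> (real^2^3) set set" where
  "lines_meeting I c = {L. subspace L \<and> dim L = 2 \<and> (\<exists>s\<in>I. c s \<in> L)}"


section \<open>Pfaffian systems in involution\<close>

text \<open>A system \<open>\<theta> = 0\<close> on an open subset of \<open>'v\<close> with independence condition \<open>\<omega>\<close>, both given by
  vector-valued 1-forms \<open>\<theta> g h\<close>, \<open>\<omega> g h\<close> (at the point \<open>g\<close>, on the tangent vector \<open>h\<close>).\<close>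

definition ext_d ::
    "('v::real_normed_vector \<Rightarrow> 'v \<Rightarrow> 'k::real_normed_vector) \<Rightarrow> 'v \<Rightarrow> 'v \<Rightarrow> 'v \<Rightarrow> 'k" where
  "ext_d \<theta> g h k = frechet_derivative (\<lambda>y. \<theta> y k) (at g) h - frechet_derivative (\<lambda>y. \<theta> y h) (at g) k"

definition polar_space ::
    "('v::real_normed_vector \<Rightarrow> 'v \<Rightarrow> 'k::real_normed_vector) \<Rightarrow> 'v \<Rightarrow> 'v set \<Rightarrow> 'v set" where
  "polar_space \<theta> g E = {k. \<theta> g k = 0 \<and> (\<forall>h\<in>E. ext_d \<theta> g h k = 0)}"

definition cauchy_space ::
    "('v::real_normed_vector \<Rightarrow> 'v \<Rightarrow> 'k::real_normed_vector) \<Rightarrow> 'v \<Rightarrow> 'v set" where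
  "cauchy_space \<theta> g = {h. \<theta> g h = 0 \<and> (\<forall>k. \<theta> g k = 0 \<longrightarrow> ext_d \<theta> g h k = 0)}"

text \<open>An integral element on which \<open>\<omega> g\<close> is an isomorphism is described by the inverse \<open>L\<close> of
  this isomorphism; the element itself is \<open>range L\<close>.\<close>

definition integral_elements ::
    "('v::real_normed_vector \<Rightarrow> 'v \<Rightarrow> 'k::real_normed_vector) \<Rightarrow> ('v \<Rightarrow> 'v \<Rightarrow> 'w::real_normed_vector)
      \<Rightarrow> 'v \<Rightarrow> ('w \<Rightarrow>\<^sub>L 'v) set" where
  "integral_elements \<theta> \<omega> g = {L. (\<forall>a. \<omega> g (blinfun_apply L a) = a \<and> \<theta> g (blinfun_apply L a) = 0) \<and>
     (\<forall>a b. ext_d \<theta> g (blinfun_apply L a) (blinfun_apply L b) = 0)}"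

text \<open>The codimension of the polar space of a generic \<open>k\<close>-dimensional subspace of \<open>E\<close>.\<close>

definition polar_codim ::
    "('v::euclidean_space \<Rightarrow> 'v \<Rightarrow> 'k::real_normed_vector) \<Rightarrow> 'v \<Rightarrow> 'v set \<Rightarrow> nat \<Rightarrow> int" where
  "polar_codim \<theta> g E k =
     Max {int DIM('v) - int (dim (polar_space \<theta> g F)) | F. subspace F \<and> F \<subseteq> E \<and> dim F = k}"

text \<open>Cartan characters \<open>s\<^sub>0, \<dots>, s\<^sub>n\<close>, \<open>n = DIM('w)\<close>, of the system induced on the quotient by the
  Cauchy characteristics, so that variables on which neither the system nor its exterior
  derivative depends (for moving frames: the choice of frames adapted to one and the same
  solution) are not counted. They only affect the last character, for which the codimension
  of \<open>E\<close> in the quotient replaces that of a polar space.\<close>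

definition cartan_character ::
    "('v::euclidean_space \<Rightarrow> 'v \<Rightarrow> 'k::real_normed_vector) \<Rightarrow> 'v \<Rightarrow> ('w::euclidean_space \<Rightarrow>\<^sub>L 'v)
      \<Rightarrow> nat \<Rightarrow> int" where
  "cartan_character \<theta> g L k =
     (let c = polar_codim \<theta> g (range (blinfun_apply L)); n = DIM('w) in
      if k = 0 then c 0
      else if k < n then c k - c (k - 1)
      else int DIM('v) - int (dim (cauchy_space \<theta> g)) - int n - c (n - 1))"

text \<open>Cartan's test: the integral elements at \<open>g\<close> form a nonempty affine family, and the number
  of parameters it depends on (again modulo Cauchy characteristics) is
  \<open>s\<^sub>1 + 2 s\<^sub>2 + \<dots> + n s\<^sub>n\<close>.\<close>

definition in_involution ::
    "('v::euclidean_space \<Rightarrow> 'v \<Rightarrow> 'k::real_normed_vector) \<Rightarrow> ('v \<Rightarrow> 'v \<Rightarrow> 'w::euclidean_space)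
      \<Rightarrow> 'v \<Rightarrow> bool" where
  "in_involution \<theta> \<omega> g \<longleftrightarrow>
     (let V = integral_elements \<theta> \<omega> g in
      V \<noteq> {} \<and> affine V \<and>
      (\<forall>L\<in>V. int (dim {M - N | M N. M \<in> V \<and> N \<in> V}) - int (DIM('w) * dim (cauchy_space \<theta> g)) =
         (\<Sum>k = 1..DIM('w). int k * cartan_character \<theta> g L k)))"


section \<open>The system defining smooth lines\<close>

text \<open>A frame is a matrix \<open>g\<close> with columns \<open>A\<^sub>0, A\<^sub>1, A\<^sub>2\<close>, where the index type \<open>3\<close> has the
  elements \<open>0, 1, 2\<close>. Since \<open>dA\<^sub>\<alpha> = \<Sum>\<^sub>\<beta> A\<^sub>\<beta> \<Omega>\<^sub>\<alpha>\<^sup>\<beta>\<close> means \<open>dg = g \<Omega>\<close>, the entry of \<open>\<Omega>\<close> in row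
  \<open>\<beta>\<close> and column \<open>\<alpha>\<close> is \<open>\<Omega>\<^sub>\<alpha>\<^sup>\<beta>\<close>.\<close>

definition is_frame :: "'a::plane_algebra^3^3 \<Rightarrow> bool" where
  "is_frame g \<longleftrightarrow> (\<forall>\<alpha>. coord_vector (column \<alpha> g)) \<and>
     (\<forall>\<alpha> \<beta>. \<alpha> \<noteq> \<beta> \<longrightarrow> \<not> adjacent (column \<alpha> g) (column \<beta> g)) \<and>
     dim {real_col (column \<alpha> g) j | \<alpha> j. True} = 6"

definition Omega :: "3 \<Rightarrow> 3 \<Rightarrow> 'a::plane_algebra^3^3 \<Rightarrow> 'a^3^3 \<Rightarrow> 'a" where
  "Omega \<alpha> \<beta> g h = (matrix_inv g ** h) $ \<beta> $ \<alpha>"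

text \<open>A moving frame \<open>G\<close> solves \<open>\<Omega>\<^sub>0\<^sup>2 = 0\<close> with \<open>\<Omega>\<^sub>0\<^sup>1\<close> independent iff \<open>A\<^sub>0\<close> describes an immersed
  surface whose tangent plane is that of the straight line \<open>A\<^sub>0 \<and> A\<^sub>1\<close>.\<close>

lemma frame_solution_iff:
  fixes G :: "real^2 \<Rightarrow> 'a::plane_algebra^3^3"
  assumes inv: "invertible (G w)" and G: "G differentiable (at w)"
  defines "\<phi> \<equiv> \<lambda>y. column 0 (G y)"
    and "DG \<equiv> frechet_derivative G (at w)"
  shows "(\<forall>v. Omega 0 2 (G w) (DG v) = 0) \<and> inj (\<lambda>v. Omega 0 1 (G w) (DG v)) \<longleftrightarrow>
     (\<forall>v P. frechet_derivative \<phi> (at w) v = P *s \<phi> w \<longrightarrow> v = 0) \<and>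
     tangent_space \<phi> w = straight_line (column 0 (G w)) (column 1 (G w))"
proof -
  let ?a = "column 0 (G w)" and ?b = "column 1 (G w)" and ?c = "column 2 (G w)"
  define D where "D = frechet_derivative \<phi> (at w)"
  have GD: "(G has_derivative DG) (at w)"
    using G unfolding DG_def by (simp add: frechet_derivative_works)
  have lin: "bounded_linear (\<lambda>g::'a^3^3. column 0 g)"
    by (intro linear_conv_bounded_linear[THEN iffD1] linearI) (simp_all add: column_def vec_eq_iff)
  have "(\<phi> has_derivative (\<lambda>v. column 0 (DG v))) (at w)"
    unfolding \<phi>_def by (rule bounded_linear.has_derivative[OF lin GD])
  then have D: "D = (\<lambda>v. column 0 (DG v))" unfolding D_def
    by (rule frechet_derivative_at[symmetric])
  have gi: "G w ** matrix_inv (G w) = mat 1" "matrix_inv (G w) ** G w = mat 1"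
    using someI_ex[OF inv[unfolded invertible_def]] unfolding matrix_inv_def by blast+
  let ?O = "\<lambda>b v. Omega 0 b (G w) (DG v)"
  have three3: "(3::3) = 0" by simp
  have split3: "(\<Sum>k\<in>UNIV. f k) = f 0 + f 1 + f (2::3)" for f :: "3 \<Rightarrow> 'a"
    using sum_3[of f] three3 by (simp add: algebra_simps)
  have mult_col: "(A ** B) $ i $ j = B $ 0 $ j * A $ i $ 0 + B $ 1 $ j * A $ i $ 1 + B $ 2 $ j * A $ i $ 2"
    for A B :: "'a^3^3" and i j
    by (simp only: matrix_matrix_mult_def split3 vec_lambda_beta mult.commute)
  have Dv: "D v = ?O 0 v *s ?a + ?O 1 v *s ?b + ?O 2 v *s ?c" for v
  proof -
    have "DG v = G w ** (matrix_inv (G w) ** DG v)"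
      by (simp only: matrix_mul_assoc gi matrix_mul_lid)
    then have *: "DG v $ i $ 0 = (G w ** (matrix_inv (G w) ** DG v)) $ i $ 0" for i
      by simp
    show ?thesis
      unfolding D vec_eq_iff Omega_def column_def
      by (simp only: * [unfolded mult_col[of "G w"]] vec_lambda_beta vector_add_component
          vector_smult_component simp_thms)
  qed
  have uniq: "p = p' \<and> q = q' \<and> r = r'"
    if "p *s ?a + q *s ?b + r *s ?c = p' *s ?a + q' *s ?b + r' *s ?c" for p q r p' q' r'
  proof -
    define x :: "'a^3" where "x = (\<chi> i. if i = 0 then p - p' else if i = 1 then q - q' else r - r')"
    have "G w *v x = 0"
      using that by (simp add: vec_eq_iff matrix_vector_mult_def split3 x_def column_def algebra_simps)
    then have "x = 0"
      by (metis gi(2) matrix_vector_mul_assoc matrix_vector_mul_lid matrix_vector_mult_0_right)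
    then have "x $ 0 = 0" "x $ 1 = 0" "x $ 2 = 0" by simp_all
    then show ?thesis by (simp add: x_def)
  qed
  have linDG: "linear DG" using GD by (simp add: has_derivative_linear)
  have linO: "linear (?O b)" for b
    by (intro linearI) (simp_all add: Omega_def linear_add[OF linDG] linear_cmul[OF linDG]
         matrix_matrix_mult_def sum.distrib scaleR_sum_right algebra_simps)
  have T: "tangent_space \<phi> w = {D v + P *s ?a | v P. True}"
    by (simp add: tangent_space_def D_def \<phi>_def)
  have phi: "\<phi> w = ?a" by (simp add: \<phi>_def)
  show ?thesis unfolding D_def[symmetric] phi T
  proof (intro iffI conjI allI impI)
    assume A: "(\<forall>v. ?O 2 v = 0) \<and> inj (?O 1)"
    { fix v P assume "D v = P *s ?a"
      then have "?O 0 v *s ?a + ?O 1 v *s ?b + ?O 2 v *s ?c = P *s ?a + 0 *s ?b + 0 *s ?c"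
        using Dv[of v] by simp
      then have "?O 1 v = ?O 1 0" using uniq linear_0[OF linO] by metis
      then show "v = 0" using A by (auto dest: injD) }
    have surj: "surj (?O 1)"
      using A DIM_plane_algebra[where ?'a='a]
      by (intro linear_injective_imp_surjective[OF linO]) auto
    show "{D v + P *s ?a | v P. True} = straight_line ?a ?b"
    proof (intro equalityI subsetI)
      fix x assume "x \<in> {D v + P *s ?a | v P. True}"
      then obtain v P where "x = D v + P *s ?a" by blast
      then have "x = (?O 0 v + P) *s ?a + ?O 1 v *s ?b"
        using A by (simp add: Dv vec_eq_iff algebra_simps)
      then show "x \<in> straight_line ?a ?b" unfolding straight_line_def by blast
    next
      fix x assume "x \<in> straight_line ?a ?b"
      then obtain P Q where x: "x = P *s ?a + Q *s ?b" unfolding straight_line_def by blast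
      obtain v where v: "Q = ?O 1 v" using surj by (metis surjD)
      have "x = D v + (P - ?O 0 v) *s ?a"
        using A by (simp add: x v Dv vec_eq_iff algebra_simps)
      then show "x \<in> {D v + P *s ?a | v P. True}" by blast
    qed
  next
    assume B: "(\<forall>v P. D v = P *s ?a \<longrightarrow> v = 0) \<and> {D v + P *s ?a | v P. True} = straight_line ?a ?b"
    { fix v
      have "D v + 0 *s ?a \<in> straight_line ?a ?b" using B by blast
      then obtain P Q where "D v = P *s ?a + Q *s ?b" by (auto simp: straight_line_def)
      then have "?O 0 v *s ?a + ?O 1 v *s ?b + ?O 2 v *s ?c = P *s ?a + Q *s ?b + 0 *s ?c"
        using Dv[of v] by simp
      then show "?O 2 v = 0" using uniq by blast }
    note 2 = this
    show "inj (?O 1)"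
      unfolding linear_injective_0[OF linO]
    proof (intro allI impI)
      fix v assume "?O 1 v = 0"
      then have "D v = ?O 0 v *s ?a" using Dv[of v] 2 by simp
      then show "v = 0" using B by blast
    qed
  qed
qed

definition depends_on_two_functions_of_one_variable :: "'a::plane_algebra itself \<Rightarrow> bool" where
  "depends_on_two_functions_of_one_variable _ \<longleftrightarrow>
     (\<forall>g :: 'a^3^3. is_frame g \<longrightarrow>
        in_involution (Omega 0 2) (Omega 0 1) g \<and>
        (\<forall>L \<in> integral_elements (Omega 0 2) (Omega 0 1) g.
           cartan_character (Omega 0 2) g L 1 = 2 \<and> cartan_character (Omega 0 2) g L 2 = 0))"

end

theory Submission
  imports Defs
begin

text \<open>Let \<open>A\<close> be the algebra. A two-dimensional algebra of real \<open>(2 \<times> 2)\<close>-matrices with unit has a cyclic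
vector, which turns \<open>\<real>\<^sup>2\<close> into a copy of \<open>A\<close> and \<open>\<real>\<^sup>6\<close> into a copy of \<open>A\<^sup>3\<close>. The generator of the
point with coordinates \<open>X\<close> is then the set of multiples of \<open>X\<close>, and over a parametrization \<open>\<phi>\<close> of \<open>\<gamma>\<close>
the submanifold \<open>S\<close> consists of the points \<open>b \<phi>(w)\<close> with \<open>b\<close> in \<open>A\<close>. All of the geometry of \<open>S\<close> is
read off from this description, for the three algebras at once.

The tangent subspace of \<open>S\<close> at \<open>b \<phi>(w)\<close> is spanned by the vectors \<open>b D\<phi>(w) v\<close> and \<open>a \<phi>(w)\<close>. It lies in
the submodule \<open>U(w)\<close> of the straight line tangent to \<open>\<gamma>\<close> at \<open>\<phi>(w)\<close>, whose real dimension is 4, and it is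
all of \<open>U(w)\<close> exactly if \<open>b\<close> is a unit (\<open>nonsingular_iff_regular\<close>). Hence the foci are the points for
which \<open>b\<close> is a zero divisor, and there are none over the field of complex numbers. At all other points
the tangent subspace \<open>U(w)\<close> is the same along the whole generator, so that the Gauss map has rank at
most 2. Differentiating the orthogonal projection onto \<open>U(w)\<close> in a direction \<open>v\<close> gives 0 iff the
derivatives in this direction of the sections of \<open>U\<close> stay in \<open>U(w)\<close>. By the symmetry of second
derivatives this says that \<open>v\<close> lies in the kernel of the second fundamental form (\<open>gauss_derivative\<close>),
which is why rank 2 amounts to nondegeneracy.

The plane curves come from elements \<open>c\<close> of \<open>A\<close> whose multiples are just the real multiples of \<open>c\<close>: the
two idempotents \<open>(1 \<plusminus> e) / 2\<close> of the double numbers, and \<open>\<epsilon>\<close> for the dual numbers. The vectors \<open>c X\<close> form a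
2-plane of \<open>\<real>P\<^sup>5\<close>, which the generator of \<open>X\<close> meets in the point \<open>c X\<close>. As \<open>c U(w)\<close> has real dimension 2,
the map \<open>w \<mapsto> c \<phi>(w)\<close> to this plane has rank 1 and traces a curve. For the double numbers the kernels of
the two maps are transversal, therefore the inverse function theorem makes the parameters of the two
curves local coordinates on \<open>\<gamma>\<close> (\<open>transversal_rank_one_maps\<close>), and a generator is the line joining a
point of one curve to a point of the other, where all pairs of points occur.

For the dependence on two functions, the structure equations of moving frames say that
\<open>d\<Omega>\<^sub>0\<^sup>2 = \<Omega>\<^sub>0\<^sup>1 \<and> \<Omega>\<^sub>1\<^sup>2\<close> modulo \<open>\<Omega>\<^sub>0\<^sup>2\<close>. For any system with one such equation the integral elements are
given by \<open>\<Omega>\<^sub>1\<^sup>2 = \<beta> \<Omega>\<^sub>0\<^sup>1\<close> with \<open>\<beta>\<close> in \<open>A\<close>, which leaves two real parameters up to Cauchy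
characteristics, and the polar space of a line
spanned by \<open>x\<close> has codimension \<open>2 + dim x A\<close>. This is 4 for a unit \<open>x\<close>, so that the characters are
\<open>s\<^sub>1 = 2\<close> and \<open>s\<^sub>2 = 0\<close>, and \<open>s\<^sub>1 + 2 s\<^sub>2 = 2\<close> is Cartan's test.\<close>

section \<open>Linear algebra\<close>

text \<open>The orthogonal complement of the kernel within \<open>V\<close> is mapped bijectively onto \<open>f ` V\<close>. The codomain
may be any real vector space, so that the lemma also counts parameters in spaces of operators.\<close>

lemma rank_nullity:
  fixes f :: "'a::euclidean_space \<Rightarrow> 'b::real_vector"
  assumes f: "linear f" and V: "subspace V"
  shows "dim (f ` V) + dim {x \<in> V. f x = 0} = dim V"
proof -
  define K where "K = {x \<in> V. f x = 0}"
  define C where "C = {y \<in> V. \<forall>x\<in>K. orthogonal x y}"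
  have K: "subspace K"
    using V f unfolding K_def subspace_def
    by (auto simp: linear_0 linear_add linear_cmul)
  have C: "subspace C"
    using V unfolding C_def subspace_def by (auto simp: orthogonal_def inner_right_distrib)
  have dims: "dim C + dim K = dim V"
    unfolding C_def by (rule dim_subspace_orthogonal_to_vectors[OF K V]) (auto simp: K_def)
  have "inj_on f C"
  proof (rule inj_onI)
    fix x y assume xy: "x \<in> C" "y \<in> C" "f x = f y"
    then have "x - y \<in> C" using C by (simp add: subspace_diff)
    moreover have "x - y \<in> K"
      using xy V f by (auto simp: K_def C_def linear_diff subspace_diff)
    ultimately have "orthogonal (x - y) (x - y)" by (auto simp: C_def)
    then show "x = y" by (simp add: orthogonal_def)
  qed
  then have "dim (f ` C) = dim C"
    using C by (intro dim_image_eq[OF f]) (simp add: span_eq_iff[THEN iffD2])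
  moreover have "f ` C = f ` V"
  proof
    show "f ` V \<subseteq> f ` C"
    proof
      fix z assume "z \<in> f ` V"
      then obtain v where v: "v \<in> V" "z = f v" by auto
      obtain y w where yw: "y \<in> span K" "\<And>u. u \<in> span K \<Longrightarrow> orthogonal w u" "v = y + w"
        using orthogonal_subspace_decomp_exists[of K v] by blast
      have y: "y \<in> K" using yw(1) K by (simp add: span_eq_iff[THEN iffD2])
      have "w = v - y" using yw by simp
      then have "w \<in> V" using v y V by (auto simp: K_def subspace_diff)
      moreover have "\<forall>x\<in>K. orthogonal x w"
        using yw(2) by (simp add: orthogonal_commute span_base)
      moreover have "z = f w" using v y yw(3) f by (simp add: K_def linear_add)
      ultimately show "z \<in> f ` C" by (auto simp: C_def)
    qed
  qed (auto simp: C_def)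
  ultimately show ?thesis using dims by (simp add: K_def)
qed

lemma full_rank_imp_inj:
  fixes f :: "'a::euclidean_space \<Rightarrow> 'b::real_vector"
  assumes f: "linear f" and "DIM('a) \<le> dim (range f)"
  shows "inj f"
proof -
  have "dim {x. f x = 0} = 0"
    using rank_nullity[OF f subspace_UNIV] assms(2) by (simp del: dim_eq_0)
  then have "{x. f x = 0} \<subseteq> {0}" by (simp only: dim_eq_0)
  then show ?thesis unfolding linear_injective_0[OF f] by blast
qed

lemma dim_kernel_surjective:
  fixes f :: "'v::euclidean_space \<Rightarrow> 'b::euclidean_space"
  assumes "linear f" "surj f"
  shows "dim {x. f x = 0} + DIM('b) = DIM('v)"
  using rank_nullity[OF assms(1) subspace_UNIV] assms(2) by simp

lemma span_scaled_singleton: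
  fixes u :: "'b::real_vector"
  assumes "c \<noteq> 0" shows "span {c *\<^sub>R u} = span {u}"
proof -
  have "u \<in> span {c *\<^sub>R u}"
    using span_scale[OF span_base[of "c *\<^sub>R u" "{c *\<^sub>R u}"], of "1 / c"] assms by simp
  moreover have "c *\<^sub>R u \<in> span {u}" by (simp add: span_base span_scale)
  ultimately show ?thesis by (simp add: span_eq)
qed

section \<open>Units and cyclic vectors\<close>

lemma DIM_algebra: "DIM('a::plane_algebra) = 2"
  by (rule DIM_plane_algebra)

lemma linear_mult: "linear (\<lambda>x. b * x)" for b :: "'a::plane_algebra"
  by (intro linearI) (simp_all add: algebra_simps)

lemma linear_smult_right: "linear (\<lambda>X. a *s X)" for a :: "'a::plane_algebra"
  by (intro linearI) (simp_all add: vec_eq_iff algebra_simps)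

lemma linear_smult_left: "linear (\<lambda>a. a *s X)" for X :: "'a::plane_algebra^'n"
  by (intro linearI) (simp_all add: vec_eq_iff algebra_simps)

lemma regular_imp_unit:
  fixes b :: "'a::plane_algebra"
  assumes "regular b"
  shows "\<exists>c. c * b = 1"
proof -
  have "inj (\<lambda>x. b * x)"
    unfolding linear_injective_0[OF linear_mult] using assms by (simp add: regular_def)
  then have "surj (\<lambda>x. b * x)"
    by (rule linear_injective_imp_surjective[OF linear_mult]) simp
  then obtain c where "1 = b * c" by (rule surjE)
  then show ?thesis by (metis mult.commute)
qed

text \<open>If some \<open>a \<noteq> 0\<close> kills \<open>p \<noteq> 0\<close>, then \<open>a\<close> is not a real number, hence \<open>1\<close> and \<open>a\<close> span the algebra, and
every element acts on \<open>p\<close> as its component along \<open>1\<close> does.\<close>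

lemma mat_rep_eigenvector_if_not_cyclic:
  fixes j :: "'a::plane_algebra" and p :: "real^2"
  assumes "\<not> inj (\<lambda>a::'a. mat_rep a *v p)"
  shows "\<exists>r. mat_rep j *v p = r *\<^sub>R p"
proof (cases "p = 0")
  case True then show ?thesis by simp
next
  case False
  have lin: "linear (\<lambda>a::'a. mat_rep a *v p)"
    by (intro linearI)
      (simp_all add: mat_rep_add mat_rep_scaleR matrix_vector_mult_add_rdistrib scaleR_matrix_vector_assoc)
  obtain a :: 'a where a: "mat_rep a *v p = 0" "a \<noteq> 0"
    using assms unfolding linear_injective_0[OF lin] by blast
  have "a \<notin> span {1}"
  proof
    assume "a \<in> span {1}"
    then obtain r where "a = r *\<^sub>R 1" by (auto simp: span_singleton)
    then show False using a False
      by (auto simp: mat_rep_scaleR mat_rep_one scaleR_matrix_vector_assoc[symmetric])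
  qed
  then have "dim {a, 1} = DIM('a)"
    by (simp add: dim_insert DIM_algebra)
  then have "j \<in> span {a, 1}" by (simp only: dim_eq_full) simp
  then obtain k r where "j - k *\<^sub>R a = r *\<^sub>R 1"
    by (auto simp: span_breakdown_eq span_singleton)
  then have "j = k *\<^sub>R a + r *\<^sub>R 1" by (simp add: algebra_simps)
  then have "mat_rep j *v p = r *\<^sub>R p"
    using a by (simp add: mat_rep_add mat_rep_scaleR mat_rep_one matrix_vector_mult_add_rdistrib
        scaleR_matrix_vector_assoc[symmetric])
  then show ?thesis by blast
qed

text \<open>Otherwise every vector would be an eigenvector of every element of the algebra. A matrix for which
both unit vectors and their sum are eigenvectors is scalar, so the algebra would be one-dimensional.\<close>

lemma exists_cyclic_vector: "\<exists>p. inj (\<lambda>a::'a::plane_algebra. mat_rep a *v p)"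
proof (rule ccontr)
  assume none: "\<not> ?thesis"
  have eig: "\<exists>r. mat_rep j *v p = r *\<^sub>R p" for j :: 'a and p
    using none mat_rep_eigenvector_if_not_cyclic by blast
  have "j \<in> span {1}" for j :: 'a
  proof -
    obtain r where r: "mat_rep j *v vector [1, 0] = r *\<^sub>R vector [1, 0]" using eig by blast
    obtain s where s: "mat_rep j *v vector [0, 1] = s *\<^sub>R vector [0, 1]" using eig by blast
    obtain t where t: "mat_rep j *v vector [1, 1] = t *\<^sub>R vector [1, 1]" using eig by blast
    have "mat_rep j = r *\<^sub>R mat 1"
      using r s t by (auto simp: vec_eq_iff forall_2 matrix_vector_mult_def sum_2 mat_def)
    then have "j = r *\<^sub>R 1"
      by (intro mat_rep_inject) (simp add: mat_rep_scaleR mat_rep_one)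
    then show ?thesis by (simp add: span_singleton)
  qed
  then have "DIM('a) \<le> dim {1 :: 'a}"
    by (metis UNIV_I dim_UNIV dim_span dim_subset subsetI)
  also have "\<dots> \<le> 1" by (simp add: dim_insert)
  finally show False by (simp add: DIM_algebra)
qed

definition cyclic_vector :: "'a::plane_algebra itself \<Rightarrow> real^2" where
  "cyclic_vector _ = (SOME p. inj (\<lambda>a::'a. mat_rep a *v p))"

text \<open>The identification of \<open>A\<^sup>3\<close> with \<open>\<real>\<^sup>6\<close>; \<open>scalar_of\<close> is the corresponding one of \<open>\<real>\<^sup>2\<close> with \<open>A\<close>.\<close>

definition real_coords :: "'a::plane_algebra^3 \<Rightarrow> real^2^3" where
  "real_coords X = (\<chi> i. mat_rep (X $ i) *v cyclic_vector TYPE('a))"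

definition scalar_of :: "real^2 \<Rightarrow> 'a::plane_algebra" where
  "scalar_of = inv (\<lambda>a::'a. mat_rep a *v cyclic_vector TYPE('a))"

lemma bij_cyclic: "bij (\<lambda>a::'a::plane_algebra. mat_rep a *v cyclic_vector TYPE('a))"
  and linear_cyclic: "linear (\<lambda>a::'a::plane_algebra. mat_rep a *v cyclic_vector TYPE('a))"
proof -
  show lin: "linear (\<lambda>a::'a. mat_rep a *v cyclic_vector TYPE('a))"
    by (intro linearI)
      (simp_all add: mat_rep_add mat_rep_scaleR matrix_vector_mult_add_rdistrib scaleR_matrix_vector_assoc)
  have "inj (\<lambda>a::'a. mat_rep a *v cyclic_vector TYPE('a))"
    unfolding cyclic_vector_def by (rule someI_ex[OF exists_cyclic_vector])
  with lin show "bij (\<lambda>a::'a. mat_rep a *v cyclic_vector TYPE('a))"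
    unfolding bij_def by (simp add: linear_injective_imp_surjective DIM_algebra)
qed

lemma bij_scalar_of: "bij (scalar_of :: _ \<Rightarrow> 'a::plane_algebra)"
  unfolding scalar_of_def by (rule bij_imp_bij_inv[OF bij_cyclic])

lemma mat_rep_scalar_of: "mat_rep (scalar_of p :: 'a::plane_algebra) *v cyclic_vector TYPE('a) = p"
  unfolding scalar_of_def using bij_cyclic[where 'a='a]
  by (rule bij_inv_eq_iff[THEN iffD1]) simp

lemma linear_scalar_of: "linear (scalar_of :: _ \<Rightarrow> 'a::plane_algebra)"
proof -
  have eqI: "a = b" if "mat_rep a *v cyclic_vector TYPE('a) = mat_rep b *v cyclic_vector TYPE('a)" for a b :: 'a
    using bij_is_inj[OF bij_cyclic[where 'a='a]] that by (auto dest: injD)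
  show ?thesis
    by (intro linearI eqI)
      (simp_all add: mat_rep_scalar_of linear_add[OF linear_cyclic] linear_cmul[OF linear_cyclic])
qed

lemma linear_real_coords: "linear real_coords"
  by (intro linearI)
    (simp_all add: real_coords_def vec_eq_iff linear_add[OF linear_cyclic] linear_cmul[OF linear_cyclic])

lemma bij_real_coords: "bij (real_coords :: 'a::plane_algebra^3 \<Rightarrow> _)"
proof -
  have "inj (real_coords :: 'a^3 \<Rightarrow> _)"
    using bij_is_inj[OF bij_cyclic[where 'a='a]]
    by (auto simp: inj_def real_coords_def vec_eq_iff)
  then show ?thesis
    unfolding bij_def by (simp add: linear_injective_imp_surjective linear_real_coords DIM_algebra)
qed

text \<open>The matrix of \<open>X\<close> sends \<open>p = b p\<^sub>0\<close>, where \<open>p\<^sub>0\<close> is the cyclic vector, to \<open>X b p\<^sub>0 = (b X) p\<^sub>0\<close>. So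
homogeneous coordinates on a generator are the same as multipliers from the algebra.\<close>

lemma real_col_combination:
  "p $ 1 *\<^sub>R real_col X 1 + p $ 2 *\<^sub>R real_col X 2 = real_coords (scalar_of p *s X)"
proof -
  have "(p $ 1 *\<^sub>R real_col X 1 + p $ 2 *\<^sub>R real_col X 2) $ i = mat_rep (X $ i) *v p" for i
    by (simp add: real_col_def vec_eq_iff column_def matrix_vector_mult_def sum_2 mult.commute)
  also have "\<dots> i = mat_rep (X $ i) *v (mat_rep (scalar_of p :: 'a) *v cyclic_vector TYPE('a))" for i
    by (simp add: mat_rep_scalar_of)
  also have "\<dots> i = real_coords (scalar_of p *s X) $ i" for i
    by (simp add: real_coords_def matrix_vector_mul_assoc mat_rep_mult[symmetric] mult.commute)
  finally show ?thesis by (simp add: vec_eq_iff)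
qed

lemma real_col_1: "real_col X 1 = real_coords (scalar_of (axis 1 1) *s X)"
  and real_col_2: "real_col X 2 = real_coords (scalar_of (axis 2 1) *s X)"
  using real_col_combination[of "axis 1 1" X] real_col_combination[of "axis 2 1" X]
  by (simp_all add: axis_def)

lemma linear_real_col: "linear (\<lambda>X::'a::plane_algebra^3. real_col X k)"
proof -
  have "linear (\<lambda>X::'a^3. real_coords (scalar_of (axis k 1) *s X))"
    using linear_compose[OF linear_smult_right linear_real_coords] by (simp add: o_def)
  moreover have "(\<lambda>X::'a^3. real_col X k) = (\<lambda>X. real_coords (scalar_of (axis k 1) *s X))"
    using exhaust_2[of k] by (auto simp: real_col_1 real_col_2)
  ultimately show ?thesis by simp
qed

lemma span_real_cols:
  "span {real_col X 1, real_col X 2} = range (\<lambda>a. real_coords (a *s X))"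
proof -
  have "span {real_col X 1, real_col X 2} = range (\<lambda>p::real^2. p $ 1 *\<^sub>R real_col X 1 + p $ 2 *\<^sub>R real_col X 2)"
  proof safe
    fix x assume "x \<in> span {real_col X 1, real_col X 2}"
    then obtain k r where "x - k *\<^sub>R real_col X 1 = r *\<^sub>R real_col X 2"
      by (auto simp: span_breakdown_eq span_singleton)
    then have "x = (vector [k, r] :: real^2) $ 1 *\<^sub>R real_col X 1 + (vector [k, r] :: real^2) $ 2 *\<^sub>R real_col X 2"
      by (simp add: algebra_simps)
    then show "x \<in> range (\<lambda>p::real^2. p $ 1 *\<^sub>R real_col X 1 + p $ 2 *\<^sub>R real_col X 2)" by blast
  next
    fix p :: "real^2"
    show "p $ 1 *\<^sub>R real_col X 1 + p $ 2 *\<^sub>R real_col X 2 \<in> span {real_col X 1, real_col X 2}"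
      by (intro span_add span_scale span_base) simp_all
  qed
  also have "\<dots> = range (\<lambda>p. real_coords (scalar_of p *s X))" by (simp add: real_col_combination)
  also have "\<dots> = (\<lambda>a. real_coords (a *s X)) ` range scalar_of" by (simp add: image_image)
  finally show ?thesis by (simp add: bij_is_surj[OF bij_scalar_of])
qed

lemma generator_eq: "generator X = range (\<lambda>a. real_coords (a *s X))"
  by (simp add: generator_def span_real_cols)

lemma coord_vector_free:
  assumes "coord_vector X" "a *s X = 0"
  shows "a = 0"
proof -
  have lin: "linear (\<lambda>a. real_coords (a *s X))"
    using linear_compose[OF linear_smult_left linear_real_coords] by (simp add: o_def)
  have "dim (range (\<lambda>a. real_coords (a *s X))) = 2"
    using assms(1) by (simp add: coord_vector_def span_real_cols[symmetric] dim_eq_card_independent)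
  then have "inj (\<lambda>a. real_coords (a *s X))"
    by (intro full_rank_imp_inj[OF lin]) (simp add: DIM_algebra)
  then show ?thesis
    using assms(2) unfolding linear_injective_0[OF lin] by (simp add: linear_0[OF linear_real_coords])
qed

text \<open>The four real columns span a space of dimension 4, which is also the real dimension of the space of
coefficient pairs \<open>(P, Q)\<close>, so the linear combination is an injective function of them.\<close>

lemma nonadjacent_free:
  fixes Y Z :: "'a::plane_algebra^3"
  assumes "\<not> adjacent Y Z" "P *s Y + Q *s Z = 0"
  shows "P = 0" "Q = 0"
proof -
  define f where "f = (\<lambda>(P, Q). real_coords (P *s Y + Q *s Z))"
  have lin: "linear f"
    unfolding f_def
    by (intro linearI) (auto simp: linear_add[OF linear_real_coords] linear_cmul[OF linear_real_coords]
      linear_add[OF linear_smult_left] linear_cmul[OF linear_smult_left] algebra_simps)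
  have mem: "real_coords (P *s Y + Q *s Z) \<in> range f" for P Q
    unfolding f_def by (rule range_eqI[of _ _ "(P, Q)"]) simp
  have "{real_col Y 1, real_col Y 2, real_col Z 1, real_col Z 2} \<subseteq> range f"
    using mem[of _ 0] mem[of 0] by (auto simp: real_col_1 real_col_2)
  from dim_subset[OF this] have "4 \<le> dim (range f)"
    using assms(1) by (simp add: adjacent_def)
  then have "DIM('a \<times> 'a) \<le> dim (range f)"
    by (simp add: DIM_algebra)
  then have "inj f" by (rule full_rank_imp_inj[OF lin])
  moreover have "f (P, Q) = 0" using assms(2) by (simp add: f_def linear_0[OF linear_real_coords])
  ultimately have "(P, Q) = 0" unfolding linear_injective_0[OF lin] by blast
  then show "P = 0" "Q = 0" by (simp_all add: zero_prod_def)
qed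

lemma regular_scalar_of:
  "regular (scalar_of p) \<Longrightarrow> p \<noteq> 0"
  by (metis linear_0[OF linear_scalar_of] mult_zero_left regular_def zero_neq_one)

section \<open>Tangent spaces of smooth lines\<close>

lemma smooth_on_imp_differentiable: "smooth_on f W \<Longrightarrow> x \<in> W \<Longrightarrow> f differentiable (at x)"
  unfolding smooth_on_def by (metis Ck_on.simps(2))

lemma smooth_on_imp_C1:
  assumes "smooth_on f W"
  shows "continuous_on W (\<lambda>x. frechet_derivative f (at x) v)"
  using assms unfolding smooth_on_def by (metis Ck_on.simps)

lemma smooth_on_imp_C2:
  assumes "smooth_on f W"
    and "x \<in> W"
  shows "(\<lambda>x. frechet_derivative f (at x) v) differentiable (at x)"
proof -
  have "Ck_on (Suc (Suc 0)) f W" using assms(1) unfolding smooth_on_def by blast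
  then show ?thesis using assms(2) by simp
qed

lemma local_param_coord_vector:
  assumes lp: "local_param \<gamma> W \<phi>" and w: "w \<in> W"
  shows "coord_vector (\<phi> w)"
proof -
  have "open_part \<gamma> (saturation (\<phi> ` W))"
    using lp unfolding local_param_def by blast
  moreover have "\<phi> w \<in> saturation (\<phi> ` W)"
    unfolding saturation_def using w by (intro CollectI exI[of _ 1] exI[of _ "\<phi> w"]) (auto simp: regular_def)
  ultimately show ?thesis by (auto simp: open_part_def plane_subset_def)
qed

text \<open>The algebraic content of being the straight line through two non-adjacent points.\<close>

definition free_rank_two :: "('a::plane_algebra^3) set \<Rightarrow> bool" where
  "free_rank_two U \<longleftrightarrow> (\<exists>Y Z. U = straight_line Y Z \<and> (\<forall>P Q. P *s Y + Q *s Z = 0 \<longrightarrow> P = 0 \<and> Q = 0))"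

lemma smooth_line_tangent_space:
  assumes "smooth_line \<gamma>" "local_param \<gamma> W \<phi>" "w \<in> W"
  shows "free_rank_two (tangent_space \<phi> w)"
  using assms nonadjacent_free unfolding smooth_line_def free_rank_two_def by metis

lemma straight_line_smult:
  fixes Y Z :: "'a::plane_algebra^3"
  assumes "X \<in> straight_line Y Z" shows "a *s X \<in> straight_line Y Z"
proof -
  obtain P Q where "X = P *s Y + Q *s Z" using assms by (auto simp: straight_line_def)
  then have "a *s X = (a * P) *s Y + (a * Q) *s Z" by (simp add: vec_eq_iff algebra_simps)
  then show ?thesis unfolding straight_line_def by blast
qed

lemma straight_line_add:
  fixes Y Z :: "'a::plane_algebra^3"
  assumes "X \<in> straight_line Y Z" "X' \<in> straight_line Y Z" shows "X + X' \<in> straight_line Y Z"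
proof -
  obtain P Q where "X = P *s Y + Q *s Z" using assms by (auto simp: straight_line_def)
  moreover obtain P' Q' where "X' = P' *s Y + Q' *s Z" using assms by (auto simp: straight_line_def)
  ultimately have "X + X' = (P + P') *s Y + (Q + Q') *s Z" by (simp add: vec_eq_iff algebra_simps)
  then show ?thesis unfolding straight_line_def by blast
qed

lemma free_rank_two_smult: "free_rank_two U \<Longrightarrow> X \<in> U \<Longrightarrow> a *s X \<in> U"
  and free_rank_two_add: "free_rank_two U \<Longrightarrow> X \<in> U \<Longrightarrow> X' \<in> U \<Longrightarrow> X + X' \<in> U"
  unfolding free_rank_two_def using straight_line_smult straight_line_add by metis+

lemma scaleR_eq_smult: "r *\<^sub>R X = of_real r *s X" for X :: "'a::plane_algebra^'n"
  unfolding vec_eq_iff by (intro allI) (simp add: scaleR_conv_of_real[of r "X $ _"])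

lemma free_rank_two_subspace:
  assumes "free_rank_two U" shows "subspace U"
proof -
  have "0 \<in> U"
    using assms unfolding free_rank_two_def straight_line_def
    by (auto intro!: exI[of _ 0])
  then show ?thesis
    using free_rank_two_smult[OF assms] free_rank_two_add[OF assms]
    by (auto simp: subspace_def scaleR_eq_smult)
qed

lemma dim_real_coords_image: "dim (real_coords ` S) = dim S"
  by (rule dim_image_eq[OF linear_real_coords])
    (rule inj_on_subset[OF bij_is_inj[OF bij_real_coords] subset_UNIV])

lemma dim_free_rank_two:
  assumes "free_rank_two (U :: ('a::plane_algebra^3) set)"
  shows "dim U = 4"
proof -
  obtain Y Z where U: "U = straight_line Y Z"
    and free: "\<And>P Q. P *s Y + Q *s Z = 0 \<Longrightarrow> P = 0 \<and> Q = 0"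
    using assms unfolding free_rank_two_def by blast
  define f where "f = (\<lambda>(P, Q). P *s Y + Q *s Z)"
  have lin: "linear f"
    unfolding f_def by (intro linearI)
      (auto simp: linear_add[OF linear_smult_left] linear_cmul[OF linear_smult_left] algebra_simps)
  have "inj f"
    unfolding linear_injective_0[OF lin] using free by (auto simp: f_def zero_prod_def)
  then have "dim (range f) = DIM('a \<times> 'a)"
    by (subst dim_image_eq[OF lin]) auto
  moreover have "range f = U" unfolding U straight_line_def f_def by force
  ultimately show ?thesis by (simp add: DIM_algebra)
qed

lemma tangent_space_members:
  assumes "\<phi> differentiable (at w)"
  shows "P *s \<phi> w \<in> tangent_space \<phi> w" "frechet_derivative \<phi> (at w) v \<in> tangent_space \<phi> w"
proof -
  have "linear (frechet_derivative \<phi> (at w))" by (rule linear_frechet_derivative[OF assms])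
  then have "P *s \<phi> w = frechet_derivative \<phi> (at w) 0 + P *s \<phi> w" by (simp add: linear_0)
  then show "P *s \<phi> w \<in> tangent_space \<phi> w" unfolding tangent_space_def by blast
  have "frechet_derivative \<phi> (at w) v = frechet_derivative \<phi> (at w) v + 0 *s \<phi> w" by simp
  then show "frechet_derivative \<phi> (at w) v \<in> tangent_space \<phi> w" unfolding tangent_space_def by blast
qed

section \<open>The tangent spaces of the ruled submanifold\<close>

lemma ruling_eq: "ruling \<phi> (w, p) = real_coords (scalar_of p *s \<phi> w)"
  by (simp add: ruling_def real_col_combination)

lemma has_derivative_real_col:
  fixes \<phi> :: "real^2 \<Rightarrow> 'a::plane_algebra^3"
  assumes "\<phi> differentiable (at w)"
  shows "((\<lambda>z. real_col (\<phi> (fst z)) k) has_derivative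
    (\<lambda>\<zeta>. real_col (frechet_derivative \<phi> (at w) (fst \<zeta>)) k)) (at (w, p))"
proof -
  have "(\<phi> has_derivative frechet_derivative \<phi> (at w)) (at (fst (w, p)))"
    using assms by (simp add: frechet_derivative_works)
  then have "((\<lambda>z. \<phi> (fst z)) has_derivative (\<lambda>\<zeta>. frechet_derivative \<phi> (at w) (fst \<zeta>))) (at (w, p))"
    by (rule has_derivative_compose[rotated]) (auto intro!: derivative_eq_intros)
  then show ?thesis
    by (rule bounded_linear.has_derivative[OF linear_real_col[unfolded linear_conv_bounded_linear]])
qed

lemma has_derivative_ruling:
  fixes \<phi> :: "real^2 \<Rightarrow> 'a::plane_algebra^3"
  assumes "\<phi> differentiable (at w)"
  shows "(ruling \<phi> has_derivative (\<lambda>(v, q).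
    real_coords (scalar_of p *s frechet_derivative \<phi> (at w) v + scalar_of q *s \<phi> w))) (at (w, p))"
proof -
  let ?D = "frechet_derivative \<phi> (at w)"
  have nth: "((\<lambda>z. snd z $ k) has_derivative (\<lambda>\<zeta>. snd \<zeta> $ k)) (at (w, p))" for k :: 2
    by (rule bounded_linear.has_derivative[OF bounded_linear_vec_nth has_derivative_snd[OF has_derivative_ident]])
  have eq: "ruling \<phi> = (\<lambda>z. (snd z $ 1) *\<^sub>R real_col (\<phi> (fst z)) 1 + (snd z $ 2) *\<^sub>R real_col (\<phi> (fst z)) 2)"
    by (auto simp: ruling_def)
  have "(ruling \<phi> has_derivative (\<lambda>\<zeta>.
      ((p $ 1) *\<^sub>R real_col (?D (fst \<zeta>)) 1 + (snd \<zeta> $ 1) *\<^sub>R real_col (\<phi> w) 1) +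
      ((p $ 2) *\<^sub>R real_col (?D (fst \<zeta>)) 2 + (snd \<zeta> $ 2) *\<^sub>R real_col (\<phi> w) 2))) (at (w, p))"
    unfolding eq
    using has_derivative_add[OF has_derivative_scaleR[OF nth has_derivative_real_col[OF assms]]
        has_derivative_scaleR[OF nth has_derivative_real_col[OF assms]]] by (simp add: )
  moreover have "(\<lambda>\<zeta>.
      ((p $ 1) *\<^sub>R real_col (?D (fst \<zeta>)) 1 + (snd \<zeta> $ 1) *\<^sub>R real_col (\<phi> w) 1) +
      ((p $ 2) *\<^sub>R real_col (?D (fst \<zeta>)) 2 + (snd \<zeta> $ 2) *\<^sub>R real_col (\<phi> w) 2)) =
    (\<lambda>(v, q). real_coords (scalar_of p *s ?D v + scalar_of q *s \<phi> w))"
    by (auto simp: fun_eq_iff linear_add[OF linear_real_coords] real_col_combination[symmetric])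
  ultimately show ?thesis by simp
qed

text \<open>The summand \<open>a \<phi>(w)\<close> comes from moving along the generator, the other one from moving along \<open>\<gamma>\<close>.\<close>

lemma proj_tangent_ruling:
  fixes \<phi> :: "real^2 \<Rightarrow> 'a::plane_algebra^3"
  assumes "\<phi> differentiable (at w)"
  shows "proj_tangent (ruling \<phi>) (w, p) =
    real_coords ` {scalar_of p *s frechet_derivative \<phi> (at w) v + a *s \<phi> w | v a. True}"
proof -
  let ?D = "frechet_derivative \<phi> (at w)"
  let ?F = "\<lambda>(v, q). real_coords (scalar_of p *s ?D v + scalar_of q *s \<phi> w)"
  have D: "linear ?D" by (rule linear_frechet_derivative[OF assms])
  have F: "frechet_derivative (ruling \<phi>) (at (w, p)) = ?F"
    by (rule frechet_derivative_at[OF has_derivative_ruling[OF assms], symmetric])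
  have lin: "linear ?F" using has_derivative_linear[OF has_derivative_ruling[OF assms]] .
  have "ruling \<phi> (w, p) = ?F (0, p)" by (simp add: ruling_eq linear_0[OF D])
  then have "ruling \<phi> (w, p) \<in> range ?F" by (rule range_eqI)
  then have "proj_tangent (ruling \<phi>) (w, p) = span (range ?F)"
    by (simp add: proj_tangent_def F insert_absorb)
  also have "\<dots> = range ?F"
    by (rule span_eq_iff[THEN iffD2, OF linear_subspace_image[OF lin subspace_UNIV]])
  also have "\<dots> = real_coords ` {scalar_of p *s ?D v + scalar_of q *s \<phi> w | v q. True}"
    by force
  also have "{scalar_of p *s ?D v + scalar_of q *s \<phi> w | v q. True} =
      {scalar_of p *s ?D v + a *s \<phi> w | v a. True}"
    using bij_is_surj[OF bij_scalar_of[where 'a='a]] by (metis (no_types, opaque_lifting) surjD)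
  finally show ?thesis .
qed

lemma proj_tangent_ruling_subset:
  fixes \<phi> :: "real^2 \<Rightarrow> 'a::plane_algebra^3"
  assumes "\<phi> differentiable (at w)" "free_rank_two (tangent_space \<phi> w)"
  shows "proj_tangent (ruling \<phi>) (w, p) \<subseteq> real_coords ` tangent_space \<phi> w"
  unfolding proj_tangent_ruling[OF assms(1)]
  using assms by (auto intro!: imageI free_rank_two_add free_rank_two_smult tangent_space_members)

lemma not_singular_iff:
  "\<not> singular_at \<phi> (w, p) \<longleftrightarrow> 4 \<le> dim (proj_tangent (ruling \<phi>) (w, p))"
  by (auto simp: singular_at_def proj_rank_def)

lemma proj_tangent_ruling_nonsingular:
  fixes \<phi> :: "real^2 \<Rightarrow> 'a::plane_algebra^3"
  assumes \<phi>: "\<phi> differentiable (at w)" and U: "free_rank_two (tangent_space \<phi> w)"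
    and ns: "\<not> singular_at \<phi> (w, p)"
  shows "proj_tangent (ruling \<phi>) (w, p) = real_coords ` tangent_space \<phi> w"
proof (rule subspace_dim_equal)
  show "subspace (real_coords ` tangent_space \<phi> w)"
    by (rule linear_subspace_image[OF linear_real_coords free_rank_two_subspace[OF U]])
  show "dim (real_coords ` tangent_space \<phi> w) \<le> dim (proj_tangent (ruling \<phi>) (w, p))"
    using ns unfolding not_singular_iff dim_real_coords_image dim_free_rank_two[OF U] .
qed (auto simp: proj_tangent_def proj_tangent_ruling_subset[OF \<phi> U, unfolded proj_tangent_def])

text \<open>Write \<open>b = scalar_of p\<close>. If \<open>b\<close> is a unit, multiplication by \<open>b\<close> maps the tangent space of \<open>\<gamma>\<close> onto
itself, and every vector \<open>b (D\<phi> v + a \<phi>)\<close> is tangent to \<open>S\<close>. If \<open>b c = 0\<close> and the tangent space of \<open>S\<close>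
were all of that of \<open>\<gamma>\<close>, multiplication by \<open>c\<close> would map a module with a basis of two elements \<open>Y\<close>, \<open>Z\<close>
into the multiples of the single vector \<open>\<phi>\<close>, and \<open>c Y\<close>, \<open>c Z\<close> would satisfy a relation that forces \<open>c = 0\<close>.\<close>

lemma nonsingular_iff_regular:
  fixes \<phi> :: "real^2 \<Rightarrow> 'a::plane_algebra^3"
  assumes \<phi>: "\<phi> differentiable (at w)" and U: "free_rank_two (tangent_space \<phi> w)"
  shows "\<not> singular_at \<phi> (w, p) \<longleftrightarrow> regular (scalar_of p :: 'a)"
proof
  let ?D = "frechet_derivative \<phi> (at w)" and ?b = "scalar_of p :: 'a"
  assume "regular ?b"
  then obtain c where c: "c * ?b = 1" using regular_imp_unit by blast
  have "u \<in> {?b *s ?D v + a *s \<phi> w | v a. True}" if "u \<in> tangent_space \<phi> w" for u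
  proof -
    have "c *s u \<in> tangent_space \<phi> w" by (rule free_rank_two_smult[OF U that])
    then obtain v P where "c *s u = ?D v + P *s \<phi> w" by (auto simp: tangent_space_def)
    then have "?b *s (c *s u) = ?b *s (?D v + P *s \<phi> w)" by simp
    also have "\<dots> = ?b *s ?D v + (?b * P) *s \<phi> w"
      by (simp add: vec_eq_iff algebra_simps)
    finally have "?b *s (c *s u) = ?b *s ?D v + (?b * P) *s \<phi> w" .
    moreover have "?b *s (c *s u) = u" using c by (simp add: vec_eq_iff algebra_simps flip: mult.assoc)
    ultimately show ?thesis by auto
  qed
  then have "real_coords ` tangent_space \<phi> w \<subseteq> proj_tangent (ruling \<phi>) (w, p)"
    unfolding proj_tangent_ruling[OF \<phi>] by blast
  from dim_subset[OF this] show "\<not> singular_at \<phi> (w, p)"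
    by (simp add: not_singular_iff dim_real_coords_image dim_free_rank_two[OF U])
next
  let ?D = "frechet_derivative \<phi> (at w)" and ?b = "scalar_of p :: 'a"
  assume ns: "\<not> singular_at \<phi> (w, p)"
  show "regular ?b" unfolding regular_def
  proof (intro allI impI)
    fix c assume bc: "?b * c = 0"
    have *: "\<exists>a. c *s u = (c * a) *s \<phi> w" if "u \<in> tangent_space \<phi> w" for u
    proof -
      have "real_coords u \<in> real_coords ` {?b *s ?D v + a *s \<phi> w | v a. True}"
        using that proj_tangent_ruling_nonsingular[OF \<phi> U ns] proj_tangent_ruling[OF \<phi>] by blast
      then have "u \<in> {?b *s ?D v + a *s \<phi> w | v a. True}"
        using bij_is_inj[OF bij_real_coords[where 'a='a]] by (simp add: inj_image_mem_iff)
      then obtain v a where "u = ?b *s ?D v + a *s \<phi> w" by blast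
      then have "c *s u = (?b * c) *s ?D v + (c * a) *s \<phi> w"
        by (simp add: vec_eq_iff algebra_simps)
      then show ?thesis using bc by auto
    qed
    obtain Y Z where YZ: "tangent_space \<phi> w = straight_line Y Z"
      and free: "\<And>P Q. P *s Y + Q *s Z = 0 \<Longrightarrow> P = 0 \<and> Q = 0"
      using U unfolding free_rank_two_def by blast
    have "Y = 1 *s Y + 0 *s Z" "Z = 0 *s Y + 1 *s Z" by simp_all
    then have "Y \<in> tangent_space \<phi> w" "Z \<in> tangent_space \<phi> w"
      unfolding YZ straight_line_def by blast+
    then obtain a a' where a: "c *s Y = (c * a) *s \<phi> w" "c *s Z = (c * a') *s \<phi> w" using * by blast
    have "(a' * c) *s Y + (- (a * c)) *s Z = a' *s (c *s Y) - a *s (c *s Z)"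
      by (simp add: vec_eq_iff algebra_simps)
    also have "\<dots> = 0" unfolding a by (simp add: vec_eq_iff algebra_simps)
    \<comment> \<open>With \<open>c Y = a c \<phi>\<close> and \<open>c Z = a' c \<phi>\<close>, the combination \<open>a' (c Y) - a (c Z)\<close> vanishes, so freeness
      yields \<open>a c = 0\<close>.\<close>
    finally have "a * c = 0" using free[of "a' * c" "- (a * c)"] by simp
    then have "c *s Y + 0 *s Z = 0" using a(1) by (simp add: mult.commute)
    then show "c = 0" using free by blast
  qed
qed

section \<open>Orthogonal projections\<close>

definition proj_onto :: "'b::euclidean_space set \<Rightarrow> 'b \<Rightarrow>\<^sub>L 'b" where
  "proj_onto S = Blinfun (closest_point S)"

lemma closest_point_subspace_eqI:
  fixes S :: "'b::euclidean_space set"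
  assumes S: "subspace S" and x: "x \<in> S" and orth: "\<And>y. y \<in> S \<Longrightarrow> (a - x) \<bullet> y = 0"
  shows "closest_point S a = x"
proof -
  have "dist a x \<le> dist a z" if "z \<in> S" for z
  proof -
    have "(a - x) \<bullet> (x - z) = 0" using orth S x that by (simp add: subspace_diff)
    then have "(norm (a - z))\<^sup>2 = (norm (a - x))\<^sup>2 + (norm (x - z))\<^sup>2"
      using norm_add_Pythagorean[of "a - x" "x - z"] by (simp add: orthogonal_def)
    then have "(norm (a - x))\<^sup>2 \<le> (norm (a - z))\<^sup>2" by simp
    then show ?thesis by (simp add: dist_norm power2_le_iff_abs_le)
  qed
  then show ?thesis
    using closest_point_unique[of S x a] S x by (simp add: subspace_imp_convex closed_subspace)
qed

lemma closest_point_subspace: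
  fixes S :: "'b::euclidean_space set"
  assumes S: "subspace S"
  shows "closest_point S a \<in> S" "y \<in> S \<Longrightarrow> (a - closest_point S a) \<bullet> y = 0"
proof -
  obtain x z where xz: "x \<in> span S" "\<And>w. w \<in> span S \<Longrightarrow> orthogonal z w" "a = x + z"
    using orthogonal_subspace_decomp_exists[of S a] by blast
  have "closest_point S a = x"
    using xz S by (intro closest_point_subspace_eqI) (simp_all add: span_eq_iff[THEN iffD2] orthogonal_def)
  then show "closest_point S a \<in> S" "y \<in> S \<Longrightarrow> (a - closest_point S a) \<bullet> y = 0"
    using xz S by (simp_all add: span_eq_iff[THEN iffD2] orthogonal_def)
qed

lemma proj_onto_apply:
  fixes S :: "'b::euclidean_space set"
  assumes S: "subspace S"
  shows "blinfun_apply (proj_onto S) = closest_point S"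
proof -
  note cp = closest_point_subspace[OF S]
  have "linear (closest_point S)"
  proof (intro linearI closest_point_subspace_eqI[OF S])
    fix a b :: 'b and r :: real
    show "closest_point S a + closest_point S b \<in> S" "r *\<^sub>R closest_point S a \<in> S"
      using cp(1) S by (simp_all add: subspace_add subspace_scale)
    fix y assume "y \<in> S"
    then have "(a - closest_point S a) \<bullet> y = 0" "(b - closest_point S b) \<bullet> y = 0" by (simp_all add: cp(2))
    then show "(a + b - (closest_point S a + closest_point S b)) \<bullet> y = 0"
      "(r *\<^sub>R a - r *\<^sub>R closest_point S a) \<bullet> y = 0"
      by (simp_all add: inner_diff_left inner_add_left)
  qed
  then show ?thesis
    unfolding proj_onto_def by (simp add: bounded_linear_Blinfun_apply linear_conv_bounded_linear)
qed

lemma proj_onto_mem: "subspace S \<Longrightarrow> blinfun_apply (proj_onto S) a \<in> S"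
  by (simp add: proj_onto_apply closest_point_subspace)

lemma proj_onto_orthogonal: "subspace S \<Longrightarrow> y \<in> S \<Longrightarrow> (a - blinfun_apply (proj_onto S) a) \<bullet> y = 0"
  by (simp add: proj_onto_apply closest_point_subspace)

lemma proj_onto_eqI:
  "subspace S \<Longrightarrow> x \<in> S \<Longrightarrow> (\<And>y. y \<in> S \<Longrightarrow> (a - x) \<bullet> y = 0) \<Longrightarrow> blinfun_apply (proj_onto S) a = x"
  by (simp add: proj_onto_apply closest_point_subspace_eqI)

lemma proj_onto_ident_iff: "subspace S \<Longrightarrow> blinfun_apply (proj_onto S) a = a \<longleftrightarrow> a \<in> S"
  by (metis proj_onto_mem proj_onto_eqI diff_self inner_zero_left)

lemma proj_onto_self_adjoint:
  assumes S: "subspace S"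
  shows "blinfun_apply (proj_onto S) a \<bullet> b = a \<bullet> blinfun_apply (proj_onto S) b"
  using proj_onto_orthogonal[OF S proj_onto_mem[OF S, of b], of a]
    proj_onto_orthogonal[OF S proj_onto_mem[OF S, of a], of b]
  by (simp add: inner_diff_left inner_diff_right inner_commute)

text \<open>One Gram-Schmidt step: \<open>h\<close> is the component of the new vector orthogonal to \<open>S\<close>, and the projection
grows by the projection onto the line of \<open>h\<close>.\<close>

lemma proj_onto_span_insert:
  fixes S :: "'b::euclidean_space set"
  assumes S: "subspace S" and x: "x \<notin> S"
  defines "h \<equiv> x - blinfun_apply (proj_onto S) x"
  shows "proj_onto (span (insert x S)) =
    proj_onto S + (1 / (h \<bullet> h)) *\<^sub>R (blinfun_scaleR_left h o\<^sub>L blinfun_inner_left h)"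
proof (rule blinfun_eqI)
  fix a
  have h0: "h \<noteq> 0" using x proj_onto_mem[OF S, of x] by (auto simp: h_def)
  have hS: "h \<bullet> y = 0" if "y \<in> S" for y
    unfolding h_def using proj_onto_orthogonal[OF S that] .
  let ?p = "blinfun_apply (proj_onto S) a" and ?c = "(h \<bullet> a) / (h \<bullet> h)"
  have "blinfun_apply (proj_onto (span (insert x S))) a = ?p + ?c *\<^sub>R h"
  proof (rule proj_onto_eqI)
    have "?p \<in> span (insert x S)" "blinfun_apply (proj_onto S) x \<in> span (insert x S)"
      using proj_onto_mem[OF S] by (auto intro: span_base)
    then show "?p + ?c *\<^sub>R h \<in> span (insert x S)"
      unfolding h_def by (intro span_add span_scale span_diff) (auto intro: span_base)
    fix y assume "y \<in> span (insert x S)"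
    then obtain k where "y - k *\<^sub>R x \<in> span S" by (auto simp: span_breakdown_eq)
    then have k: "y - k *\<^sub>R x \<in> S" using S by (simp add: span_eq_iff[THEN iffD2])
    define s where "s = (y - k *\<^sub>R x) + k *\<^sub>R blinfun_apply (proj_onto S) x"
    have s: "s \<in> S" unfolding s_def using k proj_onto_mem[OF S] S by (simp add: subspace_add subspace_scale)
    have y: "y = s + k *\<^sub>R h" by (simp add: s_def h_def algebra_simps)
    have "(a - ?p) \<bullet> s = 0" "h \<bullet> s = 0" "h \<bullet> ?p = 0"
      using proj_onto_orthogonal[OF S s] hS s proj_onto_mem[OF S] by auto
    then show "(a - (?p + ?c *\<^sub>R h)) \<bullet> y = 0"
      using h0 by (simp add: y algebra_simps inner_diff_left inner_diff_right inner_add_left inner_add_right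
          inner_commute[of a h] inner_commute[of ?p h])
  qed (rule subspace_span)
  then show "blinfun_apply (proj_onto (span (insert x S))) a = blinfun_apply (proj_onto S +
      (1 / (h \<bullet> h)) *\<^sub>R (blinfun_scaleR_left h o\<^sub>L blinfun_inner_left h)) a"
    by (simp add: blinfun.add_left blinfun.scaleR_left inner_commute)
qed

lemma differentiable_proj_onto_span_insert:
  fixes f :: "'z::real_normed_vector \<Rightarrow> 'b::euclidean_space"
  assumes S: "\<And>z. subspace (S z)"
    and P: "(\<lambda>z. proj_onto (S z)) differentiable (at z0)"
    and f: "f differentiable (at z0)" and notin: "f z0 \<notin> S z0"
  shows "(\<lambda>z. proj_onto (span (insert (f z) (S z)))) differentiable (at z0)"
proof -
  define h where "h = (\<lambda>z. f z - blinfun_apply (proj_onto (S z)) (f z))"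
  obtain P' where P': "((\<lambda>z. proj_onto (S z)) has_derivative P') (at z0)"
    using P by (auto simp: differentiable_def)
  obtain f' where f': "(f has_derivative f') (at z0)" using f by (auto simp: differentiable_def)
  obtain h' where h': "(h has_derivative h') (at z0)"
    unfolding h_def
    using has_derivative_diff[OF f' bounded_bilinear.FDERIV[OF bounded_bilinear_blinfun_apply P' f']] by blast
  have h0: "h z0 \<noteq> 0" using notin proj_onto_ident_iff[OF S] by (simp add: h_def) metis
  have "isCont h z0" using h' by (rule has_derivative_continuous)
  then have "\<forall>\<^sub>F z in at z0. h z \<noteq> 0"
    using h0 by (simp add: continuous_at tendsto_imp_eventually_ne)
  then have ev: "\<forall>\<^sub>F z in at z0. proj_onto (S z) +
      (1 / (h z \<bullet> h z)) *\<^sub>R (blinfun_scaleR_left (h z) o\<^sub>L blinfun_inner_left (h z)) =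
      proj_onto (span (insert (f z) (S z)))"
  proof (rule eventually_mono)
    fix z assume "h z \<noteq> 0"
    then have "f z \<notin> S z" using proj_onto_ident_iff[OF S, of z "f z"] by (auto simp: h_def)
    from proj_onto_span_insert[OF S this]
    show "proj_onto (S z) + (1 / (h z \<bullet> h z)) *\<^sub>R (blinfun_scaleR_left (h z) o\<^sub>L blinfun_inner_left (h z)) =
      proj_onto (span (insert (f z) (S z)))" by (simp add: h_def)
  qed
  have hh: "((\<lambda>z. h z \<bullet> h z) has_derivative (\<lambda>k. h z0 \<bullet> h' k + h' k \<bullet> h z0)) (at z0)"
    by (rule has_derivative_inner[OF h' h'])
  have "(\<lambda>z. 1 / (h z \<bullet> h z)) differentiable (at z0)"
    using hh h0 by (intro differentiable_divide differentiable_const) (auto simp: differentiable_def)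
  then obtain q' where q': "((\<lambda>z. 1 / (h z \<bullet> h z)) has_derivative q') (at z0)"
    by (auto simp: differentiable_def)
  note hl = bounded_linear.has_derivative[OF bounded_linear_blinfun_scaleR_left h']
  note hr = bounded_linear.has_derivative[OF bounded_linear_blinfun_inner_left h']
  note d = has_derivative_add[OF P' has_derivative_scaleR[OF q'
        bounded_bilinear.FDERIV[OF bounded_bilinear_blinfun_compose hl hr]]]
  have "f z0 \<notin> S z0" by (rule notin)
  then show ?thesis
    using has_derivative_transform_eventually[OF d ev] proj_onto_span_insert[OF S notin]
    unfolding differentiable_def by (auto simp: h_def)
qed

text \<open>The Gram-Schmidt step is a differentiable operation as long as the new vector is independent of the
previous ones, which the assumption on the dimension guarantees at the point \<open>z0\<close>.\<close>

lemma differentiable_proj_onto_span: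
  fixes fs :: "('z::real_normed_vector \<Rightarrow> 'b::euclidean_space) list"
  assumes "\<And>f. f \<in> set fs \<Longrightarrow> f differentiable (at z0)"
    and "length fs \<le> dim ((\<lambda>f. f z0) ` set fs)"
  shows "(\<lambda>z. proj_onto (span ((\<lambda>f. f z) ` set fs))) differentiable (at z0)"
  using assms
proof (induction fs)
  case Nil
  show ?case by simp
next
  case (Cons f fs)
  let ?R = "\<lambda>z. (\<lambda>f. f z) ` set fs"
  have "dim (?R z0) \<le> length fs"
    by (metis List.finite_set card_image_le card_length dim_le_card' finite_imageI le_trans)
  then have notin: "f z0 \<notin> span (?R z0)" and len: "length fs \<le> dim (?R z0)"
    using Cons.prems(2) by (auto simp: dim_insert split: if_splits)
  have "span (insert (f z) (span (?R z))) = span (insert (f z) (?R z))" for z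
    by (auto simp only: span_breakdown_eq span_span)
  then show ?case
    using differentiable_proj_onto_span_insert[of "\<lambda>z. span (?R z)" z0 f] notin len Cons by simp
qed

text \<open>Differentiating \<open>P(z) f(z) = f(z)\<close> for a section \<open>f\<close> of the family \<open>T\<close> shows that \<open>P'\<close> applied to
\<open>f(z0)\<close> is the part of \<open>f'\<close> orthogonal to \<open>T(z0)\<close>. This decides whether \<open>P'\<close> vanishes on \<open>T(z0)\<close>.
Differentiating \<open>P P = P\<close> shows that \<open>P'\<close> maps the orthogonal complement of \<open>T(z0)\<close> into \<open>T(z0)\<close>, where it
is determined by symmetry from its values on \<open>T(z0)\<close>.\<close>

lemma proj_onto_derivative_eq_0_iff:
  fixes T :: "'z::real_normed_vector \<Rightarrow> 'b::euclidean_space set"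
  assumes T: "\<And>z. subspace (T z)"
    and P: "((\<lambda>z. proj_onto (T z)) has_derivative P') (at z0)"
    and f: "\<And>f. f \<in> F \<Longrightarrow> (f has_derivative D f) (at z0)"
    and mem: "\<And>f. f \<in> F \<Longrightarrow> \<forall>\<^sub>F z in nhds z0. f z \<in> T z"
    and spn: "T z0 = span ((\<lambda>f. f z0) ` F)"
  shows "P' \<zeta> = 0 \<longleftrightarrow> (\<forall>f\<in>F. D f \<zeta> \<in> T z0)"
proof -
  let ?P = "blinfun_apply (proj_onto (T z0))"
  have section_eq: "?P (D f \<zeta>) + blinfun_apply (P' \<zeta>) (f z0) = D f \<zeta>" if "f \<in> F" for f
  proof -
    have "((\<lambda>z. blinfun_apply (proj_onto (T z)) (f z)) has_derivative
        (\<lambda>k. ?P (D f k) + blinfun_apply (P' k) (f z0))) (at z0)"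
      by (rule bounded_bilinear.FDERIV[OF bounded_bilinear_blinfun_apply P f[OF that]])
    moreover have "\<forall>\<^sub>F z in at z0. blinfun_apply (proj_onto (T z)) (f z) = f z"
      using mem[OF that] by (auto simp: proj_onto_ident_iff[OF T] eventually_nhds_conv_at)
    moreover have "blinfun_apply (proj_onto (T z0)) (f z0) = f z0"
      using mem[OF that] by (auto simp: proj_onto_ident_iff[OF T] eventually_nhds_conv_at)
    ultimately have "(f has_derivative (\<lambda>k. ?P (D f k) + blinfun_apply (P' k) (f z0))) (at z0)"
      by (rule has_derivative_transform_eventually) simp
    from has_derivative_unique[OF this f[OF that]] show ?thesis by (rule fun_cong)
  qed
  have idem: "?P (blinfun_apply (P' \<zeta>) y) + blinfun_apply (P' \<zeta>) (?P y) = blinfun_apply (P' \<zeta>) y" for y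
  proof -
    have Py: "((\<lambda>z. blinfun_apply (proj_onto (T z)) y) has_derivative (\<lambda>k. blinfun_apply (P' k) y)) (at z0)"
      using bounded_bilinear.FDERIV[OF bounded_bilinear_blinfun_apply P has_derivative_const[of y]]
      by (simp add: blinfun.zero_right)
    have "((\<lambda>z. blinfun_apply (proj_onto (T z)) (blinfun_apply (proj_onto (T z)) y)) has_derivative
        (\<lambda>k. ?P (blinfun_apply (P' k) y) + blinfun_apply (P' k) (?P y))) (at z0)"
      by (rule bounded_bilinear.FDERIV[OF bounded_bilinear_blinfun_apply P Py])
    then have "((\<lambda>z. blinfun_apply (proj_onto (T z)) y) has_derivative
        (\<lambda>k. ?P (blinfun_apply (P' k) y) + blinfun_apply (P' k) (?P y))) (at z0)"
      by (simp only: proj_onto_ident_iff[OF T, THEN iffD2, OF proj_onto_mem[OF T]])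
    from has_derivative_unique[OF this Py] show ?thesis by (rule fun_cong)
  qed
  have sym: "blinfun_apply (P' \<zeta>) x \<bullet> y = x \<bullet> blinfun_apply (P' \<zeta>) y" for x y
  proof -
    have Py: "((\<lambda>z. blinfun_apply (proj_onto (T z)) y) has_derivative (\<lambda>k. blinfun_apply (P' k) y)) (at z0)" for y
      using bounded_bilinear.FDERIV[OF bounded_bilinear_blinfun_apply P has_derivative_const[of y]]
      by (simp add: blinfun.zero_right)
    have "((\<lambda>z. blinfun_apply (proj_onto (T z)) x \<bullet> y) has_derivative
        (\<lambda>k. blinfun_apply (P' k) x \<bullet> y)) (at z0)"
      by (rule has_derivative_inner_left[OF Py])
    then have "((\<lambda>z. x \<bullet> blinfun_apply (proj_onto (T z)) y) has_derivative
        (\<lambda>k. blinfun_apply (P' k) x \<bullet> y)) (at z0)"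
      by (simp only: proj_onto_self_adjoint[OF T])
    from has_derivative_unique[OF this has_derivative_inner_right[OF Py]] show ?thesis by (rule fun_cong)
  qed
  show ?thesis
  proof
    assume "P' \<zeta> = 0"
    then show "\<forall>f\<in>F. D f \<zeta> \<in> T z0"
      using section_eq by (simp add: proj_onto_ident_iff[OF T, symmetric])
  next
    assume "\<forall>f\<in>F. D f \<zeta> \<in> T z0"
    then have "blinfun_apply (P' \<zeta>) (f z0) = 0" if "f \<in> F" for f
      using section_eq[OF that] that by (simp add: proj_onto_ident_iff[OF T, THEN iffD2])
    then have "(\<lambda>f. f z0) ` F \<subseteq> {x. blinfun_apply (P' \<zeta>) x = 0}" by auto
    moreover have "subspace {x. blinfun_apply (P' \<zeta>) x = 0}"
      by (simp add: subspace_def blinfun.add_right blinfun.scaleR_right blinfun.zero_right)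
    ultimately have on_T: "blinfun_apply (P' \<zeta>) x = 0" if "x \<in> T z0" for x
      using that span_minimal unfolding spn by blast
    show "P' \<zeta> = 0"
    proof (rule blinfun_eqI)
      fix y
      have 1: "?P (blinfun_apply (P' \<zeta>) y) = blinfun_apply (P' \<zeta>) y"
        using idem[of y] on_T[OF proj_onto_mem[OF T]] by simp
      then have "blinfun_apply (P' \<zeta>) y \<in> T z0" using proj_onto_ident_iff[OF T] by blast
      then have "blinfun_apply (P' \<zeta>) y \<bullet> blinfun_apply (P' \<zeta>) y = 0"
        by (simp add: sym on_T)
      then show "blinfun_apply (P' \<zeta>) y = blinfun_apply 0 y" by simp
    qed
  qed
qed

section \<open>Symmetry of the second derivative\<close>

text \<open>The mean value theorem along \<open>u\<close> expresses the second difference by values of \<open>D y u\<close> at two points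
differing by \<open>h v\<close>, and their difference is \<open>h A v\<close> up to \<open>o(h)\<close>.\<close>

lemma second_difference_tendsto:
  fixes f :: "'a::real_normed_vector \<Rightarrow> real"
  assumes W: "open W" "x \<in> W" and f: "\<And>y. y \<in> W \<Longrightarrow> (f has_derivative D y) (at y)"
    and A: "((\<lambda>y. D y u) has_derivative A) (at x)"
  shows "((\<lambda>h. (f (x + h *\<^sub>R u + h *\<^sub>R v) - f (x + h *\<^sub>R u) - f (x + h *\<^sub>R v) + f x) / h\<^sup>2)
    \<longlongrightarrow> A v) (at_right 0)"
proof (rule tendstoI)
  fix e :: real assume e: "e > 0"
  define M where "M = norm u + norm v + 1"
  have M: "M > 0" "norm u \<le> M" "norm v \<le> M" "norm u + norm v \<le> M" by (simp_all add: M_def add_nonneg_pos)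
  define e' where "e' = e / (4 * M)"
  have e': "e' > 0" using e M by (simp add: e'_def)
  obtain d1 where d1: "d1 > 0" "ball x d1 \<subseteq> W" using W open_contains_ball by blast
  obtain d2 where d2: "d2 > 0"
    "\<And>y. norm (y - x) < d2 \<Longrightarrow> norm (D y u - D x u - A (y - x)) \<le> e' * norm (y - x)"
    using A e' unfolding has_derivative_at_alt by blast
  have lA: "linear A" using A by (rule has_derivative_linear)
  define d where "d = min d1 d2 / M"
  have d: "d > 0" using d1 d2 M by (simp add: d_def)
  have "dist ((f (x + h *\<^sub>R u + h *\<^sub>R v) - f (x + h *\<^sub>R u) - f (x + h *\<^sub>R v) + f x) / h\<^sup>2) (A v) < e"
    if h: "0 < h" "h < d" for h
  proof -
    have hM: "h * M < min d1 d2" using h M by (simp add: d_def pos_less_divide_eq)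
    have small: "norm (s *\<^sub>R u + t *\<^sub>R v) \<le> h * M" if "0 \<le> s" "s \<le> h" "0 \<le> t" "t \<le> h" for s t
    proof -
      have "norm (s *\<^sub>R u + t *\<^sub>R v) \<le> s * norm u + t * norm v"
        using norm_triangle_ineq[of "s *\<^sub>R u" "t *\<^sub>R v"] that by simp
      also have "\<dots> \<le> h * norm u + h * norm v"
        using that by (intro add_mono mult_right_mono) auto
      also have "\<dots> \<le> h * M" using M(4) h by (simp add: distrib_left[symmetric])
      finally show ?thesis .
    qed
    have inW: "x + (s *\<^sub>R u + t *\<^sub>R v) \<in> W" if "0 \<le> s" "s \<le> h" "0 \<le> t" "t \<le> h" for s t
    proof -
      have "x + (s *\<^sub>R u + t *\<^sub>R v) \<in> ball x d1"
        using small[OF that] hM by (simp only: mem_ball dist_norm norm_minus_commute[of x]) simp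
      then show ?thesis using d1 by blast
    qed
    define g where "g = (\<lambda>t. f (x + (t *\<^sub>R u + h *\<^sub>R v)) - f (x + (t *\<^sub>R u + 0 *\<^sub>R v)))"
    define g' where "g' = (\<lambda>t r. D (x + (t *\<^sub>R u + h *\<^sub>R v)) (r *\<^sub>R u) - D (x + (t *\<^sub>R u + 0 *\<^sub>R v)) (r *\<^sub>R u))"
    have along: "((\<lambda>t. f (x + (t *\<^sub>R u + c *\<^sub>R v))) has_derivative (\<lambda>r. D (x + (t *\<^sub>R u + c *\<^sub>R v)) (r *\<^sub>R u)))
        (at t within {0..h})" if "0 \<le> t" "t \<le> h" "0 \<le> c" "c \<le> h" for t c
      by (rule has_derivative_compose[of "\<lambda>t. x + (t *\<^sub>R u + c *\<^sub>R v)" "\<lambda>r. r *\<^sub>R u" t "{0..h}", OF _ f[OF inW[OF that]]])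
        (auto intro!: derivative_eq_intros)
    have "\<exists>t\<in>{0<..<h}. g h - g 0 = g' t (h - 0)"
    proof (rule mvt_simple[OF h(1)])
      fix t assume "0 \<le> t" "t \<le> h"
      then show "(g has_derivative g' t) (at t within {0..h})"
        unfolding g_def g'_def using h by (intro has_derivative_diff along) auto
    qed
    then obtain t where t: "0 < t" "t < h" "g h - g 0 = g' t h" by auto
    let ?y1 = "x + (t *\<^sub>R u + h *\<^sub>R v)" and ?y2 = "x + (t *\<^sub>R u + 0 *\<^sub>R v)"
    have n1: "norm (?y1 - x) \<le> h * M" "norm (?y2 - x) \<le> h * M"
      using small[of t h] small[of t 0] t h by auto
    define r1 where "r1 = D ?y1 u - D x u - A (?y1 - x)"
    define r2 where "r2 = D ?y2 u - D x u - A (?y2 - x)"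
    have b1: "\<bar>r1\<bar> \<le> e' * (h * M)"
      unfolding r1_def using order_trans[OF d2(2)[of ?y1] mult_left_mono[OF n1(1), of e']] n1(1) hM e' by simp
    have b2: "\<bar>r2\<bar> \<le> e' * (h * M)"
      unfolding r2_def using order_trans[OF d2(2)[of ?y2] mult_left_mono[OF n1(2), of e']] n1(2) hM e' by simp
    have lin: "D y (h *\<^sub>R u) = h * D y u" if "y \<in> W" for y
      using linear_cmul[OF has_derivative_linear[OF f[OF that]]] by simp
    have "g' t h = h * (D ?y1 u - D ?y2 u)"
      using lin[OF inW[of t h]] lin[OF inW[of t 0]] t h by (simp add: g'_def algebra_simps)
    moreover have A12: "A (?y1 - x) - A (?y2 - x) = h * A v"
      using linear_diff[OF lA, of "?y1 - x" "?y2 - x"] linear_cmul[OF lA, of h v] by simp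
    moreover have "r1 - r2 = D ?y1 u - D ?y2 u - (A (?y1 - x) - A (?y2 - x))"
      unfolding r1_def r2_def by simp
    ultimately have "g' t h - h * (h * A v) = h * (r1 - r2)" by (simp only: right_diff_distrib)
    then have "\<bar>g' t h - h * (h * A v)\<bar> = h * \<bar>r1 - r2\<bar>" using h by (simp add: abs_mult)
    also have "\<dots> \<le> h * (2 * (e' * (h * M)))"
      using b1 b2 h by (intro mult_left_mono) linarith+
    also have "\<dots> = h\<^sup>2 * (e / 2)"
      using M by (simp add: e'_def power2_eq_square field_simps)
    finally have "\<bar>g' t h - h\<^sup>2 * A v\<bar> \<le> h\<^sup>2 * (e / 2)" by (simp add: power2_eq_square mult.assoc)
    moreover have "g' t h = f (x + h *\<^sub>R u + h *\<^sub>R v) - f (x + h *\<^sub>R u) - f (x + h *\<^sub>R v) + f x"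
      unfolding t(3)[symmetric] by (simp add: g_def add.assoc)
    ultimately have "\<bar>(f (x + h *\<^sub>R u + h *\<^sub>R v) - f (x + h *\<^sub>R u) - f (x + h *\<^sub>R v) + f x) - h\<^sup>2 * A v\<bar> \<le> h\<^sup>2 * (e / 2)"
      by simp
    then have "\<bar>(f (x + h *\<^sub>R u + h *\<^sub>R v) - f (x + h *\<^sub>R u) - f (x + h *\<^sub>R v) + f x) / h\<^sup>2 - A v\<bar> \<le> e / 2"
      using h by (simp add: abs_le_iff field_simps)
    then show ?thesis using e by (simp add: dist_real_def)
  qed
  then show "\<forall>\<^sub>F h in at_right 0. dist ((f (x + h *\<^sub>R u + h *\<^sub>R v) - f (x + h *\<^sub>R u) - f (x + h *\<^sub>R v) + f x) / h\<^sup>2) (A v) < e"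
    using d by (auto simp: eventually_at_right)
qed

text \<open>The second difference is symmetric in \<open>u\<close> and \<open>v\<close>, hence so is its limit.\<close>

lemma second_derivative_symmetric:
  fixes f :: "'a::real_normed_vector \<Rightarrow> 'b::euclidean_space"
  assumes W: "open W" "x \<in> W" and f: "\<And>y. y \<in> W \<Longrightarrow> (f has_derivative D y) (at y)"
    and A: "((\<lambda>y. D y u) has_derivative A) (at x)"
    and B: "((\<lambda>y. D y v) has_derivative B) (at x)"
  shows "A v = B u"
proof (rule euclidean_eqI)
  fix b :: 'b assume "b \<in> Basis"
  let ?f = "\<lambda>y. f y \<bullet> b"
  have f': "(?f has_derivative (\<lambda>v. D y v \<bullet> b)) (at y)" if "y \<in> W" for y
    by (rule has_derivative_inner_left[OF f[OF that]])
  have 1: "((\<lambda>h. (?f (x + h *\<^sub>R u + h *\<^sub>R v) - ?f (x + h *\<^sub>R u) - ?f (x + h *\<^sub>R v) + ?f x) / h\<^sup>2)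
      \<longlongrightarrow> A v \<bullet> b) (at_right 0)"
    by (rule second_difference_tendsto[OF W f' has_derivative_inner_left[OF A]])
  have 2: "((\<lambda>h. (?f (x + h *\<^sub>R v + h *\<^sub>R u) - ?f (x + h *\<^sub>R v) - ?f (x + h *\<^sub>R u) + ?f x) / h\<^sup>2)
      \<longlongrightarrow> B u \<bullet> b) (at_right 0)"
    by (rule second_difference_tendsto[OF W f' has_derivative_inner_left[OF B]])
  have 3: "(\<lambda>h. (?f (x + h *\<^sub>R v + h *\<^sub>R u) - ?f (x + h *\<^sub>R v) - ?f (x + h *\<^sub>R u) + ?f x) / h\<^sup>2) =
      (\<lambda>h. (?f (x + h *\<^sub>R u + h *\<^sub>R v) - ?f (x + h *\<^sub>R u) - ?f (x + h *\<^sub>R v) + ?f x) / h\<^sup>2)"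
  proof
    fix h :: real
    have "x + h *\<^sub>R v + h *\<^sub>R u = x + h *\<^sub>R u + h *\<^sub>R v" by simp
    then show "(?f (x + h *\<^sub>R v + h *\<^sub>R u) - ?f (x + h *\<^sub>R v) - ?f (x + h *\<^sub>R u) + ?f x) / h\<^sup>2 =
      (?f (x + h *\<^sub>R u + h *\<^sub>R v) - ?f (x + h *\<^sub>R u) - ?f (x + h *\<^sub>R v) + ?f x) / h\<^sup>2"
      by (simp only:) simp
  qed
  show "A v \<bullet> b = B u \<bullet> b"
    by (rule tendsto_unique[OF trivial_limit_at_right_real 1 2[unfolded 3]])
qed

section \<open>The Gauss map of the ruled submanifold\<close>

text \<open>Four differentiable sections of the family of tangent subspaces of \<open>S\<close> that span it at every point,
including the singular ones: the last two are \<open>b D\<phi>(w) e\<close> for the two unit vectors \<open>e\<close>.\<close>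

definition frame_fields :: "(real^2 \<Rightarrow> 'a::plane_algebra^3) \<Rightarrow> ((real^2) \<times> (real^2) \<Rightarrow> real^2^3) list" where
  "frame_fields \<phi> =
    [\<lambda>z. real_col (\<phi> (fst z)) 1,
     \<lambda>z. real_col (\<phi> (fst z)) 2,
     ruling (\<lambda>w. frechet_derivative \<phi> (at w) (axis 1 1)),
     ruling (\<lambda>w. frechet_derivative \<phi> (at w) (axis 2 1))]"

lemma vec2_eq_axis: "v = v $ 1 *\<^sub>R axis 1 1 + v $ 2 *\<^sub>R axis 2 1" for v :: "real^2"
  by (simp add: vec_eq_iff forall_2 axis_def)

lemma smult_scaleR: "a *s (r *\<^sub>R X) = r *\<^sub>R (a *s X)" for a :: "'a::plane_algebra"
  by (simp add: vec_eq_iff)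

lemma proj_tangent_ruling_span:
  fixes \<phi> :: "real^2 \<Rightarrow> 'a::plane_algebra^3"
  assumes \<phi>: "\<phi> differentiable (at w)"
  shows "proj_tangent (ruling \<phi>) (w, p) = span ((\<lambda>f. f (w, p)) ` set (frame_fields \<phi>))"
proof
  let ?D = "frechet_derivative \<phi> (at w)" and ?b = "scalar_of p :: 'a"
  let ?S = "span ((\<lambda>f. f (w, p)) ` set (frame_fields \<phi>))"
  have D: "linear ?D" by (rule linear_frechet_derivative[OF \<phi>])
  have "real_coords (?b *s ?D v + a *s \<phi> w) \<in> ?S" for v a
  proof -
    have "real_coords (a *s \<phi> w) \<in> span {real_col (\<phi> w) 1, real_col (\<phi> w) 2}"
      unfolding span_real_cols by (rule rangeI)
    also have "\<dots> \<subseteq> ?S" by (rule span_mono) (simp add: frame_fields_def)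
    finally have 1: "real_coords (a *s \<phi> w) \<in> ?S" .
    have "?D v = v $ 1 *\<^sub>R ?D (axis 1 1) + v $ 2 *\<^sub>R ?D (axis 2 1)"
      by (subst vec2_eq_axis[of v]) (simp only: linear_add[OF D] linear_cmul[OF D])
    then have "real_coords (?b *s ?D v) = v $ 1 *\<^sub>R real_coords (?b *s ?D (axis 1 1)) +
        v $ 2 *\<^sub>R real_coords (?b *s ?D (axis 2 1))"
      by (simp only: linear_add[OF linear_smult_right] smult_scaleR linear_add[OF linear_real_coords]
          linear_cmul[OF linear_real_coords])
    also have "\<dots> \<in> ?S"
      by (intro span_add span_scale span_base) (simp_all add: frame_fields_def ruling_eq)
    finally show ?thesis using 1 by (simp add: linear_add[OF linear_real_coords] span_add)
  qed
  then show "proj_tangent (ruling \<phi>) (w, p) \<subseteq> ?S"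
    unfolding proj_tangent_ruling[OF \<phi>] by blast
  have mem: "real_coords (?b *s ?D v + a *s \<phi> w) \<in> proj_tangent (ruling \<phi>) (w, p)" for v a
    unfolding proj_tangent_ruling[OF \<phi>] by blast
  have "(\<lambda>f. f (w, p)) ` set (frame_fields \<phi>) \<subseteq> proj_tangent (ruling \<phi>) (w, p)"
    using mem[of 0] mem[of _ 0]
    by (auto simp: frame_fields_def ruling_eq real_col_1 real_col_2 linear_0[OF D])
  then show "?S \<subseteq> proj_tangent (ruling \<phi>) (w, p)"
    by (rule span_minimal) (simp add: proj_tangent_def)
qed

lemma unit_smult_mem_iff:
  assumes "free_rank_two U" and c: "c * b = 1"
  shows "b *s X \<in> U \<longleftrightarrow> X \<in> U"
proof -
  have "c *s (b *s X) = X" using c by (simp add: vec_eq_iff flip: mult.assoc)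
  then show ?thesis using free_rank_two_smult[OF assms(1)] by metis
qed

lemma free_rank_two_add_iff:
  assumes "free_rank_two U" "Y \<in> U"
  shows "X + Y \<in> U \<longleftrightarrow> X \<in> U"
  using free_rank_two_subspace[OF assms(1)] assms(2) by (metis add_diff_cancel_right' subspace_add subspace_diff)

lemma smooth_line_differentiable:
  "local_param \<gamma> W \<phi> \<Longrightarrow> w \<in> W \<Longrightarrow> \<phi> differentiable (at w)"
  unfolding local_param_def using smooth_on_imp_differentiable by blast

text \<open>The kernel of the differential of the Gauss map consists of the directions in which the derivatives
of the frame fields remain tangent. The derivatives of \<open>\<phi>\<close> itself always do. The fields \<open>b D\<phi>(w) e\<close> lead
to \<open>b D\<^sup>2\<phi>(v, e)\<close>, where the unit \<open>b\<close> can be cancelled because tangent spaces are submodules.\<close>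

lemma gauss_derivative:
  fixes \<phi> :: "real^2 \<Rightarrow> 'a::plane_algebra^3"
  assumes sl: "smooth_line \<gamma>" and lp: "local_param \<gamma> W \<phi>" and w: "w \<in> W"
    and ns: "\<not> singular_at \<phi> (w, p)"
  shows "gauss \<phi> differentiable (at (w, p))"
    and "frechet_derivative (gauss \<phi>) (at (w, p)) (v, q) = 0 \<longleftrightarrow>
      (\<forall>u. frechet_derivative (\<lambda>y. frechet_derivative \<phi> (at y) v) (at w) u \<in> tangent_space \<phi> w)"
proof -
  let ?T = "proj_tangent (ruling \<phi>)" and ?z = "(w, p)" and ?U = "tangent_space \<phi> w"
  let ?D = "\<lambda>y. frechet_derivative \<phi> (at y)" and ?b = "scalar_of p :: 'a"
  let ?D2 = "\<lambda>v. frechet_derivative (\<lambda>y. frechet_derivative \<phi> (at y) v) (at w)"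
  have W: "open W" and sm: "smooth_on \<phi> W" using lp by (auto simp: local_param_def)
  have diff: "\<phi> differentiable (at y)" if "y \<in> W" for y using smooth_line_differentiable[OF lp that] .
  note \<phi> = diff[OF w]
  have U: "free_rank_two ?U" by (rule smooth_line_tangent_space[OF sl lp w])
  have diff2: "(\<lambda>y. ?D y v) differentiable (at w)" for v by (rule smooth_on_imp_C2[OF sm w])
  have frame_diff: "f differentiable (at ?z)" if "f \<in> set (frame_fields \<phi>)" for f
    using that
    by (auto simp: frame_fields_def intro!: differentiableI[OF has_derivative_real_col[OF \<phi>]]
        differentiableI[OF has_derivative_ruling[OF diff2]])
  have span_eq: "?T z = span ((\<lambda>f. f z) ` set (frame_fields \<phi>))" if "z \<in> W \<times> UNIV" for z
    using proj_tangent_ruling_span[OF diff[of "fst z"], of "snd z"] that by auto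
  have gauss_eq: "gauss \<phi> = (\<lambda>z. proj_onto (?T z))"
    by (simp add: fun_eq_iff gauss_def proj_onto_def)
  have "length (frame_fields \<phi>) \<le> dim ((\<lambda>f. f ?z) ` set (frame_fields \<phi>))"
  proof -
    have "?T ?z = span ((\<lambda>f. f ?z) ` set (frame_fields \<phi>))" using w by (intro span_eq) simp
    then have "4 \<le> dim ((\<lambda>f. f ?z) ` set (frame_fields \<phi>))"
      using ns by (simp only: not_singular_iff dim_span)
    moreover have "length (frame_fields \<phi>) = 4" by (simp add: frame_fields_def)
    ultimately show ?thesis by simp
  qed
  from differentiable_proj_onto_span[OF frame_diff this]
  obtain P' where "((\<lambda>z. proj_onto (span ((\<lambda>f. f z) ` set (frame_fields \<phi>)))) has_derivative P') (at ?z)"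
    unfolding differentiable_def by blast
  then have P': "((\<lambda>z. proj_onto (?T z)) has_derivative P') (at ?z)"
    by (rule has_derivative_transform_within_open[of _ _ _ _ "W \<times> UNIV"])
      (use w W span_eq in \<open>auto simp: open_Times\<close>)
  then show "gauss \<phi> differentiable (at ?z)" unfolding gauss_eq differentiable_def by blast
  have "frechet_derivative (gauss \<phi>) (at ?z) (v, q) = 0 \<longleftrightarrow> P' (v, q) = 0"
    unfolding gauss_eq by (simp add: frechet_derivative_at[OF P', symmetric])
  also have "\<dots> \<longleftrightarrow> (\<forall>f\<in>set (frame_fields \<phi>). frechet_derivative f (at ?z) (v, q) \<in> ?T ?z)"
  proof (rule proj_onto_derivative_eq_0_iff[OF _ P'])
    show "subspace (?T z)" for z by (simp add: proj_tangent_def)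
    show "?T ?z = span ((\<lambda>f. f ?z) ` set (frame_fields \<phi>))" using span_eq w by auto
    fix f assume f: "f \<in> set (frame_fields \<phi>)"
    show "(f has_derivative frechet_derivative f (at ?z)) (at ?z)"
      using frame_diff[OF f] by (simp add: frechet_derivative_works)
    show "\<forall>\<^sub>F z in nhds ?z. f z \<in> ?T z"
      unfolding eventually_nhds
      by (rule exI[of _ "W \<times> UNIV"]) (use W w f span_eq in \<open>auto simp: open_Times intro: span_base\<close>)
  qed
  also have "\<dots> \<longleftrightarrow> (\<forall>e\<in>{axis 1 1, axis 2 1}. ?D2 e v \<in> ?U)"
  proof -
    have T: "?T ?z = real_coords ` ?U" by (rule proj_tangent_ruling_nonsingular[OF \<phi> U ns])
    have inj: "real_coords X \<in> real_coords ` ?U \<longleftrightarrow> X \<in> ?U" for X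
      by (rule inj_image_mem_iff[OF bij_is_inj[OF bij_real_coords]])
    have col: "frechet_derivative (\<lambda>z. real_col (\<phi> (fst z)) k) (at ?z) (v, q) \<in> ?T ?z" for k
    proof -
      have "frechet_derivative (\<lambda>z. real_col (\<phi> (fst z)) k) (at ?z) (v, q) = real_col (?D w v) k"
        by (simp add: frechet_derivative_at[OF has_derivative_real_col[OF \<phi>], symmetric])
      also have "\<dots> \<in> ?T ?z"
        using exhaust_2[of k] free_rank_two_smult[OF U tangent_space_members(2)[OF \<phi>]]
        by (auto simp: T real_col_1 real_col_2)
      finally show ?thesis .
    qed
    have rul: "frechet_derivative (ruling (\<lambda>y. ?D y e)) (at ?z) (v, q) \<in> ?T ?z \<longleftrightarrow> ?D2 e v \<in> ?U" for e
    proof -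
      obtain c where c: "c * ?b = 1"
        using regular_imp_unit nonsingular_iff_regular[OF \<phi> U] ns by blast
      have "frechet_derivative (ruling (\<lambda>y. ?D y e)) (at ?z) (v, q) =
          real_coords (?b *s ?D2 e v + scalar_of q *s ?D w e)"
        by (simp add: frechet_derivative_at[OF has_derivative_ruling[OF diff2], symmetric])
      then show ?thesis
        by (simp add: T inj free_rank_two_add_iff[OF U free_rank_two_smult[OF U tangent_space_members(2)[OF \<phi>]]]
            unit_smult_mem_iff[OF U c])
    qed
    show ?thesis by (simp add: frame_fields_def col rul)
  qed
  also have "\<dots> \<longleftrightarrow> (\<forall>u. ?D2 v u \<in> ?U)"
  proof -
    have sym: "?D2 e v = ?D2 v e" for e
      by (rule second_derivative_symmetric[OF W w, of \<phi> ?D])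
        (use diff diff2 in \<open>simp_all add: frechet_derivative_works[symmetric]\<close>)
    have lin: "linear (?D2 v)" by (rule linear_frechet_derivative[OF diff2])
    have sub: "subspace ?U" by (rule free_rank_two_subspace[OF U])
    have "?D2 v u \<in> ?U" if "?D2 v (axis 1 1) \<in> ?U" "?D2 v (axis 2 1) \<in> ?U" for u
    proof -
      have "?D2 v u = u $ 1 *\<^sub>R ?D2 v (axis 1 1) + u $ 2 *\<^sub>R ?D2 v (axis 2 1)"
        by (subst vec2_eq_axis[of u]) (simp only: linear_add[OF lin] linear_cmul[OF lin])
      also have "\<dots> \<in> ?U" using that sub by (simp add: subspace_add subspace_scale)
      finally show ?thesis .
    qed
    then show ?thesis by (auto simp: sym)
  qed
  finally show "frechet_derivative (gauss \<phi>) (at ?z) (v, q) = 0 \<longleftrightarrow> (\<forall>u. ?D2 v u \<in> ?U)" .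
qed

text \<open>The displacement \<open>q\<close> along the generator does not affect the differential of the Gauss map, which is
therefore a function of \<open>v\<close> in \<open>\<real>\<^sup>2\<close>; its rank is 2 iff it is injective.\<close>

lemma gauss_rank_smooth_line:
  fixes \<phi> :: "real^2 \<Rightarrow> 'a::plane_algebra^3"
  assumes sl: "smooth_line \<gamma>" and lp: "local_param \<gamma> W \<phi>" and w: "w \<in> W"
    and ns: "\<not> singular_at \<phi> (w, p)"
  shows "gauss_rank \<phi> (w, p) \<le> 2"
    and "gauss_rank \<phi> (w, p) = 2 \<longleftrightarrow>
      (\<forall>v. (\<forall>u. frechet_derivative (\<lambda>y. frechet_derivative \<phi> (at y) v) (at w) u \<in> tangent_space \<phi> w) \<longrightarrow> v = 0)"
proof -
  let ?G = "frechet_derivative (gauss \<phi>) (at (w, p))"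
  let ?N = "\<lambda>v. \<forall>u. frechet_derivative (\<lambda>y. frechet_derivative \<phi> (at y) v) (at w) u \<in> tangent_space \<phi> w"
  note G = gauss_derivative[OF assms]
  have lin: "linear ?G" by (rule linear_frechet_derivative[OF G(1)])
  define g where "g = (\<lambda>v. ?G (v, 0))"
  have g: "linear g"
  proof (rule linearI)
    fix a b and r :: real
    show "g (a + b) = g a + g b" using linear_add[OF lin, of "(a, 0)" "(b, 0)"] by (simp add: g_def)
    show "g (r *\<^sub>R a) = r *\<^sub>R g a" using linear_cmul[OF lin, of r "(a, 0)"] by (simp add: g_def)
  qed
  have N0: "?N 0"
    using G(2)[of 0 0] linear_0[OF lin] by (simp add: zero_prod_def)
  have "?G (v, q) = g v" for v q
    using linear_add[OF lin, of "(v, 0)" "(0, q)"] G(2)[of 0 q] N0 by (simp add: g_def)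
  then have "range ?G = range g" by (auto simp: image_iff)
  then have rank: "gauss_rank \<phi> (w, p) = dim (range g)" by (simp add: gauss_rank_def)
  have nullity: "dim (range g) + dim {v. g v = 0} = 2"
    using rank_nullity[OF g subspace_UNIV] by simp
  then show "gauss_rank \<phi> (w, p) \<le> 2" using rank by simp
  have "gauss_rank \<phi> (w, p) = 2 \<longleftrightarrow> dim {v. g v = 0} = 0" using rank nullity by linarith
  also have "\<dots> \<longleftrightarrow> (\<forall>v. g v = 0 \<longrightarrow> v = 0)" by (auto simp: dim_eq_0)
  finally show "gauss_rank \<phi> (w, p) = 2 \<longleftrightarrow> (\<forall>v. ?N v \<longrightarrow> v = 0)"
    by (simp add: g_def G(2))
qed

lemma exists_nonsingular_point:
  fixes \<phi> :: "real^2 \<Rightarrow> 'a::plane_algebra^3"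
  assumes "\<phi> differentiable (at w)" "free_rank_two (tangent_space \<phi> w)"
  shows "\<exists>p. p \<noteq> 0 \<and> \<not> singular_at \<phi> (w, p)"
proof -
  obtain p where "scalar_of p = (1 :: 'a)" using bij_is_surj[OF bij_scalar_of[where 'a='a]] by (metis surjD)
  then have "regular (scalar_of p :: 'a)" by (simp add: regular_def)
  then show ?thesis using nonsingular_iff_regular[OF assms] regular_scalar_of by blast
qed

lemma smooth_line_tangentially_degenerate:
  fixes \<gamma> :: "('a::plane_algebra^3) set"
  assumes sl: "smooth_line \<gamma>"
  shows "tangentially_degenerate \<gamma>"
  unfolding tangentially_degenerate_def
proof (intro allI impI ballI conjI)
  fix W \<phi> w assume lp: "local_param \<gamma> W \<phi>" and w: "w \<in> W"
  show "\<exists>p. p \<noteq> 0 \<and> \<not> singular_at \<phi> (w, p)"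
    by (rule exists_nonsingular_point[OF smooth_line_differentiable[OF lp w] smooth_line_tangent_space[OF sl lp w]])
  fix p assume p: "p \<noteq> 0 \<and> \<not> singular_at \<phi> (w, p)"
  then show "gauss \<phi> differentiable (at (w, p))" using gauss_derivative(1)[OF sl lp w] by blast
  show "gauss_rank \<phi> (w, p) < 3" using gauss_rank_smooth_line(1)[OF sl lp w, of p] p by simp
qed

lemma smooth_line_rank_two_iff_nondegenerate:
  fixes \<gamma> :: "('a::plane_algebra^3) set"
  assumes sl: "smooth_line \<gamma>"
  shows "tangentially_degenerate_of_rank 2 \<gamma> \<longleftrightarrow> nondegenerate \<gamma>"
proof
  assume R: "tangentially_degenerate_of_rank 2 \<gamma>"
  show "nondegenerate \<gamma>" unfolding nondegenerate_def
  proof (intro allI impI ballI)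
    fix W \<phi> w v
    assume lp: "local_param \<gamma> W \<phi>" and w: "w \<in> W"
      and v: "\<forall>u. frechet_derivative (\<lambda>y. frechet_derivative \<phi> (at y) v) (at w) u \<in> tangent_space \<phi> w"
    obtain p where p: "p \<noteq> 0" "\<not> singular_at \<phi> (w, p)"
      using exists_nonsingular_point[OF smooth_line_differentiable[OF lp w] smooth_line_tangent_space[OF sl lp w]] by blast
    then have "gauss_rank \<phi> (w, p) = 2"
      using R lp w unfolding tangentially_degenerate_of_rank_def by blast
    then show "v = 0" using gauss_rank_smooth_line(2)[OF sl lp w p(2)] v by blast
  qed
next
  assume "nondegenerate \<gamma>"
  then show "tangentially_degenerate_of_rank 2 \<gamma>"
    unfolding tangentially_degenerate_of_rank_def nondegenerate_def
    by (simp add: smooth_line_tangentially_degenerate[OF sl] gauss_rank_smooth_line(2)[OF sl])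
qed

lemma no_real_singular_points_if_field:
  fixes \<gamma> :: "('a::plane_algebra^3) set"
  assumes sl: "smooth_line \<gamma>" and field: "\<And>a :: 'a. a \<noteq> 0 \<Longrightarrow> regular a"
  shows "no_real_singular_points \<gamma>"
  unfolding no_real_singular_points_def
proof (intro allI impI ballI)
  fix W \<phi> w and p :: "real^2"
  assume lp: "local_param \<gamma> W \<phi>" and w: "w \<in> W" and p: "p \<noteq> 0"
  have "(scalar_of p :: 'a) \<noteq> 0"
    using p bij_is_inj[OF bij_scalar_of[where 'a='a]] linear_0[OF linear_scalar_of[where 'a='a]]
    by (metis injD)
  then show "\<not> singular_at \<phi> (w, p)"
    using nonsingular_iff_regular[OF smooth_line_differentiable[OF lp w] smooth_line_tangent_space[OF sl lp w]]
      field by blast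
qed

section \<open>Families of points depending on one parameter\<close>

text \<open>A map \<open>x\<close> to a projective space which has rank at most 1 and moves in the direction \<open>a\<close> at \<open>w0\<close> has, near
\<open>w0\<close>, a differential which vanishes in the same directions as that of one real function \<open>s\<close>. The quotient \<open>s\<close> of two linear forms on \<open>x\<close> moves with \<open>x\<close>,
and \<open>z\<close> is the multiple of \<open>x\<close> normalized by the denominator, whose differential vanishes wherever that
of \<open>s\<close> does.\<close>

lemma rank_one_coordinate:
  fixes x :: "real^2 \<Rightarrow> 'b::euclidean_space"
  assumes W: "open W" "w0 \<in> W"
    and x: "\<And>w. w \<in> W \<Longrightarrow> (x has_derivative x' w) (at w)"
    and cont: "\<And>v. continuous_on W (\<lambda>w. x' w v)"
    and rank: "\<And>w. w \<in> W \<Longrightarrow> dim (insert (x w) (range (x' w))) \<le> 2"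
    and a: "x w0 \<noteq> 0" "x' w0 a \<notin> span {x w0}"
  obtains N s s' z z' where "open N" "w0 \<in> N" "N \<subseteq> W"
    "\<And>w. w \<in> N \<Longrightarrow> (s has_derivative s' w) (at w)"
    "\<And>v. continuous_on N (\<lambda>w. s' w v :: real)"
    "\<And>w. w \<in> N \<Longrightarrow> s' w a \<noteq> 0"
    "\<And>w v. w \<in> N \<Longrightarrow> s' w v = 0 \<longleftrightarrow> x' w v \<in> span {x w}"
    "\<And>w. w \<in> N \<Longrightarrow> (z has_derivative z' w) (at w)"
    "\<And>w v. w \<in> N \<Longrightarrow> s' w v = 0 \<Longrightarrow> z' w v = (0 :: 'b)"
    "\<And>w. w \<in> N \<Longrightarrow> span {x w} = span {z w}"
proof -
  define x0 where "x0 = x w0"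
  \<comment> \<open>The form \<open>h\<close> vanishes at \<open>x0\<close> and not at \<open>x' w0 a\<close>, which makes the derivative of \<open>h/r\<close> in the
    direction \<open>a\<close> nonzero at \<open>w0\<close>.\<close>
  define h where "h = x' w0 a - ((x0 \<bullet> x' w0 a) / (x0 \<bullet> x0)) *\<^sub>R x0"
  define r where "r = (\<lambda>w. x0 \<bullet> x w)"
  define s where "s = (\<lambda>w. (h \<bullet> x w) / r w)"
  define s' where "s' = (\<lambda>w v. ((h \<bullet> x' w v) * r w - (h \<bullet> x w) * (x0 \<bullet> x' w v)) / (r w * r w))"
  define z where "z = (\<lambda>w. (1 / r w) *\<^sub>R x w)"
  define z' where "z' = (\<lambda>w v. (1 / r w) *\<^sub>R x' w v - ((x0 \<bullet> x' w v) / (r w * r w)) *\<^sub>R x w)"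
  \<comment> \<open>The product of \<open>r\<close> and the numerator of the derivative of \<open>s\<close> in the direction \<open>a\<close>; the
    neighbourhood \<open>N\<close> is where both are nonzero.\<close>
  define q where "q = (\<lambda>w. r w * ((h \<bullet> x' w a) * r w - (h \<bullet> x w) * (x0 \<bullet> x' w a)))"
  define N where "N = W \<inter> q -` (- {0})"
  have contx: "continuous_on W x"
    using x by (intro has_derivative_continuous_on[of _ _ x']) (auto intro: has_derivative_at_withinI)
  have contq: "continuous_on W q"
    unfolding q_def r_def by (intro continuous_intros contx cont)
  have N: "open N" unfolding N_def by (rule continuous_open_preimage[OF contq W(1)]) (simp add: open_Compl)
  have NW: "N \<subseteq> W" by (auto simp: N_def)
  have r0: "r w \<noteq> 0" if "w \<in> N" for w using that by (auto simp: N_def q_def)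
  have s'a: "s' w a \<noteq> 0" if "w \<in> N" for w using that by (auto simp: N_def q_def s'_def)
  have x00: "x0 \<bullet> x0 > 0" using a(1) by (simp add: x0_def)
  have hx0: "h \<bullet> x0 = 0"
    unfolding h_def inner_diff_left inner_scaleR_left using x00 by (simp add: inner_commute)
  have h0: "h \<noteq> 0" using a(2) by (auto simp: h_def x0_def[symmetric] span_singleton)
  have "x' w0 a = h + ((x0 \<bullet> x' w0 a) / (x0 \<bullet> x0)) *\<^sub>R x0" by (simp add: h_def)
  then have "h \<bullet> x' w0 a = h \<bullet> h"
    by (metis add_0_right hx0 inner_add_right inner_scaleR_right mult_zero_right)
  then have "q w0 \<noteq> 0" using h0 hx0 x00 by (simp add: q_def r_def x0_def[symmetric])
  then have w0N: "w0 \<in> N" using W by (simp add: N_def)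
  have der_s: "(s has_derivative s' w) (at w)" if "w \<in> N" for w
  proof -
    note d = x[OF subsetD[OF NW that]]
    have "(s has_derivative (\<lambda>v. ((h \<bullet> x' w v) * r w - (h \<bullet> x w) * (x0 \<bullet> x' w v)) / (r w * r w))) (at w)"
      unfolding s_def r_def
      by (rule has_derivative_divide'[OF has_derivative_inner_right[OF d] has_derivative_inner_right[OF d]])
        (use r0[OF that] in \<open>simp add: r_def\<close>)
    then show ?thesis by (simp add: s'_def)
  qed
  have der_z: "(z has_derivative z' w) (at w)" if "w \<in> N" for w
  proof -
    note d = x[OF subsetD[OF NW that]]
    have "((\<lambda>w. 1 / r w) has_derivative (\<lambda>v. (0 * r w - 1 * (x0 \<bullet> x' w v)) / (r w * r w))) (at w)"
      unfolding r_def
      by (rule has_derivative_divide'[OF has_derivative_const has_derivative_inner_right[OF d]])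
        (use r0[OF that] in \<open>simp add: r_def\<close>)
    from has_derivative_scaleR[OF this d] show ?thesis
      by (simp add: z_def z'_def)
  qed
  have zero_if: "s' w v = 0" if "w \<in> N" and v: "x' w v \<in> span {x w}" for w v
  proof -
    obtain c where "x' w v = c *\<^sub>R x w" using v by (auto simp: span_singleton)
    then show ?thesis by (simp add: s'_def r_def)
  qed
  have only_if: "x' w v \<in> span {x w}" if w: "w \<in> N" and v: "s' w v = 0" for w v
  proof -
    have wW: "w \<in> W" using w NW by blast
    let ?T = "span (insert (x w) (range (x' w)))"
    have "x w \<noteq> 0" using r0[OF w] by (auto simp: r_def)
    moreover have "x' w a \<notin> span {x w}" using zero_if[OF w] s'a[OF w] by blast
    ultimately have "dim (span {x' w a, x w}) = 2" by (simp add: dim_insert)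
    then have "span {x' w a, x w} = ?T"
      using rank[OF wW] by (intro subspace_dim_equal) (auto intro!: span_mono)
    moreover have "x' w v \<in> ?T" by (rule span_base) simp
    ultimately have "x' w v \<in> span {x' w a, x w}" by simp
    then obtain k where k: "x' w v - k *\<^sub>R x' w a \<in> span {x w}"
      using span_breakdown_eq[of "x' w v" "x' w a" "{x w}"] by blast
    have lin: "linear (x' w)" "linear (s' w)"
      using x[OF wW] der_s[OF w] by (auto intro: has_derivative_linear)
    have "x' w (v - k *\<^sub>R a) \<in> span {x w}" using k by (simp add: linear_diff[OF lin(1)] linear_cmul[OF lin(1)])
    from zero_if[OF w this] have "k * s' w a = 0"
      using v by (simp add: linear_diff[OF lin(2)] linear_cmul[OF lin(2)])
    then show ?thesis using k s'a[OF w] by simp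
  qed
  show ?thesis
  proof (rule that[OF N w0N NW der_s _ s'a _ der_z])
    have "continuous_on N r" "continuous_on N x" "continuous_on N (\<lambda>w. x' w v)" for v
      unfolding r_def by (intro continuous_intros continuous_on_subset[OF contx NW] continuous_on_subset[OF cont NW])+
    then show "continuous_on N (\<lambda>w. s' w v)" for v
      unfolding s'_def using r0 by (intro continuous_intros) auto
    show "s' w v = 0 \<longleftrightarrow> x' w v \<in> span {x w}" if "w \<in> N" for w v
      using zero_if only_if that by blast
    show "z' w v = 0" if wv: "w \<in> N" "s' w v = 0" for w v
    proof -
      obtain c where "x' w v = c *\<^sub>R x w" using only_if[OF wv] by (auto simp: span_singleton)
      then show ?thesis using r0[OF wv(1)] by (simp add: z'_def r_def)
    qed
    show "span {x w} = span {z w}" if "w \<in> N" for w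
    proof -
      have "x w = r w *\<^sub>R z w" using r0[OF that] by (simp add: z_def)
      then show ?thesis using span_scaled_singleton[OF r0[OF that], of "z w"] by simp
    qed
  qed
qed

text \<open>Each of the maps is a function of one real function, \<open>s\<close> or \<open>t\<close>, by \<open>rank_one_coordinate\<close>, and
transversality makes \<open>(s, t)\<close> local coordinates. The normalized \<open>x\<close> is constant along the lines
\<open>s = const\<close> of these coordinates, so its value at \<open>w\<close> is also taken at the point of the segment through
\<open>w0\<close> in the direction \<open>a\<close> where \<open>s\<close> has the same value. This parametrization of the image by the segment
is as smooth as \<open>x\<close>, since it is the restriction of \<open>x\<close> to a line.\<close>

lemma transversal_rank_one_maps:
  fixes x :: "real^2 \<Rightarrow> 'b::euclidean_space" and y :: "real^2 \<Rightarrow> 'c::euclidean_space"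
  assumes W: "open W" "w0 \<in> W"
    and x: "\<And>w. w \<in> W \<Longrightarrow> (x has_derivative x' w) (at w)" "\<And>v. continuous_on W (\<lambda>w. x' w v)"
      "\<And>w. w \<in> W \<Longrightarrow> dim (insert (x w) (range (x' w))) \<le> 2"
    and y: "\<And>w. w \<in> W \<Longrightarrow> (y has_derivative y' w) (at w)" "\<And>v. continuous_on W (\<lambda>w. y' w v)"
      "\<And>w. w \<in> W \<Longrightarrow> dim (insert (y w) (range (y' w))) \<le> 2"
    and a: "x w0 \<noteq> 0" "x' w0 a \<notin> span {x w0}"
    and b: "y w0 \<noteq> 0" "y' w0 b \<notin> span {y w0}"
    and transversal: "\<And>v. x' w0 v \<in> span {x w0} \<Longrightarrow> y' w0 v \<in> span {y w0} \<Longrightarrow> v = 0"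
  obtains N \<delta> where "open N" "w0 \<in> N" "N \<subseteq> W" "\<delta> > 0"
    "\<And>\<sigma>. \<sigma> \<in> {-\<delta><..<\<delta>} \<Longrightarrow> w0 + \<sigma> *\<^sub>R a \<in> W \<and> x' (w0 + \<sigma> *\<^sub>R a) a \<notin> span {x (w0 + \<sigma> *\<^sub>R a)}"
    "\<And>\<tau>. \<tau> \<in> {-\<delta><..<\<delta>} \<Longrightarrow> w0 + \<tau> *\<^sub>R b \<in> W \<and> y' (w0 + \<tau> *\<^sub>R b) b \<notin> span {y (w0 + \<tau> *\<^sub>R b)}"
    "\<And>w. w \<in> N \<Longrightarrow> \<exists>\<sigma>\<in>{-\<delta><..<\<delta>}. \<exists>\<tau>\<in>{-\<delta><..<\<delta>}.
      span {x w} = span {x (w0 + \<sigma> *\<^sub>R a)} \<and> span {y w} = span {y (w0 + \<tau> *\<^sub>R b)}"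
    "\<And>\<sigma> \<tau>. \<sigma> \<in> {-\<delta><..<\<delta>} \<Longrightarrow> \<tau> \<in> {-\<delta><..<\<delta>} \<Longrightarrow> \<exists>w\<in>N.
      span {x w} = span {x (w0 + \<sigma> *\<^sub>R a)} \<and> span {y w} = span {y (w0 + \<tau> *\<^sub>R b)}"
proof -
  obtain N1 s s' xh xh' where N1: "open N1" "w0 \<in> N1" "N1 \<subseteq> W"
    and s: "\<And>w. w \<in> N1 \<Longrightarrow> (s has_derivative s' w) (at w)" "\<And>v. continuous_on N1 (\<lambda>w. s' w v :: real)"
      "\<And>w. w \<in> N1 \<Longrightarrow> s' w a \<noteq> 0" "\<And>w v. w \<in> N1 \<Longrightarrow> s' w v = 0 \<longleftrightarrow> x' w v \<in> span {x w}"
    and xh: "\<And>w. w \<in> N1 \<Longrightarrow> (xh has_derivative xh' w) (at w)"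
      "\<And>w v. w \<in> N1 \<Longrightarrow> s' w v = 0 \<Longrightarrow> xh' w v = (0 :: 'b)"
      "\<And>w. w \<in> N1 \<Longrightarrow> span {x w} = span {xh w}"
    using rank_one_coordinate[OF W x a] by blast
  obtain N2 t t' yh yh' where N2: "open N2" "w0 \<in> N2" "N2 \<subseteq> W"
    and t: "\<And>w. w \<in> N2 \<Longrightarrow> (t has_derivative t' w) (at w)" "\<And>v. continuous_on N2 (\<lambda>w. t' w v :: real)"
      "\<And>w. w \<in> N2 \<Longrightarrow> t' w b \<noteq> 0" "\<And>w v. w \<in> N2 \<Longrightarrow> t' w v = 0 \<longleftrightarrow> y' w v \<in> span {y w}"
    and yh: "\<And>w. w \<in> N2 \<Longrightarrow> (yh has_derivative yh' w) (at w)"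
      "\<And>w v. w \<in> N2 \<Longrightarrow> t' w v = 0 \<Longrightarrow> yh' w v = (0 :: 'c)"
      "\<And>w. w \<in> N2 \<Longrightarrow> span {y w} = span {yh w}"
    using rank_one_coordinate[OF W y b] by blast
  define M where "M = N1 \<inter> N2"
  have M: "open M" "w0 \<in> M" using N1 N2 by (auto simp: M_def)
  define p :: "real \<Rightarrow> real \<Rightarrow> real^2" where "p = (\<lambda>\<sigma> \<tau>. \<sigma> *\<^sub>R axis 1 1 + \<tau> *\<^sub>R axis 2 1)"
  have p_nth: "p \<sigma> \<tau> $ 1 = \<sigma>" "p \<sigma> \<tau> $ 2 = \<tau>" for \<sigma> \<tau> by (simp_all add: p_def axis_def)
  define \<Psi> where "\<Psi> = (\<lambda>w. p (s w) (t w))"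
  define \<Psi>' where "\<Psi>' = (\<lambda>w. Blinfun (\<lambda>v. p (s' w v) (t' w v)))"
  have lin_s: "linear (s' w)" and lin_t: "linear (t' w)" if "w \<in> M" for w
    using s(1) t(1) that by (auto simp: M_def intro: has_derivative_linear)
  have der': "(\<Psi> has_derivative (\<lambda>v. p (s' w v) (t' w v))) (at w)" if "w \<in> M" for w
    unfolding \<Psi>_def p_def using s(1)[of w] t(1)[of w] that
    by (auto simp: M_def intro!: derivative_eq_intros)
  have \<Psi>': "blinfun_apply (\<Psi>' w) = (\<lambda>v. p (s' w v) (t' w v))" if "w \<in> M" for w
    unfolding \<Psi>'_def by (rule bounded_linear_Blinfun_apply[OF has_derivative_bounded_linear[OF der'[OF that]]])
  have der: "(\<Psi> has_derivative blinfun_apply (\<Psi>' w)) (at w)" if "w \<in> M" for w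
    using der'[OF that] \<Psi>'[OF that] by simp
  have cont: "continuous_on M \<Psi>'"
  proof (rule continuous_on_blinfun_componentwise)
    fix v :: "real^2"
    have "continuous_on M (\<lambda>w. p (s' w v) (t' w v))"
      unfolding p_def M_def
      by (intro continuous_intros continuous_on_subset[OF s(2)] continuous_on_subset[OF t(2)]) auto
    then show "continuous_on M (\<lambda>w. blinfun_apply (\<Psi>' w) v)"
      by (rule continuous_on_eq) (simp add: \<Psi>')
  qed
  have "inj (blinfun_apply (\<Psi>' w0))"
    unfolding linear_injective_0[OF bounded_linear.linear[OF blinfun.bounded_linear_right]]
  proof (intro allI impI)
    fix v assume "blinfun_apply (\<Psi>' w0) v = 0"
    then have "p (s' w0 v) (t' w0 v) = 0" by (simp add: \<Psi>'[OF M(2)])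
    then have "s' w0 v = 0" "t' w0 v = 0" using p_nth by (metis zero_index)+
    then show "v = 0" using transversal s(4) t(4) M(2) by (auto simp: M_def)
  qed
  then obtain i where i: "linear i" "i \<circ> blinfun_apply (\<Psi>' w0) = id"
    using linear_injective_left_inverse[OF bounded_linear.linear[OF blinfun.bounded_linear_right]] by blast
  have "Blinfun i o\<^sub>L \<Psi>' w0 = id_blinfun"
    using i by (intro blinfun_eqI)
      (simp add: bounded_linear_Blinfun_apply linear_conv_bounded_linear fun_eq_iff)
  from inverse_function_theorem[OF M(1) der cont M(2) this]
  obtain U V G G' where U: "open U" "U \<subseteq> M" "w0 \<in> U" and V: "open V" "\<Psi> w0 \<in> V"
    and hom: "homeomorphism U V \<Psi> G"
    and G: "\<And>q. q \<in> V \<Longrightarrow> (G has_derivative G' q) (at q)"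
    and G': "\<And>q. q \<in> V \<Longrightarrow> G' q = inv (blinfun_apply (\<Psi>' (G q)))"
    and bij: "\<And>q. q \<in> V \<Longrightarrow> bij (blinfun_apply (\<Psi>' (G q)))"
    by blast
  have GU: "G q \<in> U" "\<Psi> (G q) = q" if "q \<in> V" for q
    using hom that by (auto simp: homeomorphism_def)
  have GPsi: "G (\<Psi> w) = w" "\<Psi> w \<in> V" if "w \<in> U" for w
    using hom that by (auto simp: homeomorphism_def)
  have UM: "w \<in> N1" "w \<in> N2" if "w \<in> U" for w using that U by (auto simp: M_def)
  have G'_nth: "s' (G q) (G' q k) = k $ 1" "t' (G q) (G' q k) = k $ 2" if "q \<in> V" for q k
  proof -
    have "blinfun_apply (\<Psi>' (G q)) (G' q k) = k"
      using bij[OF that] by (simp add: G'[OF that] bij_is_surj surj_f_inv_f)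
    then have "p (s' (G q) (G' q k)) (t' (G q) (G' q k)) = k"
      using \<Psi>' GU(1)[OF that] U(2) by (simp add: subset_iff)
    then show "s' (G q) (G' q k) = k $ 1" "t' (G q) (G' q k) = k $ 2" using p_nth by metis+
  qed
  obtain e' where e': "e' > 0" "ball (\<Psi> w0) e' \<subseteq> V" using V open_contains_ball by blast
  define e where "e = e' / 2"
  have e: "e > 0" using e' by (simp add: e_def)
  define B1 where "B1 = {s w0 - e<..<s w0 + e}"
  define B2 where "B2 = {t w0 - e<..<t w0 + e}"
  have box: "p \<sigma> \<tau> \<in> V" if "\<sigma> \<in> B1" "\<tau> \<in> B2" for \<sigma> \<tau>
  proof -
    have "p (s w0) (t w0) - p \<sigma> \<tau> = (s w0 - \<sigma>) *\<^sub>R axis 1 1 + (t w0 - \<tau>) *\<^sub>R axis 2 1"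
      by (simp add: p_def algebra_simps)
    then have "norm (p (s w0) (t w0) - p \<sigma> \<tau>) \<le> \<bar>s w0 - \<sigma>\<bar> + \<bar>t w0 - \<tau>\<bar>"
      using norm_triangle_ineq[of "(s w0 - \<sigma>) *\<^sub>R axis 1 1 :: real^2" "(t w0 - \<tau>) *\<^sub>R axis 2 1"]
      by (simp add: norm_axis_1)
    also have "\<dots> < e'" using that by (auto simp: B1_def B2_def e_def abs_if)
    finally show ?thesis using e'(2) by (auto simp: \<Psi>_def dist_norm)
  qed
  have const_x: "xh (G (p \<sigma> \<tau>)) = xh (G (p \<sigma> \<tau>'))" if "\<sigma> \<in> B1" "\<tau> \<in> B2" "\<tau>' \<in> B2" for \<sigma> \<tau> \<tau>'
  proof (rule has_derivative_zero_unique[of B2 "\<lambda>\<tau>. xh (G (p \<sigma> \<tau>))"])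
    fix \<tau> assume \<tau>: "\<tau> \<in> B2"
    have q: "p \<sigma> \<tau> \<in> V" by (rule box[OF that(1) \<tau>])
    have "(p \<sigma> has_derivative (\<lambda>k. p 0 k)) (at \<tau>)"
      unfolding p_def by (auto intro!: derivative_eq_intros)
    from has_derivative_compose[OF this G[OF q]]
    have "((\<lambda>\<tau>. G (p \<sigma> \<tau>)) has_derivative (\<lambda>k. G' (p \<sigma> \<tau>) (p 0 k))) (at \<tau>)" .
    from has_derivative_compose[OF this xh(1)[OF UM(1)[OF GU(1)[OF q]]]]
    have "((\<lambda>\<tau>. xh (G (p \<sigma> \<tau>))) has_derivative (\<lambda>k. xh' (G (p \<sigma> \<tau>)) (G' (p \<sigma> \<tau>) (p 0 k)))) (at \<tau>)" .
    moreover have "xh' (G (p \<sigma> \<tau>)) (G' (p \<sigma> \<tau>) (p 0 k)) = 0" for k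
      by (rule xh(2)[OF UM(1)[OF GU(1)[OF q]]]) (simp add: G'_nth[OF q] p_nth)
    ultimately show "((\<lambda>\<tau>. xh (G (p \<sigma> \<tau>))) has_derivative (\<lambda>k. 0)) (at \<tau> within B2)"
      by (simp add: has_derivative_at_withinI)
  qed (use that in \<open>auto simp: B2_def\<close>)
  have const_y: "yh (G (p \<sigma> \<tau>)) = yh (G (p \<sigma>' \<tau>))" if "\<sigma> \<in> B1" "\<sigma>' \<in> B1" "\<tau> \<in> B2" for \<sigma> \<sigma>' \<tau>
  proof (rule has_derivative_zero_unique[of B1 "\<lambda>\<sigma>. yh (G (p \<sigma> \<tau>))"])
    fix \<sigma> assume \<sigma>: "\<sigma> \<in> B1"
    have q: "p \<sigma> \<tau> \<in> V" by (rule box[OF \<sigma> that(3)])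
    have "((\<lambda>\<sigma>. p \<sigma> \<tau>) has_derivative (\<lambda>k. p k 0)) (at \<sigma>)"
      unfolding p_def by (auto intro!: derivative_eq_intros)
    from has_derivative_compose[OF this G[OF q]]
    have "((\<lambda>\<sigma>. G (p \<sigma> \<tau>)) has_derivative (\<lambda>k. G' (p \<sigma> \<tau>) (p k 0))) (at \<sigma>)" .
    from has_derivative_compose[OF this yh(1)[OF UM(2)[OF GU(1)[OF q]]]]
    have "((\<lambda>\<sigma>. yh (G (p \<sigma> \<tau>))) has_derivative (\<lambda>k. yh' (G (p \<sigma> \<tau>)) (G' (p \<sigma> \<tau>) (p k 0)))) (at \<sigma>)" .
    moreover have "yh' (G (p \<sigma> \<tau>)) (G' (p \<sigma> \<tau>) (p k 0)) = 0" for k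
      by (rule yh(2)[OF UM(2)[OF GU(1)[OF q]]]) (simp add: G'_nth[OF q] p_nth)
    ultimately show "((\<lambda>\<sigma>. yh (G (p \<sigma> \<tau>))) has_derivative (\<lambda>k. 0)) (at \<sigma> within B1)"
      by (simp add: has_derivative_at_withinI)
  qed (use that in \<open>auto simp: B1_def\<close>)
  have contU: "continuous_on U s" "continuous_on U t"
    by (rule has_derivative_continuous_on[OF has_derivative_at_withinI], erule s(1)[OF UM(1)])
      (rule has_derivative_continuous_on[OF has_derivative_at_withinI], erule t(1)[OF UM(2)])
  \<comment> \<open>Inside \<open>U'\<close> all points have coordinates in the box, so that values at points with the same \<open>s\<close> or
    the same \<open>t\<close> can be compared.\<close>
  define U' where "U' = (U \<inter> s -` B1) \<inter> (U \<inter> t -` B2)"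
  have U': "open U'" "w0 \<in> U'" "U' \<subseteq> U"
    unfolding U'_def B1_def B2_def using U e
    by (auto intro!: continuous_open_preimage contU)
  have "open ((\<lambda>\<sigma>. w0 + \<sigma> *\<^sub>R a) -` U')" "open ((\<lambda>\<sigma>. w0 + \<sigma> *\<^sub>R b) -` U')"
    using U'(1) by (auto intro!: continuous_open_vimage continuous_intros)
  then have "open ((\<lambda>\<sigma>. w0 + \<sigma> *\<^sub>R a) -` U' \<inter> (\<lambda>\<sigma>. w0 + \<sigma> *\<^sub>R b) -` U')" by blast
  moreover have "0 \<in> (\<lambda>\<sigma>. w0 + \<sigma> *\<^sub>R a) -` U' \<inter> (\<lambda>\<sigma>. w0 + \<sigma> *\<^sub>R b) -` U'" using U' by simp
  ultimately obtain \<delta> where \<delta>: "\<delta> > 0"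
    "ball 0 \<delta> \<subseteq> (\<lambda>\<sigma>. w0 + \<sigma> *\<^sub>R a) -` U' \<inter> (\<lambda>\<sigma>. w0 + \<sigma> *\<^sub>R b) -` U'"
    unfolding open_contains_ball by blast
  define I where "I = {-\<delta><..<\<delta>}"
  have on_curves: "w0 + \<sigma> *\<^sub>R a \<in> U'" "w0 + \<sigma> *\<^sub>R b \<in> U'" if "\<sigma> \<in> I" for \<sigma>
    using that \<delta>(2) by (auto simp: I_def subset_iff)
  have open_image: "open ((\<lambda>\<sigma>. f (w0 + \<sigma> *\<^sub>R c)) ` I)"
    if curve: "\<And>\<sigma>. \<sigma> \<in> I \<Longrightarrow> w0 + \<sigma> *\<^sub>R c \<in> U'"
      and f: "\<And>w. w \<in> U' \<Longrightarrow> (f has_derivative f' w) (at w)" "\<And>w. w \<in> U' \<Longrightarrow> f' w c \<noteq> (0 :: real)"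
    for f f' c
  proof -
    let ?g = "\<lambda>\<sigma>. f (w0 + \<sigma> *\<^sub>R c)"
    have g: "(?g has_derivative (\<lambda>k. f' (w0 + \<sigma> *\<^sub>R c) (k *\<^sub>R c))) (at \<sigma>)" if "\<sigma> \<in> I" for \<sigma>
    proof -
      have "((\<lambda>\<sigma>. w0 + \<sigma> *\<^sub>R c) has_derivative (\<lambda>k. k *\<^sub>R c)) (at \<sigma>)"
        by (auto intro!: derivative_eq_intros)
      from has_derivative_compose[OF this f(1)[OF curve[OF that]]] show ?thesis .
    qed
    have ne: "?g \<sigma> \<noteq> ?g \<sigma>'" if "\<sigma> \<in> I" "\<sigma>' \<in> I" and less: "\<sigma> < \<sigma>'" for \<sigma> \<sigma>'
    proof -
      have sub: "\<xi> \<in> I" if "\<sigma> \<le> \<xi>" "\<xi> \<le> \<sigma>'" for \<xi>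
        using that \<open>\<sigma> \<in> I\<close> \<open>\<sigma>' \<in> I\<close> by (auto simp: I_def)
      have "\<exists>\<xi>\<in>{\<sigma><..<\<sigma>'}. ?g \<sigma>' - ?g \<sigma> = f' (w0 + \<xi> *\<^sub>R c) ((\<sigma>' - \<sigma>) *\<^sub>R c)"
        by (rule mvt_simple[OF less, of ?g "\<lambda>\<sigma> k. f' (w0 + \<sigma> *\<^sub>R c) (k *\<^sub>R c)"])
          (rule has_derivative_at_withinI[OF g[OF sub]])
      then obtain \<xi> where \<xi>: "\<xi> \<in> {\<sigma><..<\<sigma>'}"
        "?g \<sigma>' - ?g \<sigma> = f' (w0 + \<xi> *\<^sub>R c) ((\<sigma>' - \<sigma>) *\<^sub>R c)" by blast
      have in_U': "w0 + \<xi> *\<^sub>R c \<in> U'" using \<xi>(1) sub curve by simp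
      then have "f' (w0 + \<xi> *\<^sub>R c) ((\<sigma>' - \<sigma>) *\<^sub>R c) = (\<sigma>' - \<sigma>) * f' (w0 + \<xi> *\<^sub>R c) c"
        using linear_cmul[OF has_derivative_linear[OF f(1)[OF in_U']]] by simp
      then show ?thesis using \<xi>(2) f(2)[OF in_U'] less by auto
    qed
    have "inj_on ?g I"
      by (rule inj_onI) (metis ne linorder_less_linear)
    moreover have "continuous_on I ?g"
      using g by (intro has_derivative_continuous_on) (auto intro: has_derivative_at_withinI)
    moreover have "is_interval I" "open I" by (auto simp: I_def)
    ultimately show ?thesis using injective_eq_1d_open_map_UNIV by blast
  qed
  have s_open: "open ((\<lambda>\<sigma>. s (w0 + \<sigma> *\<^sub>R a)) ` I)"
    by (rule open_image[of a s s']) (use on_curves s UM U' in auto)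
  have t_open: "open ((\<lambda>\<sigma>. t (w0 + \<sigma> *\<^sub>R b)) ` I)"
    by (rule open_image[of b t t']) (use on_curves t UM U' in auto)
  define N where "N = (U' \<inter> s -` ((\<lambda>\<sigma>. s (w0 + \<sigma> *\<^sub>R a)) ` I)) \<inter> (U' \<inter> t -` ((\<lambda>\<sigma>. t (w0 + \<sigma> *\<^sub>R b)) ` I))"
  have "open N" unfolding N_def
    using U' s_open t_open
    by (intro open_Int continuous_open_preimage continuous_on_subset[OF contU(1)] continuous_on_subset[OF contU(2)]) auto
  moreover have "w0 \<in> N" unfolding N_def using U'(2) \<delta>(1)
    by (auto simp: I_def intro!: image_eqI[of _ _ 0])
  moreover have "N \<subseteq> W" using U' UM(1) N1(3) by (auto simp: N_def)
  moreover have "w0 + \<sigma> *\<^sub>R a \<in> W \<and> x' (w0 + \<sigma> *\<^sub>R a) a \<notin> span {x (w0 + \<sigma> *\<^sub>R a)}"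
    if "\<sigma> \<in> {-\<delta><..<\<delta>}" for \<sigma>
  proof -
    have "w0 + \<sigma> *\<^sub>R a \<in> N1" using on_curves[of \<sigma>] that U' UM by (auto simp: I_def)
    then show ?thesis using s(3) s(4) N1(3) by blast
  qed
  moreover have "w0 + \<tau> *\<^sub>R b \<in> W \<and> y' (w0 + \<tau> *\<^sub>R b) b \<notin> span {y (w0 + \<tau> *\<^sub>R b)}"
    if "\<tau> \<in> {-\<delta><..<\<delta>}" for \<tau>
  proof -
    have "w0 + \<tau> *\<^sub>R b \<in> N2" using on_curves[of \<tau>] that U' UM by (auto simp: I_def)
    then show ?thesis using t(3) t(4) N2(3) by blast
  qed
  moreover have same: "span {x w} = span {x (w0 + \<sigma> *\<^sub>R a)}" "span {y w} = span {y (w0 + \<tau> *\<^sub>R b)}"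
    if w: "w \<in> U'" and \<sigma>: "\<sigma> \<in> I" "s w = s (w0 + \<sigma> *\<^sub>R a)" and \<tau>: "\<tau> \<in> I" "t w = t (w0 + \<tau> *\<^sub>R b)" for w \<sigma> \<tau>
  proof -
    let ?u = "w0 + \<sigma> *\<^sub>R a" and ?v = "w0 + \<tau> *\<^sub>R b"
    have B: "s u \<in> B1" "t u \<in> B2" "G (p (s u) (t u)) = u" "u \<in> N1" "u \<in> N2" if "u \<in> U'" for u
      using that GPsi(1) UM by (auto simp: U'_def \<Psi>_def)
    note Bw = B[OF w] and Bu = B[OF on_curves(1)[OF \<sigma>(1)]] and Bv = B[OF on_curves(2)[OF \<tau>(1)]]
    have "xh w = xh ?u"
      using const_x[OF Bw(1) Bw(2) Bu(2)] Bw(3) Bu(3) \<sigma>(2) by simp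
    then show "span {x w} = span {x ?u}" using xh(3) Bw(4) Bu(4) by simp
    have "yh w = yh ?v"
      using const_y[OF Bw(1) Bv(1) Bw(2)] Bw(3) Bv(3) \<tau>(2) by simp
    then show "span {y w} = span {y ?v}" using yh(3) Bw(5) Bv(5) by simp
  qed
  moreover have "\<exists>\<sigma>\<in>{-\<delta><..<\<delta>}. \<exists>\<tau>\<in>{-\<delta><..<\<delta>}.
      span {x w} = span {x (w0 + \<sigma> *\<^sub>R a)} \<and> span {y w} = span {y (w0 + \<tau> *\<^sub>R b)}" if w: "w \<in> N" for w
  proof -
    obtain \<sigma> \<tau> where "\<sigma> \<in> I" "s w = s (w0 + \<sigma> *\<^sub>R a)" "\<tau> \<in> I" "t w = t (w0 + \<tau> *\<^sub>R b)" "w \<in> U'"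
      using w by (auto simp: N_def)
    then show ?thesis using same[of w \<sigma> \<tau>] unfolding I_def by blast
  qed
  moreover have "\<exists>w\<in>N. span {x w} = span {x (w0 + \<sigma> *\<^sub>R a)} \<and> span {y w} = span {y (w0 + \<tau> *\<^sub>R b)}"
    if \<sigma>\<tau>: "\<sigma> \<in> {-\<delta><..<\<delta>}" "\<tau> \<in> {-\<delta><..<\<delta>}" for \<sigma> \<tau>
  proof -
    have I: "\<sigma> \<in> I" "\<tau> \<in> I" using \<sigma>\<tau> by (auto simp: I_def)
    let ?q = "p (s (w0 + \<sigma> *\<^sub>R a)) (t (w0 + \<tau> *\<^sub>R b))"
    have B: "s (w0 + \<sigma> *\<^sub>R a) \<in> B1" "t (w0 + \<tau> *\<^sub>R b) \<in> B2"
      using on_curves(1)[OF I(1)] on_curves(2)[OF I(2)] by (auto simp: U'_def)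
    have q: "?q \<in> V" by (rule box[OF B])
    have "p (s (G ?q)) (t (G ?q)) = ?q" using GU(2)[OF q] by (simp add: \<Psi>_def)
    then have st: "s (G ?q) = s (w0 + \<sigma> *\<^sub>R a)" "t (G ?q) = t (w0 + \<tau> *\<^sub>R b)" using p_nth by metis+
    then have "G ?q \<in> U'" using B GU(1)[OF q] by (simp add: U'_def)
    moreover from this have "G ?q \<in> N" using st I by (auto simp: N_def)
    ultimately show ?thesis using same[OF _ I(1) st(1) I(2) st(2)] by blast
  qed
  ultimately show ?thesis using \<delta>(1) by (intro that[of N \<delta>])
qed

section \<open>Plane curves traced by the generators\<close>

lemma Ck_on_cong:
  assumes "open I" and "\<And>s. s \<in> I \<Longrightarrow> f s = g s" and "Ck_on k f I"
  shows "Ck_on k g I"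
  using assms(2,3)
proof (induction k arbitrary: f g)
  case 0
  then show ?case using continuous_on_cong[of I I f g] by simp
next
  case (Suc k)
  have der: "(g has_derivative frechet_derivative f (at s)) (at s)" if s: "s \<in> I" for s
  proof -
    have "(f has_derivative frechet_derivative f (at s)) (at s)"
      using Suc.prems(2) s by (simp add: frechet_derivative_works[symmetric])
    then show ?thesis
      by (rule has_derivative_transform_within_open[OF _ assms(1) s Suc.prems(1)])
  qed
  have "Ck_on k (\<lambda>s. frechet_derivative g (at s) v) I" for v
  proof (rule Suc.IH)
    show "Ck_on k (\<lambda>s. frechet_derivative f (at s) v) I" using Suc.prems(2) by simp
  qed (simp add: frechet_derivative_at[OF der])
  then show ?case using der by (auto intro: differentiableI)
qed

lemma has_derivative_along_line:
  assumes "bounded_linear T" "(f has_derivative f') (at (w0 + s *\<^sub>R a))"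
  shows "((\<lambda>s. T (f (w0 + s *\<^sub>R a))) has_derivative (\<lambda>r. T (f' (r *\<^sub>R a)))) (at s)"
proof -
  have "((\<lambda>s. w0 + s *\<^sub>R a) has_derivative (\<lambda>r. r *\<^sub>R a)) (at s)"
    by (auto intro!: derivative_eq_intros)
  from bounded_linear.has_derivative[OF assms(1) has_derivative_compose[OF this assms(2)]]
  show ?thesis .
qed

text \<open>Restriction to a line and composition with a linear map commute with taking derivatives in fixed
directions, which is what the recursion in \<open>Ck_on\<close> iterates.\<close>

lemma Ck_on_along_line:
  assumes T: "bounded_linear T" and I: "open I" "\<And>s. s \<in> I \<Longrightarrow> w0 + s *\<^sub>R a \<in> W"
    and "Ck_on k f W"
  shows "Ck_on k (\<lambda>s. T (f (w0 + s *\<^sub>R a))) I"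
  using assms(4)
proof (induction k arbitrary: f)
  case 0
  then have "continuous_on I (\<lambda>s. f (w0 + s *\<^sub>R a))"
    using I(2) by (intro continuous_on_compose2[of W f I]) (auto intro!: continuous_intros)
  from bounded_linear.continuous_on[OF T this] show ?case by simp
next
  case (Suc k)
  have der: "((\<lambda>s. T (f (w0 + s *\<^sub>R a))) has_derivative
      (\<lambda>r. T (frechet_derivative f (at (w0 + s *\<^sub>R a)) (r *\<^sub>R a)))) (at s)" if "s \<in> I" for s
    using Suc.prems I(2)[OF that]
    by (intro has_derivative_along_line[OF T]) (simp add: frechet_derivative_works[symmetric])
  have "Ck_on k (\<lambda>s. frechet_derivative (\<lambda>s. T (f (w0 + s *\<^sub>R a))) (at s) r) I" for r
  proof (rule Ck_on_cong[OF I(1)])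
    show "Ck_on k (\<lambda>s. T ((\<lambda>w. frechet_derivative f (at w) (r *\<^sub>R a)) (w0 + s *\<^sub>R a))) I"
      by (rule Suc.IH) (use Suc.prems in simp)
  qed (simp add: frechet_derivative_at[OF der, symmetric])
  then show ?case using der by (auto intro: differentiableI)
qed

text \<open>Examples are the idempotents \<open>(1 \<plusminus> e) / 2\<close> of the double numbers and the dual number \<open>\<epsilon>\<close>. Such a \<open>c\<close>
halves the real dimension of every free module.\<close>

definition one_dim_ideal :: "'a::plane_algebra \<Rightarrow> bool" where
  "one_dim_ideal c \<longleftrightarrow> c \<noteq> 0 \<and> (\<forall>a. \<exists>r. c * a = r *\<^sub>R c)"

definition ideal_plane :: "'a::plane_algebra \<Rightarrow> (real^2^3) set" where
  "ideal_plane c = range (\<lambda>X. real_coords (c *s X))"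

text \<open>The point in which the generator over \<open>w\<close> meets the plane of \<open>c\<close>.\<close>

definition plane_trace :: "'a::plane_algebra \<Rightarrow> (real^2 \<Rightarrow> 'a^3) \<Rightarrow> real^2 \<Rightarrow> real^2^3" where
  "plane_trace c \<phi> w = real_coords (c *s \<phi> w)"

lemma linear_real_coords_smult: "linear (\<lambda>X. real_coords (c *s X))"
  using linear_compose[OF linear_smult_right linear_real_coords] by (simp add: o_def)

lemma bounded_linear_real_coords_smult: "bounded_linear (\<lambda>X. real_coords (c *s X))"
  using linear_real_coords_smult by (simp add: linear_conv_bounded_linear)

lemma real_coords_eq_iff: "real_coords X = real_coords Y \<longleftrightarrow> X = Y"
  using bij_is_inj[OF bij_real_coords] by (auto dest: injD)

lemma real_coords_eq_0_iff: "real_coords X = 0 \<longleftrightarrow> X = 0"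
  using real_coords_eq_iff[of X 0] by (simp add: linear_0[OF linear_real_coords])

text \<open>Every multiple of \<open>c\<close> is a real multiple, so that \<open>c X\<close> depends only on a vector of three real numbers.\<close>

lemma two_plane_ideal_plane:
  fixes c :: "'a::plane_algebra"
  assumes c: "one_dim_ideal c"
  shows "two_plane (ideal_plane c)"
proof -
  let ?f = "\<lambda>p :: real^3. real_coords (c *s (\<chi> i. (of_real (p $ i) :: 'a)))"
  have f: "linear ?f"
  proof (rule linearI)
    fix p q :: "real^3" and r :: real
    have "(\<chi> i. (of_real ((p + q) $ i) :: 'a)) = (\<chi> i. of_real (p $ i)) + (\<chi> i. of_real (q $ i))"
      "(\<chi> i. (of_real ((r *\<^sub>R p) $ i) :: 'a)) = r *\<^sub>R (\<chi> i. of_real (p $ i))"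
      by (simp_all add: vec_eq_iff scaleR_conv_of_real[of r "of_real _ :: 'a"])
    then show "?f (p + q) = ?f p + ?f q" "?f (r *\<^sub>R p) = r *\<^sub>R ?f p"
      by (simp_all only: linear_add[OF linear_real_coords_smult] linear_cmul[OF linear_real_coords_smult])
  qed
  have nth: "(c *s (\<chi> i. (of_real (p $ i) :: 'a))) $ i = (p $ i) *\<^sub>R c" for p :: "real^3" and i
    by (simp add: scaleR_conv_of_real[of _ c] mult.commute)
  have "inj ?f"
    unfolding linear_injective_0[OF f]
  proof (intro allI impI)
    fix p :: "real^3" assume "?f p = 0"
    then have "c *s (\<chi> i. (of_real (p $ i) :: 'a)) = 0"
      by (simp add: real_coords_eq_0_iff)
    then have "(p $ i) *\<^sub>R c = 0" for i using nth[of p i] by simp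
    then show "p = 0" using c by (simp add: one_dim_ideal_def vec_eq_iff)
  qed
  then have "dim (range ?f) = 3" by (subst dim_image_eq[OF f]) auto
  moreover have "range ?f = ideal_plane c"
    unfolding ideal_plane_def
  proof safe
    fix X :: "'a^3"
    obtain r where r: "\<And>a. c * a = r a *\<^sub>R c" using c unfolding one_dim_ideal_def by metis
    have "c *s X = c *s (\<chi> i. (of_real ((\<chi> i. r (X $ i)) $ i) :: 'a))"
      unfolding vec_eq_iff nth by (simp add: r)
    then show "real_coords (c *s X) \<in> range ?f" by (metis rangeI)
  qed blast
  ultimately show ?thesis
    unfolding two_plane_def
    using linear_subspace_image[OF linear_real_coords_smult subspace_UNIV, of c] by (simp add: ideal_plane_def)
qed

lemma has_derivative_plane_trace:
  assumes "local_param \<gamma> W \<phi>" "w \<in> W"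
  shows "(plane_trace c \<phi> has_derivative (\<lambda>v. real_coords (c *s frechet_derivative \<phi> (at w) v))) (at w)"
proof -
  have "(\<phi> has_derivative frechet_derivative \<phi> (at w)) (at w)"
    using smooth_line_differentiable[OF assms] by (simp add: frechet_derivative_works)
  from bounded_linear.has_derivative[OF bounded_linear_real_coords_smult this] show ?thesis
    by (simp add: plane_trace_def[abs_def])
qed

lemma continuous_on_plane_trace_derivative:
  assumes "local_param \<gamma> W \<phi>"
  shows "continuous_on W (\<lambda>w. real_coords (c *s frechet_derivative \<phi> (at w) v))"
  by (rule bounded_linear.continuous_on[OF bounded_linear_real_coords_smult smooth_on_imp_C1])
    (use assms in \<open>simp add: local_param_def\<close>)

lemma plane_trace_nonzero:
  assumes "one_dim_ideal c" "local_param \<gamma> W \<phi>" "w \<in> W"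
  shows "plane_trace c \<phi> w \<noteq> 0"
proof
  assume "plane_trace c \<phi> w = 0"
  then have "c *s \<phi> w = 0"
    by (simp add: plane_trace_def real_coords_eq_0_iff)
  then show False
    using coord_vector_free[OF local_param_coord_vector[OF assms(2,3)]] assms(1) by (auto simp: one_dim_ideal_def)
qed

text \<open>The tangent vectors are images under multiplication by \<open>c\<close> of vectors of the tangent space of \<open>\<gamma>\<close>, and
multiples of \<open>c Y\<close> and \<open>c Z\<close> for a basis \<open>Y\<close>, \<open>Z\<close> of the latter are real multiples.\<close>

lemma plane_trace_tangent_dim:
  assumes c: "one_dim_ideal c" and sl: "smooth_line \<gamma>" and lp: "local_param \<gamma> W \<phi>" and w: "w \<in> W"
  shows "dim (insert (plane_trace c \<phi> w) (range (\<lambda>v. real_coords (c *s frechet_derivative \<phi> (at w) v)))) \<le> 2"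
proof -
  note \<phi> = smooth_line_differentiable[OF lp w]
  obtain Y Z where YZ: "tangent_space \<phi> w = straight_line Y Z"
    using smooth_line_tangent_space[OF sl lp w] by (auto simp: free_rank_two_def)
  have "real_coords (c *s X) \<in> span {real_coords (c *s Y), real_coords (c *s Z)}"
    if "X \<in> tangent_space \<phi> w" for X
  proof -
    have "X \<in> straight_line Y Z" using that YZ by simp
    then obtain P Q where X: "X = P *s Y + Q *s Z" by (auto simp: straight_line_def)
    obtain r r' where r: "c * P = r *\<^sub>R c" "c * Q = r' *\<^sub>R c" using c unfolding one_dim_ideal_def by metis
    have "c *s X = (c * P) *s Y + (c * Q) *s Z" by (simp add: X vec_eq_iff algebra_simps)
    also have "\<dots> = r *\<^sub>R (c *s Y) + r' *\<^sub>R (c *s Z)" by (simp add: r vec_eq_iff)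
    finally have "real_coords (c *s X) = r *\<^sub>R real_coords (c *s Y) + r' *\<^sub>R real_coords (c *s Z)"
      by (simp add: linear_add[OF linear_real_coords] linear_cmul[OF linear_real_coords])
    then show ?thesis by (simp add: span_add span_scale span_base)
  qed
  then have "insert (plane_trace c \<phi> w) (range (\<lambda>v. real_coords (c *s frechet_derivative \<phi> (at w) v)))
      \<subseteq> span {real_coords (c *s Y), real_coords (c *s Z)}"
    using tangent_space_members[OF \<phi>, of 1] tangent_space_members(2)[OF \<phi>] by (auto simp: plane_trace_def)
  from dim_le_card[OF this] show ?thesis
    by (rule order_trans) (simp_all add: card_insert_if)
qed

text \<open>If the point stood still in all directions, multiplication by \<open>c\<close> would map the whole tangent space of
\<open>\<gamma>\<close> to real multiples of \<open>c \<phi>(w)\<close>. Then \<open>c Y\<close> and \<open>c Z\<close> would be dependent over the reals for a basis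
\<open>Y\<close>, \<open>Z\<close>, contrary to freeness.\<close>

lemma plane_trace_moving_direction:
  assumes c: "one_dim_ideal c" and sl: "smooth_line \<gamma>" and lp: "local_param \<gamma> W \<phi>" and w: "w \<in> W"
  shows "\<exists>a. real_coords (c *s frechet_derivative \<phi> (at w) a) \<notin> span {plane_trace c \<phi> w}"
proof (rule ccontr)
  assume "\<not> ?thesis"
  then have D: "real_coords (c *s frechet_derivative \<phi> (at w) v) \<in> span {plane_trace c \<phi> w}" for v by blast
  have *: "\<exists>r. c *s X = r *\<^sub>R (c *s \<phi> w)" if X: "X \<in> tangent_space \<phi> w" for X
  proof -
    obtain v P where X: "X = frechet_derivative \<phi> (at w) v + P *s \<phi> w"
      using X by (auto simp: tangent_space_def)
    obtain r where "c * P = r *\<^sub>R c" using c unfolding one_dim_ideal_def by blast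
    then have "c *s (P *s \<phi> w) = r *\<^sub>R (c *s \<phi> w)" by (simp add: vec_eq_iff flip: mult.assoc)
    moreover obtain r' where "real_coords (c *s frechet_derivative \<phi> (at w) v) = r' *\<^sub>R real_coords (c *s \<phi> w)"
      using D[of v] by (auto simp: span_singleton plane_trace_def)
    then have "c *s frechet_derivative \<phi> (at w) v = r' *\<^sub>R (c *s \<phi> w)"
      by (simp only: linear_cmul[OF linear_real_coords, symmetric] real_coords_eq_iff)
    ultimately have "c *s X = (r' + r) *\<^sub>R (c *s \<phi> w)"
      by (simp add: X linear_add[OF linear_smult_right] scaleR_left_distrib)
    then show ?thesis by blast
  qed
  obtain Y Z where YZ: "tangent_space \<phi> w = straight_line Y Z"
    and free: "\<And>P Q. P *s Y + Q *s Z = 0 \<Longrightarrow> P = 0 \<and> Q = 0"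
    using smooth_line_tangent_space[OF sl lp w] unfolding free_rank_two_def by blast
  have "Y = 1 *s Y + 0 *s Z" "Z = 0 *s Y + 1 *s Z" by simp_all
  then have "Y \<in> tangent_space \<phi> w" "Z \<in> tangent_space \<phi> w"
    unfolding YZ straight_line_def by blast+
  then obtain p q where pq: "c *s Y = p *\<^sub>R (c *s \<phi> w)" "c *s Z = q *\<^sub>R (c *s \<phi> w)" using * by blast
  have "(q *\<^sub>R c) *s Y + (- (p *\<^sub>R c)) *s Z = q *\<^sub>R (c *s Y) - p *\<^sub>R (c *s Z)"
    by (simp add: vec_eq_iff)
  also have "\<dots> = 0" unfolding pq by (simp add: vec_eq_iff mult.commute)
  finally have "p *\<^sub>R c = 0" using free[of "q *\<^sub>R c" "- (p *\<^sub>R c)"] by simp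
  then have "p = 0" using c by (simp add: one_dim_ideal_def)
  then have "c *s Y + 0 *s Z = 0" using pq(1) by simp
  then show False using free[of c 0] c by (simp add: one_dim_ideal_def)
qed

lemma plane_curve_plane_trace:
  assumes c: "one_dim_ideal c" and lp: "local_param \<gamma> W \<phi>"
    and I: "open I" "connected I" "I \<noteq> {}" "\<And>s. s \<in> I \<Longrightarrow> w0 + s *\<^sub>R a \<in> W"
    and moving: "\<And>s. s \<in> I \<Longrightarrow> real_coords (c *s frechet_derivative \<phi> (at (w0 + s *\<^sub>R a)) a)
      \<notin> span {plane_trace c \<phi> (w0 + s *\<^sub>R a)}"
  shows "plane_curve (ideal_plane c) I (\<lambda>s. plane_trace c \<phi> (w0 + s *\<^sub>R a))"
  unfolding plane_curve_def
proof (intro conjI ballI I(1-3) two_plane_ideal_plane[OF c])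
  have "smooth_on \<phi> W" using lp by (simp add: local_param_def)
  then show "smooth_on (\<lambda>s. plane_trace c \<phi> (w0 + s *\<^sub>R a)) I"
    unfolding smooth_on_def plane_trace_def
    using Ck_on_along_line[OF bounded_linear_real_coords_smult[of c] I(1) I(4), where f = \<phi>] by blast
  fix s assume s: "s \<in> I"
  let ?w = "w0 + s *\<^sub>R a"
  let ?v = "real_coords (c *s frechet_derivative \<phi> (at ?w) a)"
  show "plane_trace c \<phi> ?w \<in> ideal_plane c" by (simp add: plane_trace_def ideal_plane_def)
  show nz: "plane_trace c \<phi> ?w \<noteq> 0" by (rule plane_trace_nonzero[OF c lp I(4)[OF s]])
  have lin: "linear (frechet_derivative \<phi> (at ?w))"
    by (rule linear_frechet_derivative[OF smooth_line_differentiable[OF lp I(4)[OF s]]])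
  have "(\<phi> has_derivative frechet_derivative \<phi> (at ?w)) (at ?w)"
    using smooth_line_differentiable[OF lp I(4)[OF s]] by (simp add: frechet_derivative_works)
  from has_derivative_along_line[OF bounded_linear_real_coords_smult this]
  have "((\<lambda>s. plane_trace c \<phi> (w0 + s *\<^sub>R a)) has_derivative (\<lambda>r. r *\<^sub>R ?v)) (at s)"
    by (simp add: plane_trace_def linear_cmul[OF lin] linear_cmul[OF linear_real_coords_smult])
  then have D: "frechet_derivative (\<lambda>s. plane_trace c \<phi> (w0 + s *\<^sub>R a)) (at s) = (\<lambda>r. r *\<^sub>R ?v)"
    by (rule frechet_derivative_at[symmetric])
  have "span (insert (plane_trace c \<phi> ?w) (range (\<lambda>r. r *\<^sub>R ?v))) = span (insert ?v {plane_trace c \<phi> ?w})"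
  proof (rule span_eq[THEN iffD2], intro conjI)
    show "insert (plane_trace c \<phi> ?w) (range (\<lambda>r. r *\<^sub>R ?v)) \<subseteq> span (insert ?v {plane_trace c \<phi> ?w})"
      by (auto intro: span_base span_scale)
    have "1 *\<^sub>R ?v \<in> range (\<lambda>r. r *\<^sub>R ?v)" by (rule rangeI)
    then show "insert ?v {plane_trace c \<phi> ?w} \<subseteq> span (insert (plane_trace c \<phi> ?w) (range (\<lambda>r. r *\<^sub>R ?v)))"
      by (auto intro: span_base)
  qed
  then show "proj_rank (\<lambda>s. plane_trace c \<phi> (w0 + s *\<^sub>R a)) s = 1"
    using nz moving[OF s] by (simp add: proj_rank_def proj_tangent_def D dim_insert)
qed

section \<open>Generators of smooth lines over the double and dual numbers\<close>

lemma generator_smult: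
  assumes "regular u" shows "generator (u *s X) = generator X"
proof -
  obtain c where c: "c * u = 1" using regular_imp_unit[OF assms] by blast
  have 1: "a *s (u *s X) = (a * u) *s X" for a by (simp add: vec_eq_iff mult.assoc)
  moreover have 2: "a *s X = (a * c) *s (u *s X)" for a
    using c by (simp add: vec_eq_iff) (metis mult.assoc mult.right_neutral)
  show ?thesis unfolding generator_eq
    by (auto simp: 1) (metis 1 2 rangeI)
qed

lemma local_param_open_part:
  assumes "local_param \<gamma> W \<phi>" "open N" "N \<subseteq> W"
  shows "open_part \<gamma> (saturation (\<phi> ` N))"
  using assms unfolding local_param_def by blast

lemma generator_image_saturation: "generator ` saturation (\<phi> ` N) = (\<lambda>w. generator (\<phi> w)) ` N"
proof safe
  fix X assume "X \<in> saturation (\<phi> ` N)"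
  then obtain u w where "regular u" "w \<in> N" "X = u *s \<phi> w" by (auto simp: saturation_def)
  then show "generator X \<in> (\<lambda>w. generator (\<phi> w)) ` N" by (auto simp: generator_smult)
next
  fix w assume "w \<in> N"
  then have "1 *s \<phi> w \<in> saturation (\<phi> ` N)" unfolding saturation_def
    by (intro CollectI exI[of _ 1] exI[of _ "\<phi> w"]) (auto simp: regular_def)
  then show "generator (\<phi> w) \<in> generator ` saturation (\<phi> ` N)" by (metis image_eqI vector_smult_lid)
qed

lemma ruled_eq: "ruled \<gamma> = \<Union> (generator ` \<gamma>) - {0}"
  by (auto simp: ruled_def)

lemma span_pair_cong:
  assumes "span {x} = span {x'}" "span {y} = span {y'}"
  shows "span {x, y} = span {x', y'}"
proof -
  have "span {x, y} = {a + b | a b. a \<in> span {x} \<and> b \<in> span {y}}" for x y :: 'a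
    using span_Un[of "{x}" "{y}"] by (simp add: insert_is_Un[of x "{y}"])
  then show ?thesis using assms by simp
qed

text \<open>An element \<open>a\<close> is \<open>c a + d a\<close>, and both summands are real multiples, of \<open>c\<close> and of \<open>d\<close> respectively.\<close>

lemma generator_decomposition:
  fixes X :: "'a::plane_algebra^3"
  assumes c: "one_dim_ideal c" and d: "one_dim_ideal d" and cd: "c + d = 1"
  shows "generator X = span {real_coords (c *s X), real_coords (d *s X)}"
proof
  show "generator X \<subseteq> span {real_coords (c *s X), real_coords (d *s X)}"
  proof
    fix x assume "x \<in> generator X"
    then obtain a where a: "x = real_coords (a *s X)" by (auto simp: generator_eq)
    obtain r r' where r: "c * a = r *\<^sub>R c" "d * a = r' *\<^sub>R d"
      using c d unfolding one_dim_ideal_def by metis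
    have "a = c * a + d * a" using cd by (metis distrib_right mult_1)
    then have "a *s X = (r *\<^sub>R c + r' *\<^sub>R d) *s X" using r by simp
    also have "\<dots> = r *\<^sub>R (c *s X) + r' *\<^sub>R (d *s X)" by (simp add: vec_eq_iff algebra_simps)
    finally have "x = r *\<^sub>R real_coords (c *s X) + r' *\<^sub>R real_coords (d *s X)"
      by (simp add: a linear_add[OF linear_real_coords] linear_cmul[OF linear_real_coords])
    then show "x \<in> span {real_coords (c *s X), real_coords (d *s X)}"
      by (simp add: span_add span_scale span_base)
  qed
  have "subspace (generator X)" by (simp add: generator_def)
  then show "span {real_coords (c *s X), real_coords (d *s X)} \<subseteq> generator X"
    by (intro span_minimal) (auto simp: generator_eq)
qed

text \<open>The two traces have rank 1. A direction in which neither of them moves would make \<open>D\<phi> v\<close> a multiple of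
\<open>\<phi>\<close>, which an immersion excludes; this is the transversality which lets both parameters vary
independently.\<close>

lemma smooth_line_join_of_plane_curves:
  fixes \<gamma> :: "('a::plane_algebra^3) set" and c d :: 'a
  assumes c: "one_dim_ideal c" and d: "one_dim_ideal d" and cd: "c + d = 1" "c * d = 0"
    and sl: "smooth_line \<gamma>" and X: "X \<in> \<gamma>"
  shows "\<exists>\<gamma>\<^sub>0. open_part \<gamma> \<gamma>\<^sub>0 \<and> X \<in> \<gamma>\<^sub>0 \<and>
    (\<exists>I k J l. plane_curve (ideal_plane c) I k \<and> plane_curve (ideal_plane d) J l \<and>
       generator ` \<gamma>\<^sub>0 = connecting_lines I k J l \<and> ruled \<gamma>\<^sub>0 = join_of I k J l)"
proof -
  obtain W \<phi> where lp: "local_param \<gamma> W \<phi>" and XW: "X \<in> saturation (\<phi> ` W)"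
    using sl X unfolding smooth_line_def smooth_surface_def by blast
  obtain u w0 where u: "regular u" "w0 \<in> W" "X = u *s \<phi> w0" using XW by (auto simp: saturation_def)
  note w0 = u(2)
  have W: "open W" using lp by (simp add: local_param_def)
  let ?D = "\<lambda>w. frechet_derivative \<phi> (at w)"
  obtain a where a: "real_coords (c *s ?D w0 a) \<notin> span {plane_trace c \<phi> w0}"
    using plane_trace_moving_direction[OF c sl lp w0] by blast
  obtain b where b: "real_coords (d *s ?D w0 b) \<notin> span {plane_trace d \<phi> w0}"
    using plane_trace_moving_direction[OF d sl lp w0] by blast
  have transversal: "v = 0"
    if v: "real_coords (c *s ?D w0 v) \<in> span {plane_trace c \<phi> w0}" "real_coords (d *s ?D w0 v) \<in> span {plane_trace d \<phi> w0}" for v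
  proof -
    obtain p q where "real_coords (c *s ?D w0 v) = p *\<^sub>R real_coords (c *s \<phi> w0)"
      "real_coords (d *s ?D w0 v) = q *\<^sub>R real_coords (d *s \<phi> w0)"
      using v by (auto simp: span_singleton plane_trace_def)
    then have pq: "c *s ?D w0 v = p *\<^sub>R (c *s \<phi> w0)" "d *s ?D w0 v = q *\<^sub>R (d *s \<phi> w0)"
      by (simp_all only: linear_cmul[OF linear_real_coords, symmetric] real_coords_eq_iff)
    have "?D w0 v = (c + d) *s ?D w0 v" using cd by simp
    also have "\<dots> = p *\<^sub>R (c *s \<phi> w0) + q *\<^sub>R (d *s \<phi> w0)" by (simp only: vector_sadd_rdistrib pq)
    also have "\<dots> = (p *\<^sub>R c + q *\<^sub>R d) *s \<phi> w0" by (simp add: vec_eq_iff algebra_simps)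
    finally show ?thesis using lp w0 unfolding local_param_def by blast
  qed
  from transversal_rank_one_maps[OF W w0
      has_derivative_plane_trace[OF lp] continuous_on_plane_trace_derivative[OF lp] plane_trace_tangent_dim[OF c sl lp]
      has_derivative_plane_trace[OF lp] continuous_on_plane_trace_derivative[OF lp] plane_trace_tangent_dim[OF d sl lp]
      plane_trace_nonzero[OF c lp w0] a plane_trace_nonzero[OF d lp w0] b transversal]
  obtain N \<delta> where N: "open N" "w0 \<in> N" "N \<subseteq> W" and \<delta>: "\<delta> > 0"
    and curve_c: "\<And>\<sigma>. \<sigma> \<in> {-\<delta><..<\<delta>} \<Longrightarrow> w0 + \<sigma> *\<^sub>R a \<in> W \<and>
      real_coords (c *s ?D (w0 + \<sigma> *\<^sub>R a) a) \<notin> span {plane_trace c \<phi> (w0 + \<sigma> *\<^sub>R a)}"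
    and curve_d: "\<And>\<tau>. \<tau> \<in> {-\<delta><..<\<delta>} \<Longrightarrow> w0 + \<tau> *\<^sub>R b \<in> W \<and>
      real_coords (d *s ?D (w0 + \<tau> *\<^sub>R b) b) \<notin> span {plane_trace d \<phi> (w0 + \<tau> *\<^sub>R b)}"
    and to_curves: "\<And>w. w \<in> N \<Longrightarrow> \<exists>\<sigma>\<in>{-\<delta><..<\<delta>}. \<exists>\<tau>\<in>{-\<delta><..<\<delta>}.
      span {plane_trace c \<phi> w} = span {plane_trace c \<phi> (w0 + \<sigma> *\<^sub>R a)} \<and> span {plane_trace d \<phi> w} = span {plane_trace d \<phi> (w0 + \<tau> *\<^sub>R b)}"
    and from_curves: "\<And>\<sigma> \<tau>. \<sigma> \<in> {-\<delta><..<\<delta>} \<Longrightarrow> \<tau> \<in> {-\<delta><..<\<delta>} \<Longrightarrow> \<exists>w\<in>N.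
      span {plane_trace c \<phi> w} = span {plane_trace c \<phi> (w0 + \<sigma> *\<^sub>R a)} \<and> span {plane_trace d \<phi> w} = span {plane_trace d \<phi> (w0 + \<tau> *\<^sub>R b)}"
    by blast
  let ?I = "{-\<delta><..<\<delta>}"
  let ?k = "\<lambda>\<sigma>. plane_trace c \<phi> (w0 + \<sigma> *\<^sub>R a)" and ?l = "\<lambda>\<tau>. plane_trace d \<phi> (w0 + \<tau> *\<^sub>R b)"
  let ?N = "saturation (\<phi> ` N)"
  have "open_part \<gamma> ?N" by (rule local_param_open_part[OF lp N(1,3)])
  moreover have "X \<in> ?N" using u N(2) by (auto simp: saturation_def)
  moreover have "plane_curve (ideal_plane c) ?I ?k"
    by (rule plane_curve_plane_trace[OF c lp]) (use curve_c \<delta> in auto)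
  moreover have "plane_curve (ideal_plane d) ?I ?l"
    by (rule plane_curve_plane_trace[OF d lp]) (use curve_d \<delta> in auto)
  moreover have gen: "generator (\<phi> w) = span {plane_trace c \<phi> w, plane_trace d \<phi> w}" for w
    unfolding plane_trace_def by (rule generator_decomposition[OF c d cd(1)])
  have lines: "generator ` ?N = connecting_lines ?I ?k ?I ?l"
    unfolding generator_image_saturation connecting_lines_def
  proof (intro equalityI subsetI)
    fix L assume "L \<in> (\<lambda>w. generator (\<phi> w)) ` N"
    then obtain w where w: "w \<in> N" "L = generator (\<phi> w)" by blast
    obtain \<sigma> \<tau> where "\<sigma> \<in> ?I" "\<tau> \<in> ?I" "span {plane_trace c \<phi> w} = span {?k \<sigma>}" "span {plane_trace d \<phi> w} = span {?l \<tau>}"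
      using to_curves[OF w(1)] by blast
    then show "L \<in> {span {?k s, ?l t} | s t. s \<in> ?I \<and> t \<in> ?I}"
      using w(2) gen span_pair_cong by blast
  next
    fix L assume "L \<in> {span {?k s, ?l t} | s t. s \<in> ?I \<and> t \<in> ?I}"
    then obtain \<sigma> \<tau> where st: "\<sigma> \<in> ?I" "\<tau> \<in> ?I" "L = span {?k \<sigma>, ?l \<tau>}" by blast
    obtain w where w: "w \<in> N" "span {plane_trace c \<phi> w} = span {?k \<sigma>}" "span {plane_trace d \<phi> w} = span {?l \<tau>}"
      using from_curves[OF st(1,2)] by blast
    have "L = generator (\<phi> w)" using st(3) gen[of w] span_pair_cong[OF w(2,3)] by simp
    then show "L \<in> (\<lambda>w. generator (\<phi> w)) ` N" using w(1) by blast
  qed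
  moreover have "ruled ?N = join_of ?I ?k ?I ?l"
    unfolding ruled_eq lines join_of_def ..
  ultimately show ?thesis by blast
qed

text \<open>There is only one trace here. An auxiliary map \<open>y\<close> completes it to a transversal pair: the projective
point \<open>1 : n \<bullet> w\<close>, where \<open>n\<close> is orthogonal to the direction \<open>a\<close> in which the trace moves, stands still
exactly in the directions of multiples of \<open>a\<close>.\<close>

lemma smooth_line_meets_plane_curve:
  fixes \<gamma> :: "('a::plane_algebra^3) set" and c :: 'a
  assumes c: "one_dim_ideal c" and sl: "smooth_line \<gamma>" and X: "X \<in> \<gamma>"
  shows "\<exists>\<gamma>\<^sub>0. open_part \<gamma> \<gamma>\<^sub>0 \<and> X \<in> \<gamma>\<^sub>0 \<and>
    (\<exists>I k. plane_curve (ideal_plane c) I k \<and> generator ` \<gamma>\<^sub>0 \<subseteq> lines_meeting I k)"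
proof -
  obtain W \<phi> where lp: "local_param \<gamma> W \<phi>" and XW: "X \<in> saturation (\<phi> ` W)"
    using sl X unfolding smooth_line_def smooth_surface_def by blast
  obtain u w0 where u: "regular u" "w0 \<in> W" "X = u *s \<phi> w0" using XW by (auto simp: saturation_def)
  note w0 = u(2)
  have W: "open W" using lp by (simp add: local_param_def)
  let ?D = "\<lambda>w. frechet_derivative \<phi> (at w)"
  obtain a where a: "real_coords (c *s ?D w0 a) \<notin> span {plane_trace c \<phi> w0}"
    using plane_trace_moving_direction[OF c sl lp w0] by blast
  have lin: "linear (\<lambda>v. real_coords (c *s ?D w0 v))"
    using has_derivative_plane_trace[OF lp w0] by (rule has_derivative_linear)
  have a0: "a \<noteq> 0" using a by (auto simp: linear_0[OF lin] span_zero)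
  define n :: "real^2" where "n = vector [- (a $ 2), a $ 1]"
  define y :: "real^2 \<Rightarrow> real^2" where "y = (\<lambda>w. axis 1 1 + (n \<bullet> w) *\<^sub>R axis 2 1)"
  define y' :: "real^2 \<Rightarrow> real^2 \<Rightarrow> real^2" where "y' = (\<lambda>w v. (n \<bullet> v) *\<^sub>R axis 2 1)"
  have n0: "n \<bullet> n \<noteq> 0" using a0 by (auto simp: n_def vec_eq_iff forall_2)
  have y'_iff: "y' w v \<in> span {y w} \<longleftrightarrow> n \<bullet> v = 0" for w v
  proof
    assume "y' w v \<in> span {y w}"
    then obtain k where k: "y' w v = k *\<^sub>R y w" by (auto simp: span_singleton)
    then have "y' w v $ 1 = (k *\<^sub>R y w) $ 1" by simp
    then have "k = 0" by (simp add: y_def y'_def axis_def)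
    then have "y' w v $ 2 = 0" using k by simp
    then show "n \<bullet> v = 0" by (simp add: y'_def axis_def)
  qed (simp add: y'_def span_zero)
  have y: "(y has_derivative y' w) (at w)" "continuous_on W (\<lambda>w. y' w v)"
    "dim (insert (y w) (range (y' w))) \<le> 2" "y w \<noteq> 0" for w v
  proof -
    show "(y has_derivative y' w) (at w)"
      unfolding y_def y'_def by (auto intro!: derivative_eq_intros)
    show "dim (insert (y w) (range (y' w))) \<le> 2"
      using dim_subset_UNIV[of "insert (y w) (range (y' w))"] by simp
    have "y w $ 1 = 1" by (simp add: y_def axis_def)
    then show "y w \<noteq> 0" by auto
  qed (simp add: y'_def)
  have transversal: "v = 0" if v: "real_coords (c *s ?D w0 v) \<in> span {plane_trace c \<phi> w0}" "y' w0 v \<in> span {y w0}" for v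
  proof -
    have "n \<bullet> v = 0" using v(2) y'_iff by blast
    then have orth: "a $ 1 * v $ 2 = a $ 2 * v $ 1" by (simp add: n_def inner_vec_def sum_2)
    have a1: "(a $ 1)\<^sup>2 + (a $ 2)\<^sup>2 \<noteq> 0" using a0 by (auto simp: vec_eq_iff forall_2 sum_power2_eq_zero_iff)
    define r where "r = (a $ 1 * v $ 1 + a $ 2 * v $ 2) / ((a $ 1)\<^sup>2 + (a $ 2)\<^sup>2)"
    have "v $ 1 * ((a $ 1)\<^sup>2 + (a $ 2)\<^sup>2) = (a $ 1 * v $ 1 + a $ 2 * v $ 2) * a $ 1"
      "v $ 2 * ((a $ 1)\<^sup>2 + (a $ 2)\<^sup>2) = (a $ 1 * v $ 1 + a $ 2 * v $ 2) * a $ 2"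
      using orth by algebra+
    then have v_eq: "v = r *\<^sub>R a" using a1 by (simp add: vec_eq_iff forall_2 r_def eq_divide_eq)
    have "r = 0"
    proof (rule ccontr)
      assume r: "r \<noteq> 0"
      have "r *\<^sub>R real_coords (c *s ?D w0 a) \<in> span {plane_trace c \<phi> w0}"
        using v(1) by (simp add: v_eq linear_cmul[OF lin])
      from span_scale[OF this, of "1 / r"] show False using a r by simp
    qed
    then show ?thesis by (simp add: v_eq)
  qed
  have n_moving: "y' w0 n \<notin> span {y w0}" using y'_iff n0 by simp
  from transversal_rank_one_maps[OF W w0
      has_derivative_plane_trace[OF lp] continuous_on_plane_trace_derivative[OF lp] plane_trace_tangent_dim[OF c sl lp]
      y(1) y(2) y(3) plane_trace_nonzero[OF c lp w0] a y(4) n_moving transversal]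
  obtain N \<delta> where N: "open N" "w0 \<in> N" "N \<subseteq> W" and \<delta>: "\<delta> > 0"
    and curve: "\<And>\<sigma>. \<sigma> \<in> {-\<delta><..<\<delta>} \<Longrightarrow> w0 + \<sigma> *\<^sub>R a \<in> W \<and>
      real_coords (c *s ?D (w0 + \<sigma> *\<^sub>R a) a) \<notin> span {plane_trace c \<phi> (w0 + \<sigma> *\<^sub>R a)}"
    and "\<And>\<tau>. \<tau> \<in> {-\<delta><..<\<delta>} \<Longrightarrow> w0 + \<tau> *\<^sub>R n \<in> W \<and> y' (w0 + \<tau> *\<^sub>R n) n \<notin> span {y (w0 + \<tau> *\<^sub>R n)}"
    and to_curve: "\<And>w. w \<in> N \<Longrightarrow> \<exists>\<sigma>\<in>{-\<delta><..<\<delta>}. \<exists>\<tau>\<in>{-\<delta><..<\<delta>}.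
      span {plane_trace c \<phi> w} = span {plane_trace c \<phi> (w0 + \<sigma> *\<^sub>R a)} \<and> span {y w} = span {y (w0 + \<tau> *\<^sub>R n)}"
    and "\<And>\<sigma> \<tau>. \<sigma> \<in> {-\<delta><..<\<delta>} \<Longrightarrow> \<tau> \<in> {-\<delta><..<\<delta>} \<Longrightarrow> \<exists>w\<in>N.
      span {plane_trace c \<phi> w} = span {plane_trace c \<phi> (w0 + \<sigma> *\<^sub>R a)} \<and> span {y w} = span {y (w0 + \<tau> *\<^sub>R n)}"
    by blast
  let ?I = "{-\<delta><..<\<delta>}"
  let ?k = "\<lambda>\<sigma>. plane_trace c \<phi> (w0 + \<sigma> *\<^sub>R a)"
  have "plane_curve (ideal_plane c) ?I ?k"
    by (rule plane_curve_plane_trace[OF c lp]) (use curve \<delta> in auto)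
  moreover have "generator ` saturation (\<phi> ` N) \<subseteq> lines_meeting ?I ?k"
    unfolding generator_image_saturation
  proof safe
    fix w assume w: "w \<in> N"
    have "coord_vector (\<phi> w)" using local_param_coord_vector[OF lp] w N(3) by blast
    then have dim: "dim (generator (\<phi> w)) = 2"
      by (simp add: generator_def coord_vector_def dim_eq_card_independent)
    obtain \<sigma> where \<sigma>: "\<sigma> \<in> ?I" "span {plane_trace c \<phi> w} = span {?k \<sigma>}" using to_curve[OF w] by blast
    have "plane_trace c \<phi> w \<in> generator (\<phi> w)" by (auto simp: plane_trace_def generator_eq)
    then have "span {plane_trace c \<phi> w} \<subseteq> generator (\<phi> w)" by (intro span_minimal) (simp_all add: generator_def)
    then have "span {?k \<sigma>} \<subseteq> generator (\<phi> w)" using \<sigma>(2) by simp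
    moreover have "?k \<sigma> \<in> span {?k \<sigma>}" by (simp add: span_base)
    ultimately have "?k \<sigma> \<in> generator (\<phi> w)" by blast
    then show "generator (\<phi> w) \<in> lines_meeting ?I ?k"
      using \<sigma>(1) dim by (simp add: lines_meeting_def) (auto simp: generator_def)
  qed
  moreover have "open_part \<gamma> (saturation (\<phi> ` N))" by (rule local_param_open_part[OF lp N(1,3)])
  moreover have "X \<in> saturation (\<phi> ` N)" using u N(2) by (auto simp: saturation_def)
  ultimately show ?thesis by blast
qed

text \<open>The element \<open>c\<close> is idempotent and kills every \<open>d Y\<close>, so a common point \<open>c X = d Y\<close> is
\<open>c (c X) = c (d Y) = 0\<close>.\<close>

lemma ideal_plane_disjoint:
  fixes c d :: "'a::plane_algebra"
  assumes cd: "c + d = 1" "c * d = 0"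
  shows "ideal_plane c \<inter> ideal_plane d = {0}"
proof
  have cc: "c * c = c" using cd by (metis add.right_neutral distrib_left mult.right_neutral)
  show "ideal_plane c \<inter> ideal_plane d \<subseteq> {0}"
  proof
    fix x assume "x \<in> ideal_plane c \<inter> ideal_plane d"
    then obtain X Y where XY: "x = real_coords (c *s X)" "x = real_coords (d *s Y)"
      unfolding ideal_plane_def by blast
    then have eq: "c *s X = d *s Y" using real_coords_eq_iff by metis
    have "c *s X = c *s (c *s X)" by (simp add: vec_eq_iff cc flip: mult.assoc)
    also have "\<dots> = 0" unfolding eq by (simp add: vec_eq_iff cd flip: mult.assoc)
    finally show "x \<in> {0}" using XY(1) by (simp add: linear_0[OF linear_real_coords])
  qed
  have "0 \<in> ideal_plane e" for e :: 'a
    unfolding ideal_plane_def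
    by (rule range_eqI[of _ _ 0]) (simp add: linear_0[OF linear_real_coords])
  then show "{0} \<subseteq> ideal_plane c \<inter> ideal_plane d" by simp
qed

lemma one_dim_ideal_double:
  "one_dim_ideal (Double (1/2) (1/2))" "one_dim_ideal (Double (1/2) (-1/2))"
proof -
  have "Double (1/2) (1/2) * a = (d_fst a + d_snd a) *\<^sub>R Double (1/2) (1/2)"
    "Double (1/2) (-1/2) * a = (d_fst a - d_snd a) *\<^sub>R Double (1/2) (-1/2)" for a
    by (simp_all add: double_num_ring_defs field_simps)
  then show "one_dim_ideal (Double (1/2) (1/2))" "one_dim_ideal (Double (1/2) (-1/2))"
    unfolding one_dim_ideal_def by (auto simp: zero_double_num_def)
qed

lemma one_dim_ideal_dual: "one_dim_ideal (Dual 0 1)"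
proof -
  have "Dual 0 1 * a = e_fst a *\<^sub>R Dual 0 1" for a by (simp add: dual_num_ring_defs)
  then show ?thesis unfolding one_dim_ideal_def by (auto simp: zero_dual_num_def)
qed

section \<open>Systems with structure equation d\<theta> = \<omega> \<and> \<pi>\<close>

text \<open>The pointwise data of a system \<open>\<theta> = 0\<close> of two real equations, with independence condition \<open>\<omega>\<close>, for which
\<open>d\<theta> = \<omega> \<and> \<pi>\<close> modulo \<open>\<theta>\<close> and the three \<open>A\<close>-valued forms are independent. Involutivity and the Cartan
characters depend on nothing else.\<close>

locale product_symbol =
  fixes \<theta> :: "'v::euclidean_space \<Rightarrow> 'v \<Rightarrow> 'a::plane_algebra"
    and \<omega> :: "'v \<Rightarrow> 'v \<Rightarrow> 'a" and \<pi> :: "'v \<Rightarrow> 'a" and g :: 'v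
  assumes linear_theta: "linear (\<theta> g)" and linear_omega: "linear (\<omega> g)" and linear_pi: "linear \<pi>"
    and surj_forms: "surj (\<lambda>h. (\<theta> g h, \<omega> g h, \<pi> h))"
    and structure_eq: "\<And>h k. \<theta> g h = 0 \<Longrightarrow> \<theta> g k = 0 \<Longrightarrow>
      ext_d \<theta> g h k = \<omega> g h * \<pi> k - \<pi> h * \<omega> g k"
begin

lemmas form_simps =
  linear_add[OF linear_theta] linear_add[OF linear_omega] linear_add[OF linear_pi]
  linear_diff[OF linear_theta] linear_diff[OF linear_omega] linear_diff[OF linear_pi]
  linear_cmul[OF linear_theta] linear_cmul[OF linear_omega] linear_cmul[OF linear_pi]
  linear_0[OF linear_theta] linear_0[OF linear_omega] linear_0[OF linear_pi]

lemma linear_forms: "linear (\<lambda>h. (\<theta> g h, \<omega> g h, \<pi> h))"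
  by (intro linearI) (simp_all add: form_simps)

lemma exists_vector: "\<exists>h. \<theta> g h = t \<and> \<omega> g h = x \<and> \<pi> h = y"
proof -
  obtain h where "(t, x, y) = (\<theta> g h, \<omega> g h, \<pi> h)" using surjD[OF surj_forms] by blast
  then show ?thesis by blast
qed

text \<open>Testing \<open>d\<theta>\<close> against vectors on which \<open>(\<omega>, \<pi>)\<close> takes the values \<open>(0, 1)\<close> and \<open>(1, 0)\<close> separates the
two components of a Cauchy characteristic vector.\<close>

lemma cauchy_space_eq: "cauchy_space \<theta> g = {h. \<theta> g h = 0 \<and> \<omega> g h = 0 \<and> \<pi> h = 0}"
proof safe
  fix h assume h: "h \<in> cauchy_space \<theta> g"
  then show t: "\<theta> g h = 0" by (simp add: cauchy_space_def)
  have ext: "\<omega> g h * \<pi> k - \<pi> h * \<omega> g k = 0" if "\<theta> g k = 0" for k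
    using h that structure_eq[of h k] by (simp add: cauchy_space_def)
  obtain k where "\<theta> g k = 0" "\<omega> g k = 0" "\<pi> k = 1" using exists_vector by blast
  then show "\<omega> g h = 0" using ext[of k] by simp
  obtain k where "\<theta> g k = 0" "\<omega> g k = 1" "\<pi> k = 0" using exists_vector by blast
  then show "\<pi> h = 0" using ext[of k] by simp
qed (auto simp: cauchy_space_def structure_eq)

lemma subspace_cauchy_space: "subspace (cauchy_space \<theta> g)"
  unfolding cauchy_space_eq by (auto simp: subspace_def form_simps)

lemma dim_cauchy_space: "dim (cauchy_space \<theta> g) + 6 = DIM('v)"
  using dim_kernel_surjective[OF linear_forms surj_forms]
  by (simp add: cauchy_space_eq zero_prod_def DIM_algebra)

text \<open>On an integral element \<open>\<pi>\<close> is a function of \<open>\<omega>\<close>, and \<open>\<omega> \<and> \<pi> = 0\<close> evaluated on the values \<open>1\<close> and \<open>x\<close>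
of \<open>\<omega>\<close> shows that this function is multiplication by its value at \<open>1\<close>.\<close>

lemma integral_elements_iff:
  "L \<in> integral_elements \<theta> \<omega> g \<longleftrightarrow>
    (\<forall>x. \<omega> g (blinfun_apply L x) = x \<and> \<theta> g (blinfun_apply L x) = 0 \<and>
      \<pi> (blinfun_apply L x) = \<pi> (blinfun_apply L 1) * x)"
    (is "?l \<longleftrightarrow> ?r")
proof
  assume L: ?l
  have ext: "x * \<pi> (blinfun_apply L y) - \<pi> (blinfun_apply L x) * y = 0" for x y
    using L structure_eq[of "blinfun_apply L x" "blinfun_apply L y"] by (simp add: integral_elements_def)
  have "\<pi> (blinfun_apply L x) = \<pi> (blinfun_apply L 1) * x" for x using ext[of 1 x] by simp
  then show ?r using L unfolding integral_elements_def by blast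
next
  assume R: ?r
  have "x * \<pi> (blinfun_apply L y) - \<pi> (blinfun_apply L x) * y = 0" for x y
  proof -
    have "\<pi> (blinfun_apply L x) = \<pi> (blinfun_apply L 1) * x" "\<pi> (blinfun_apply L y) = \<pi> (blinfun_apply L 1) * y"
      using R by blast+
    then show ?thesis by (simp add: algebra_simps)
  qed
  moreover have "\<omega> g (blinfun_apply L x) = x" "\<theta> g (blinfun_apply L x) = 0" for x using R by blast+
  ultimately show ?l by (simp add: integral_elements_def structure_eq)
qed

lemma polar_codim_0: "polar_codim \<theta> g (range (blinfun_apply (L :: 'a \<Rightarrow>\<^sub>L 'v))) 0 = 2"
proof -
  have "polar_space \<theta> g {0} = {k. \<theta> g k = 0}"
    by (auto simp: polar_space_def structure_eq form_simps)
  moreover have "surj (\<theta> g)" using exists_vector unfolding surj_def by metis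
  ultimately have "dim (polar_space \<theta> g {0}) + 2 = DIM('v)"
    using dim_kernel_surjective[OF linear_theta] by (simp add: DIM_algebra)
  then have codim: "int DIM('v) - int (dim (polar_space \<theta> g {0})) = 2" by linarith
  have "{int DIM('v) - int (dim (polar_space \<theta> g F)) | F. subspace F \<and> F \<subseteq> range (blinfun_apply L) \<and> dim F = 0} = {2}"
  proof safe
    fix F :: "'v set" assume F: "subspace F" "dim F = 0"
    then have "F = {0}" by (auto simp: subspace_0 dim_eq_0)
    then show "int DIM('v) - int (dim (polar_space \<theta> g F)) = 2" by (simp add: codim)
  next
    have "{0} \<subseteq> range (blinfun_apply L)" by (metis blinfun.zero_right insert_subset rangeI empty_subsetI)
    then show "\<exists>F. 2 = int DIM('v) - int (dim (polar_space \<theta> g F)) \<and> subspace F \<and> F \<subseteq> range (blinfun_apply L) \<and> dim F = 0"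
      using codim by (intro exI[of _ "{0}"]) (auto simp: subspace_def)
  qed
  then show ?thesis by (simp add: polar_codim_def)
qed

text \<open>The polar equations of the line over \<open>x\<close> are \<open>\<theta> = 0\<close> and \<open>x (\<pi> - \<beta> \<omega>) = 0\<close>; the latter has as many
independent real components as the ideal generated by \<open>x\<close> has dimensions.\<close>

lemma polar_codim_line:
  assumes L: "L \<in> integral_elements \<theta> \<omega> g"
  shows "int DIM('v) - int (dim (polar_space \<theta> g (span {blinfun_apply L x}))) = 2 + int (dim (range (\<lambda>y. x * y)))"
proof -
  define \<beta> where "\<beta> = \<pi> (blinfun_apply L 1)"
  define f where "f = (\<lambda>k. (\<theta> g k, x * (\<pi> k - \<beta> * \<omega> g k)))"
  have f: "linear f"
    unfolding f_def by (intro linearI) (simp_all add: form_simps algebra_simps)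
  have Lx: "\<theta> g (blinfun_apply L x) = 0" "\<omega> g (blinfun_apply L x) = x" "\<pi> (blinfun_apply L x) = \<beta> * x"
    using L unfolding integral_elements_iff \<beta>_def by blast+
  have ext: "ext_d \<theta> g (r *\<^sub>R blinfun_apply L x) k = r *\<^sub>R (x * (\<pi> k - \<beta> * \<omega> g k))" if "\<theta> g k = 0" for k r
    using structure_eq[of "r *\<^sub>R blinfun_apply L x" k] that Lx by (simp add: form_simps algebra_simps)
  have "polar_space \<theta> g (span {blinfun_apply L x}) = {k. f k = 0}"
  proof (intro set_eqI iffI)
    fix k assume "k \<in> polar_space \<theta> g (span {blinfun_apply L x})"
    then have k: "\<theta> g k = 0" "ext_d \<theta> g (1 *\<^sub>R blinfun_apply L x) k = 0"
      by (auto simp: polar_space_def intro: span_base)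
    then show "k \<in> {k. f k = 0}" using ext[of k 1] by (simp add: f_def zero_prod_def)
  next
    fix k assume "k \<in> {k. f k = 0}"
    then show "k \<in> polar_space \<theta> g (span {blinfun_apply L x})"
      by (auto simp: polar_space_def f_def zero_prod_def span_singleton ext)
  qed
  moreover have "range f = UNIV \<times> range (\<lambda>y. x * y)"
  proof safe
    fix t y
    obtain k where k: "\<theta> g k = t" "\<omega> g k = 0" "\<pi> k = y" using exists_vector by blast
    then have "f k = (t, x * y)" by (simp add: f_def)
    then show "(t, x * y) \<in> range f" by (metis rangeI)
  qed (auto simp: f_def)
  then have "dim (range f) = 2 + dim (range (\<lambda>y. x * y))"
    by (simp add: dim_Times linear_subspace_image[OF linear_mult subspace_UNIV] DIM_algebra)
  ultimately show ?thesis using rank_nullity[OF f subspace_UNIV] by simp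
qed

text \<open>The maximal codimension is attained by the line over the unit \<open>1\<close>.\<close>

lemma polar_codim_1:
  assumes L: "L \<in> integral_elements \<theta> \<omega> g"
  shows "polar_codim \<theta> g (range (blinfun_apply L)) 1 = 4"
proof -
  let ?c = "\<lambda>F. int DIM('v) - int (dim (polar_space \<theta> g F))"
  let ?S = "{?c F | F. subspace F \<and> F \<subseteq> range (blinfun_apply L) \<and> dim F = 1}"
  have S: "?S \<subseteq> {2..4}"
  proof safe
    fix F assume F: "subspace F" "F \<subseteq> range (blinfun_apply L)" "dim F = 1"
    obtain B where B: "B \<subseteq> F" "independent B" "F \<subseteq> span B" "card B = 1"
      using basis_exists[of F] F(3) by metis
    then obtain v where v: "B = {v}" by (auto simp: card_1_singleton_iff)
    then have "F = span {v}" using B F(1) span_minimal[of "{v}" F] by auto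
    moreover obtain x where "v = blinfun_apply L x" using B(1) v F(2) by blast
    ultimately have c: "?c F = 2 + int (dim (range (\<lambda>y. x * y)))"
      using polar_codim_line[OF L] by simp
    have "dim (range (\<lambda>y. x * y)) \<le> DIM('a)" by (rule dim_subset_UNIV)
    then show "?c F \<in> {2..4}" unfolding c by (simp add: DIM_algebra)
  qed
  have "4 \<in> ?S"
  proof -
    have "blinfun_apply L 1 \<noteq> 0"
      using L form_simps unfolding integral_elements_iff by (metis zero_neq_one)
    then have "dim (span {blinfun_apply L 1}) = 1" by (simp add: dim_insert)
    moreover have "span {blinfun_apply L 1} \<subseteq> range (blinfun_apply L)"
      by (rule span_minimal)
        (auto intro: linear_subspace_image bounded_linear.linear[OF blinfun.bounded_linear_right])
    moreover have "?c (span {blinfun_apply L 1}) = 4"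
      unfolding polar_codim_line[OF L] by (simp add: DIM_algebra)
    ultimately show ?thesis by (metis (mono_tags, lifting) mem_Collect_eq subspace_span)
  qed
  then have "Max ?S = 4"
    using S finite_subset[OF S] by (intro Max_eqI) auto
  then show ?thesis by (simp add: polar_codim_def)
qed

lemma cartan_character_1: "L \<in> integral_elements \<theta> \<omega> g \<Longrightarrow> cartan_character \<theta> g L 1 = 2"
  by (simp add: cartan_character_def Let_def polar_codim_0 polar_codim_1[unfolded One_nat_def] DIM_algebra)

lemma cartan_character_2: "L \<in> integral_elements \<theta> \<omega> g \<Longrightarrow> cartan_character \<theta> g L 2 = 0"
  using dim_cauchy_space polar_codim_1[of L] by (simp add: cartan_character_def Let_def DIM_algebra)

lemma exists_section:
  obtains s where "linear s" "\<And>t x y. \<theta> g (s (t, x, y)) = t" "\<And>t x y. \<omega> g (s (t, x, y)) = x"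
    "\<And>t x y. \<pi> (s (t, x, y)) = y"
proof -
  obtain s where s: "linear s" "(\<lambda>h. (\<theta> g h, \<omega> g h, \<pi> h)) \<circ> s = id"
    using linear_surjective_right_inverse[OF linear_forms surj_forms] by blast
  have "(\<theta> g (s z), \<omega> g (s z), \<pi> (s z)) = z" for z
    using fun_cong[OF s(2), of z] by simp
  then show ?thesis using that[of s] s(1) by (metis prod.inject)
qed

lemma integral_elements_nonempty: "integral_elements \<theta> \<omega> g \<noteq> {}"
proof -
  obtain s where s: "linear s" "\<And>t x y. \<theta> g (s (t, x, y)) = t" "\<And>t x y. \<omega> g (s (t, x, y)) = x"
    "\<And>t x y. \<pi> (s (t, x, y)) = y" using exists_section by blast
  have "linear (\<lambda>x. s (0, x, 0))"
    using linear_add[OF s(1), of "(0, _, 0)" "(0, _, 0)"] linear_cmul[OF s(1), of _ "(0, _, 0)"]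
    by (intro linearI) simp_all
  then have "blinfun_apply (Blinfun (\<lambda>x. s (0, x, 0))) = (\<lambda>x. s (0, x, 0))"
    by (simp add: bounded_linear_Blinfun_apply linear_conv_bounded_linear)
  then have "Blinfun (\<lambda>x. s (0, x, 0)) \<in> integral_elements \<theta> \<omega> g"
    by (simp add: integral_elements_iff s)
  then show ?thesis by blast
qed

lemma affine_integral_elements: "affine (integral_elements \<theta> \<omega> g)"
  unfolding affine_def
proof (intro ballI allI impI)
  fix L M and u v :: real
  assume L: "L \<in> integral_elements \<theta> \<omega> g" and M: "M \<in> integral_elements \<theta> \<omega> g" and uv: "u + v = 1"
  have eq: "\<theta> g (blinfun_apply L x) = 0" "\<omega> g (blinfun_apply L x) = x"
    "\<theta> g (blinfun_apply M x) = 0" "\<omega> g (blinfun_apply M x) = x" for x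
    using L M unfolding integral_elements_iff by blast+
  have pi: "\<pi> (blinfun_apply L x) = \<pi> (blinfun_apply L 1) * x" "\<pi> (blinfun_apply M x) = \<pi> (blinfun_apply M 1) * x" for x
    using L M unfolding integral_elements_iff by blast+
  show "u *\<^sub>R L + v *\<^sub>R M \<in> integral_elements \<theta> \<omega> g"
    unfolding integral_elements_iff
  proof (intro allI conjI)
    fix x
    show "\<omega> g (blinfun_apply (u *\<^sub>R L + v *\<^sub>R M) x) = x" "\<theta> g (blinfun_apply (u *\<^sub>R L + v *\<^sub>R M) x) = 0"
      using uv by (simp_all add: blinfun.add_left blinfun.scaleR_left form_simps eq flip: scaleR_left_distrib)
    show "\<pi> (blinfun_apply (u *\<^sub>R L + v *\<^sub>R M) x) = \<pi> (blinfun_apply (u *\<^sub>R L + v *\<^sub>R M) 1) * x"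
      unfolding blinfun.add_left blinfun.scaleR_left form_simps pi[of x] by (simp add: algebra_simps)
  qed
qed

text \<open>Differences of integral elements send \<open>x\<close> to a vector on which \<open>\<pi>\<close> has the value \<open>\<beta> x\<close> and \<open>\<theta>\<close>, \<open>\<omega>\<close>
vanish. After subtracting a fixed lift of \<open>\<beta> x\<close> an arbitrary linear map to the Cauchy characteristics
remains, which is given by its values on the two basis elements of \<open>A\<close>.\<close>

lemma dim_integral_elements:
  "dim {M - N | M N. M \<in> integral_elements \<theta> \<omega> g \<and> N \<in> integral_elements \<theta> \<omega> g} =
    2 + 2 * dim (cauchy_space \<theta> g)"
proof -
  let ?V = "integral_elements \<theta> \<omega> g" and ?C = "cauchy_space \<theta> g"
  obtain s where s: "linear s" "\<And>t x y. \<theta> g (s (t, x, y)) = t" "\<And>t x y. \<omega> g (s (t, x, y)) = x"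
    "\<And>t x y. \<pi> (s (t, x, y)) = y" using exists_section by blast
  define \<sigma> where "\<sigma> = (\<lambda>y. s (0, 0, y))"
  have \<sigma>: "linear \<sigma>" "\<And>y. \<theta> g (\<sigma> y) = 0" "\<And>y. \<omega> g (\<sigma> y) = 0" "\<And>y. \<pi> (\<sigma> y) = y"
    using linear_add[OF s(1), of "(0, 0, _)" "(0, 0, _)"] linear_cmul[OF s(1), of _ "(0, 0, _)"]
    by (auto intro!: linearI simp: \<sigma>_def s)
  obtain u1 u2 :: 'a where u: "Basis = {u1, u2}" "u1 \<noteq> u2"
    using DIM_algebra[where 'a='a] by (metis card_2_iff)
  have inner_u: "u1 \<bullet> u1 = 1" "u2 \<bullet> u2 = 1" "u1 \<bullet> u2 = 0" "u2 \<bullet> u1 = 0"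
  proof -
    have B: "u1 \<in> Basis" "u2 \<in> Basis" unfolding u(1) by simp_all
    show "u1 \<bullet> u1 = 1" "u2 \<bullet> u2 = 1" using B by (simp_all add: inner_same_Basis)
    show "u1 \<bullet> u2 = 0" "u2 \<bullet> u1 = 0" using inner_not_same_Basis[OF B u(2)] by (simp_all add: inner_commute)
  qed
  have rep: "x = (x \<bullet> u1) *\<^sub>R u1 + (x \<bullet> u2) *\<^sub>R u2" for x :: 'a
    using euclidean_representation[of x] u(2) unfolding u(1) by simp
  define D where "D = {R :: 'a \<Rightarrow>\<^sub>L 'v. \<forall>x. \<omega> g (blinfun_apply R x) = 0 \<and> \<theta> g (blinfun_apply R x) = 0 \<and>
      \<pi> (blinfun_apply R x) = \<pi> (blinfun_apply R 1) * x}"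
  have "{M - N | M N. M \<in> ?V \<and> N \<in> ?V} = D"
  proof safe
    fix M N assume M: "M \<in> ?V" and N: "N \<in> ?V"
    have pi: "\<pi> (blinfun_apply M x) = \<pi> (blinfun_apply M 1) * x" "\<pi> (blinfun_apply N x) = \<pi> (blinfun_apply N 1) * x" for x
      using M N unfolding integral_elements_iff by blast+
    have "\<pi> (blinfun_apply (M - N) x) = \<pi> (blinfun_apply (M - N) 1) * x" for x
      unfolding blinfun.diff_left form_simps pi[of x] by (simp add: algebra_simps)
    moreover have "\<omega> g (blinfun_apply (M - N) x) = 0" "\<theta> g (blinfun_apply (M - N) x) = 0" for x
      using M N unfolding integral_elements_iff by (simp_all only: blinfun.diff_left form_simps diff_self)
    ultimately show "M - N \<in> D" unfolding D_def by blast
  next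
    fix R assume R: "R \<in> D"
    obtain N where N: "N \<in> ?V" using integral_elements_nonempty by blast
    have pi: "\<pi> (blinfun_apply R x) = \<pi> (blinfun_apply R 1) * x" "\<pi> (blinfun_apply N x) = \<pi> (blinfun_apply N 1) * x" for x
      using R N unfolding integral_elements_iff D_def by blast+
    have "\<pi> (blinfun_apply (N + R) x) = \<pi> (blinfun_apply (N + R) 1) * x" for x
      unfolding blinfun.add_left form_simps pi[of x] by (simp add: algebra_simps)
    moreover have "\<omega> g (blinfun_apply (N + R) x) = x" "\<theta> g (blinfun_apply (N + R) x) = 0" for x
      using N R unfolding integral_elements_iff D_def mem_Collect_eq
      by (simp_all only: blinfun.add_left form_simps add_0_right)
    ultimately have "N + R \<in> ?V" unfolding integral_elements_iff by blast
    then show "\<exists>M N. R = M - N \<and> M \<in> ?V \<and> N \<in> ?V"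
      using N by (intro exI[of _ "N + R"] exI[of _ N]) simp
  qed
  define G where "G = (\<lambda>(\<beta>, h1, h2). Blinfun (\<lambda>x. (x \<bullet> u1) *\<^sub>R h1 + (x \<bullet> u2) *\<^sub>R h2 + \<sigma> (\<beta> * x)))"
  have G: "blinfun_apply (G (\<beta>, h1, h2)) x = (x \<bullet> u1) *\<^sub>R h1 + (x \<bullet> u2) *\<^sub>R h2 + \<sigma> (\<beta> * x)" for \<beta> h1 h2 x
  proof -
    have "linear (\<lambda>x. (x \<bullet> u1) *\<^sub>R h1 + (x \<bullet> u2) *\<^sub>R h2 + \<sigma> (\<beta> * x))"
      by (intro linearI) (simp_all add: inner_add_left linear_add[OF \<sigma>(1)] linear_cmul[OF \<sigma>(1)] algebra_simps)
    then show ?thesis by (simp add: G_def bounded_linear_Blinfun_apply linear_conv_bounded_linear)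
  qed
  have linG: "linear G"
    by (intro linearI blinfun_eqI)
      (auto simp: G blinfun.add_left blinfun.scaleR_left linear_add[OF \<sigma>(1)] linear_cmul[OF \<sigma>(1)] algebra_simps)
  let ?S = "(UNIV :: 'a set) \<times> (?C \<times> ?C)"
  have subS: "subspace ?S" by (intro subspace_Times subspace_UNIV subspace_cauchy_space)
  have "z = 0" if "z \<in> ?S" "G z = 0" for z
  proof -
    obtain \<beta> h1 h2 where z: "z = (\<beta>, h1, h2)" by (cases z) auto
    have C: "\<pi> h1 = 0" "\<pi> h2 = 0" using that z by (auto simp: cauchy_space_eq)
    have zero: "(x \<bullet> u1) *\<^sub>R h1 + (x \<bullet> u2) *\<^sub>R h2 + \<sigma> (\<beta> * x) = 0" for x
      using that(2) G[of \<beta> h1 h2 x] z by simp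
    have "\<pi> ((1 \<bullet> u1) *\<^sub>R h1 + (1 \<bullet> u2) *\<^sub>R h2 + \<sigma> (\<beta> * 1)) = 0" unfolding zero by (simp add: form_simps)
    then have "\<beta> = 0" using C \<sigma> by (simp add: form_simps)
    then show ?thesis
      using zero[of u1] zero[of u2] z by (simp add: inner_u linear_0[OF \<sigma>(1)] zero_prod_def)
  qed
  then have "{z \<in> ?S. G z = 0} \<subseteq> {0}" by blast
  then have "dim {z \<in> ?S. G z = 0} = 0" by (simp only: dim_eq_0)
  then have "dim (G ` ?S) = dim ?S" using rank_nullity[OF linG subS] by linarith
  also have "dim ?S = 2 + 2 * dim ?C"
    by (simp add: dim_Times subspace_Times subspace_cauchy_space DIM_algebra)
  finally have "dim (G ` ?S) = 2 + 2 * dim ?C" .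
  moreover have "G ` ?S = D"
  proof safe
    fix \<beta> h1 h2 assume "h1 \<in> ?C" "h2 \<in> ?C"
    then show "G (\<beta>, h1, h2) \<in> D"
      by (auto simp: D_def G cauchy_space_eq form_simps \<sigma>)
  next
    fix R assume R: "R \<in> D"
    define \<beta> where "\<beta> = \<pi> (blinfun_apply R 1)"
    have R: "\<omega> g (blinfun_apply R x) = 0" "\<theta> g (blinfun_apply R x) = 0" "\<pi> (blinfun_apply R x) = \<beta> * x" for x
      using R unfolding D_def \<beta>_def by blast+
    let ?h = "\<lambda>u. blinfun_apply R u - \<sigma> (\<beta> * u)"
    have "?h u \<in> ?C" for u by (simp add: cauchy_space_eq form_simps R \<sigma>)
    moreover have "R = G (\<beta>, ?h u1, ?h u2)"
    proof (rule blinfun_eqI)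
      fix x
      have "blinfun_apply R x = (x \<bullet> u1) *\<^sub>R blinfun_apply R u1 + (x \<bullet> u2) *\<^sub>R blinfun_apply R u2"
        by (subst rep[of x]) (simp only: blinfun.add_right blinfun.scaleR_right)
      moreover have "\<sigma> (\<beta> * x) = (x \<bullet> u1) *\<^sub>R \<sigma> (\<beta> * u1) + (x \<bullet> u2) *\<^sub>R \<sigma> (\<beta> * u2)"
        by (subst rep[of x]) (simp only: distrib_left mult_scaleR_right linear_add[OF \<sigma>(1)] linear_cmul[OF \<sigma>(1)])
      ultimately show "blinfun_apply R x = blinfun_apply (G (\<beta>, ?h u1, ?h u2)) x"
        by (simp add: G algebra_simps)
    qed
    ultimately show "R \<in> G ` ?S" by blast
  qed
  ultimately show ?thesis using \<open>{M - N | M N. M \<in> ?V \<and> N \<in> ?V} = D\<close> by simp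
qed

lemma in_involution_product_symbol: "in_involution \<theta> \<omega> g"
proof -
  have "(\<Sum>k = 1..DIM('a). int k * cartan_character \<theta> g L k) = 2" if "L \<in> integral_elements \<theta> \<omega> g" for L
  proof -
    have "{1..DIM('a)} = {1, 2}" by (auto simp: DIM_algebra)
    then show ?thesis
      using cartan_character_1[OF that] cartan_character_2[OF that] by simp
  qed
  then show ?thesis
    unfolding in_involution_def Let_def
    by (simp add: integral_elements_nonempty affine_integral_elements dim_integral_elements DIM_algebra)
qed

end

section \<open>The structure equations of moving frames\<close>

lemma bounded_bilinear_matrix_mult:
  "bounded_bilinear ((**) :: 'a::plane_algebra^'n^'n \<Rightarrow> 'a^'n^'n \<Rightarrow> 'a^'n^'n)"
proof -
  have "linear (\<lambda>B::'a^'n^'n. A ** B)" "linear (\<lambda>B::'a^'n^'n. B ** A)" for A :: "'a^'n^'n"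
    by (auto intro!: linearI simp: matrix_matrix_mult_def vec_eq_iff sum.distrib scaleR_sum_right algebra_simps)
  then have "bilinear ((**) :: 'a^'n^'n \<Rightarrow> 'a^'n^'n \<Rightarrow> 'a^'n^'n)"
    by (simp add: bilinear_def)
  then show ?thesis by (simp only: bilinear_conv_bounded_bilinear)
qed

lemma matrix_inv_both:
  fixes A :: "'a::comm_ring_1^'n^'n"
  assumes "invertible A"
  shows "A ** matrix_inv A = mat 1" "matrix_inv A ** A = mat 1"
  using someI_ex[OF assms[unfolded invertible_def]] unfolding matrix_inv_def by blast+

lemma linear_matrix_mult_left: "linear (\<lambda>B::'a^'n^'n. A ** B)" for A :: "'a::plane_algebra^'n^'n"
  by (rule bounded_linear.linear[OF bounded_bilinear.bounded_linear_right[OF bounded_bilinear_matrix_mult]])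

lemma linear_matrix_mult_right: "linear (\<lambda>B::'a^'n^'n. B ** A)" for A :: "'a::plane_algebra^'n^'n"
  by (rule bounded_linear.linear[OF bounded_bilinear.bounded_linear_left[OF bounded_bilinear_matrix_mult]])

text \<open>For \<open>y\<close> near \<open>g\<close>, multiplication by \<open>matrix_inv g ** (g - y)\<close> at least halves norms, and so does
multiplication by \<open>(g - y) ** matrix_inv g\<close> from the right. Hence multiplication by \<open>y\<close> from either side
is injective, so \<open>y\<close> is invertible with
\<open>norm (matrix_inv y) \<le> 2 * norm (matrix_inv g)\<close>. Iterating \<open>y\<^sup>-\<^sup>1 - g\<^sup>-\<^sup>1 = - g\<^sup>-\<^sup>1 (y - g) y\<^sup>-\<^sup>1\<close> once
bounds the remainder by a multiple of the square of \<open>norm (y - g)\<close>.\<close>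

lemma has_derivative_matrix_inv:
  fixes g :: "'a::plane_algebra^'n^'n"
  assumes inv: "invertible g"
  shows "(matrix_inv has_derivative (\<lambda>h. - (matrix_inv g ** h ** matrix_inv g))) (at g)"
proof -
  let ?i = "matrix_inv g"
  note gi = matrix_inv_both[OF inv]
  interpret mm: bounded_bilinear "(**) :: 'a^'n^'n \<Rightarrow> 'a^'n^'n \<Rightarrow> 'a^'n^'n"
    by (rule bounded_bilinear_matrix_mult)
  obtain K where K0: "K > 0" "\<forall>(A :: 'a^'n^'n) (B :: 'a^'n^'n). norm (A ** B) \<le> norm A * norm B * K"
    using mm.pos_bounded by (elim exE conjE) (rule that)
  note K = K0(1) K0(2)[rule_format]
  define N where "N = norm ?i + 1"
  \<comment> \<open>The radius for which \<open>K * K * norm (matrix_inv g) * norm (g - y) \<le> 1/2\<close>; the summand 1 in \<open>N\<close> keeps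
    the quotient meaningful when the norm is 0.\<close>
  define e where "e = 1 / (2 * K * K * N)"
  have pos: "N > 0" by (simp add: N_def add_nonneg_pos)
  have e: "e > 0" using K pos by (simp add: e_def)
  have small: "norm ?i * norm R * K * K \<le> 1/2" if "norm R \<le> e" for R :: "'a^'n^'n"
  proof -
    have "norm ?i * norm R * K * K \<le> N * e * K * K"
      using that K pos e by (intro mult_mono mult_nonneg_nonneg) (auto simp: N_def)
    also have "\<dots> = 1/2" using K pos by (simp add: e_def field_simps)
    finally show ?thesis .
  qed
  have bound3: "norm (A ** B ** C) \<le> norm A * norm B * norm C * K * K" for A B C :: "'a^'n^'n"
  proof -
    have "norm (A ** B ** C) \<le> norm (A ** B) * norm C * K" by (rule K(2))
    also have "\<dots> \<le> (norm A * norm B * K) * norm C * K"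
      using K by (intro mult_right_mono K(2)) auto
    finally show ?thesis by (simp add: mult_ac)
  qed
  have near: "invertible y" "norm (matrix_inv y) \<le> 2 * norm ?i" if y: "norm (y - g) \<le> e" for y
  proof -
    define R where "R = g - y"
    have R: "norm R \<le> e" using y by (simp add: R_def norm_minus_commute)
    have half: "norm (?i ** R ** x) \<le> norm x / 2" "norm (x ** R ** ?i) \<le> norm x / 2" for x :: "'a^'n^'n"
    proof -
      have "norm ?i * norm R * norm x * K * K \<le> norm x / 2"
        using mult_right_mono[OF small[OF R], of "norm x"] by (simp add: mult_ac)
      then show "norm (?i ** R ** x) \<le> norm x / 2" "norm (x ** R ** ?i) \<le> norm x / 2"
        using bound3[of ?i R x] bound3[of x R ?i] by (simp_all add: mult_ac)
    qed
    have R_left: "?i ** R ** x = x - ?i ** (y ** x)" and R_right: "x ** R ** ?i = x - x ** y ** ?i" for x :: "'a^'n^'n"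
      unfolding R_def by (simp_all add: mm.diff_left mm.diff_right gi matrix_mul_assoc)
        (simp flip: matrix_mul_assoc add: gi)
    have "inj (\<lambda>x::'a^'n^'n. y ** x)"
      unfolding linear_injective_0[OF linear_matrix_mult_left]
    proof (intro allI impI)
      fix x :: "'a^'n^'n" assume "y ** x = 0"
      then have "?i ** R ** x = x" using R_left[of x] by (simp add: mm.zero_right)
      then show "x = 0" using half(1)[of x] by simp
    qed
    then have "surj (\<lambda>x::'a^'n^'n. y ** x)"
      by (rule linear_injective_imp_surjective[OF linear_matrix_mult_left]) simp
    then obtain x :: "'a^'n^'n" where x: "y ** x = mat 1" by (metis surjD)
    have "inj (\<lambda>x::'a^'n^'n. x ** y)"
      unfolding linear_injective_0[OF linear_matrix_mult_right]
    proof (intro allI impI)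
      fix x :: "'a^'n^'n" assume "x ** y = 0"
      then have "x ** R ** ?i = x" using R_right[of x] by (simp add: mm.zero_left)
      then show "x = 0" using half(2)[of x] by simp
    qed
    then have "surj (\<lambda>x::'a^'n^'n. x ** y)"
      by (rule linear_injective_imp_surjective[OF linear_matrix_mult_right]) simp
    then obtain z :: "'a^'n^'n" where z: "z ** y = mat 1" by (metis surjD)
    have "z = x" using x z by (metis matrix_mul_assoc matrix_mul_lid matrix_mul_rid)
    then show iy: "invertible y" using x z unfolding invertible_def by blast
    have "matrix_inv y = ?i + ?i ** R ** matrix_inv y"
      using R_left[of "matrix_inv y"] by (simp add: matrix_inv_both[OF iy])
    then have "norm (matrix_inv y) \<le> norm ?i + norm (?i ** R ** matrix_inv y)"
      by (metis norm_triangle_ineq)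
    then show "norm (matrix_inv y) \<le> 2 * norm ?i" using half(1)[of "matrix_inv y"] by simp
  qed
  define C where "C = norm ?i * norm ?i * (2 * norm ?i) * K * K * K * K"
  have C: "norm (matrix_inv y - ?i - - (?i ** (y - g) ** ?i)) \<le> C * norm (y - g) * norm (y - g)"
    if y: "norm (y - g) \<le> e" for y
  proof -
    note iy = matrix_inv_both[OF near(1)[OF y]]
    let ?R = "y - g" and ?j = "matrix_inv y"
    have ji: "?j - ?i = - (?i ** ?R ** ?j)"
      by (simp add: mm.diff_left mm.diff_right gi iy flip: matrix_mul_assoc)
    have "?j - ?i - - (?i ** ?R ** ?i) = - (?i ** ?R ** ?j) + ?i ** ?R ** ?i" unfolding ji by simp
    also have "\<dots> = - (?i ** ?R ** (?j - ?i))" by (simp add: mm.diff_right)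
    also have "\<dots> = ?i ** ?R ** (?i ** ?R ** ?j)" unfolding ji by (simp add: mm.minus_right)
    finally have "norm (?j - ?i - - (?i ** ?R ** ?i)) \<le> norm ?i * norm ?R * norm (?i ** ?R ** ?j) * K * K"
      using bound3 by presburger
    also have "\<dots> \<le> norm ?i * norm ?R * (norm ?i * norm ?R * norm ?j * K * K) * K * K"
      using K by (intro mult_right_mono mult_left_mono bound3) auto
    also have "\<dots> \<le> norm ?i * norm ?R * (norm ?i * norm ?R * (2 * norm ?i) * K * K) * K * K"
      using K by (intro mult_right_mono mult_left_mono near(2)[OF y]) auto
    finally show ?thesis by (simp add: C_def mult_ac)
  qed
  show ?thesis
  proof (rule has_derivativeI_sandwich[OF e])
    show "bounded_linear (\<lambda>h. - (?i ** h ** ?i))"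
      using linear_compose[OF linear_matrix_mult_left linear_matrix_mult_right, of ?i ?i]
      by (simp add: o_def linear_conv_bounded_linear bounded_linear_minus)
    fix y assume "y \<noteq> g" "dist y g < e"
    then show "norm (matrix_inv y - ?i - - (?i ** (y - g) ** ?i)) / norm (y - g) \<le> C * norm (y - g)"
      using C[of y] by (simp add: dist_norm divide_le_eq)
  next
    have "((\<lambda>y. C * norm (y - g)) \<longlongrightarrow> C * norm (g - g)) (at g)" by (intro tendsto_intros)
    then show "((\<lambda>y. C * norm (y - g)) \<longlongrightarrow> 0) (at g)" by simp
  qed
qed

text \<open>The real columns of the points of a frame lie in the image of multiplication by the frame matrix, which
is therefore onto, and injective because the real dimension is finite. A right inverse \<open>h\<close> satisfies
\<open>g (h g) x = g x\<close>, so injectivity makes it a left inverse.\<close>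

lemma frame_invertible:
  fixes g :: "'a::plane_algebra^3^3"
  assumes "is_frame g"
  shows "invertible g"
proof -
  have lin: "linear (\<lambda>x. g *v x)"
    by (intro linearI) (simp_all add: matrix_vector_mult_def vec_eq_iff sum.distrib scaleR_sum_right algebra_simps)
  have col: "a *s column \<alpha> g = g *v axis \<alpha> a" for a \<alpha>
    by (simp add: vec_eq_iff matrix_vector_mult_def column_def axis_def if_distrib[where f = "\<lambda>x. _ * x"] mult.commute
        cong: if_cong)
  have "real_col (column \<alpha> g) j \<in> real_coords ` range (\<lambda>x. g *v x)" for \<alpha> j
    using exhaust_2[of j] by (auto simp: real_col_1 real_col_2 col)
  then have "{real_col (column \<alpha> g) j | \<alpha> j. True} \<subseteq> real_coords ` range (\<lambda>x. g *v x)" by blast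
  from dim_subset[OF this] have "6 \<le> dim (real_coords ` range (\<lambda>x. g *v x))"
    using assms by (simp add: is_frame_def)
  also have "\<dots> \<le> dim (range (\<lambda>x. g *v x))" by (rule dim_image_le[OF linear_real_coords])
  finally have "inj (\<lambda>x. g *v x)" by (intro full_rank_imp_inj[OF lin]) (simp add: DIM_algebra)
  then have surj: "surj (\<lambda>x. g *v x)"
    by (rule linear_injective_imp_surjective[OF lin]) simp
  define h where "h = (\<chi> i k. (SOME x. g *v x = axis k 1) $ i)"
  have h: "g *v column k h = axis k 1" for k
  proof -
    have "\<exists>x. g *v x = axis k 1" using surj by (metis surjD)
    then have "g *v (SOME x. g *v x = axis k 1) = axis k 1" by (rule someI_ex)
    moreover have "column k h = (SOME x. g *v x = axis k 1)" by (simp add: h_def column_def vec_eq_iff)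
    ultimately show ?thesis by simp
  qed
  have gh: "g ** h = mat 1"
  proof -
    have "(g ** h) $ i $ k = (g *v column k h) $ i" for i k
      by (simp add: matrix_matrix_mult_def matrix_vector_mult_def column_def)
    then show ?thesis by (simp add: h vec_eq_iff mat_def axis_def)
  qed
  have "h ** g = mat 1"
  proof -
    have "(h ** g) *v x = x" for x
    proof -
      have "g *v ((h ** g) *v x) = (g ** h) *v (g *v x)"
        by (simp add: matrix_vector_mul_assoc matrix_mul_assoc)
      also have "\<dots> = g *v x" by (simp add: gh)
      finally show ?thesis using \<open>inj (\<lambda>x. g *v x)\<close> by (auto dest: injD)
    qed
    then show ?thesis by (simp add: matrix_eq)
  qed
  with gh show ?thesis unfolding invertible_def by blast
qed

lemma frechet_derivative_Omega:
  fixes g :: "'a::plane_algebra^3^3"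
  assumes inv: "invertible g"
  shows "frechet_derivative (\<lambda>y. Omega \<alpha> \<beta> y k) (at g) h =
    - ((matrix_inv g ** h) ** (matrix_inv g ** k)) $ \<beta> $ \<alpha>"
proof -
  interpret mm: bounded_bilinear "(**) :: 'a^3^3 \<Rightarrow> 'a^3^3 \<Rightarrow> 'a^3^3"
    by (rule bounded_bilinear_matrix_mult)
  have "((\<lambda>y. Omega \<alpha> \<beta> y k) has_derivative
      (\<lambda>h. (- (matrix_inv g ** h ** matrix_inv g) ** k) $ \<beta> $ \<alpha>)) (at g)"
    unfolding Omega_def
    by (intro bounded_linear.has_derivative[OF bounded_linear_vec_nth]
        bounded_linear.has_derivative[OF mm.bounded_linear_left has_derivative_matrix_inv[OF inv]])
  from frechet_derivative_at[OF this, symmetric] show ?thesis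
    by (simp add: mm.minus_left matrix_mul_assoc)
qed

text \<open>From \<open>d(g\<^sup>-\<^sup>1) = - g\<^sup>-\<^sup>1 dg g\<^sup>-\<^sup>1\<close> one gets \<open>d\<Omega> = - \<Omega> \<and> \<Omega>\<close>. In the entry \<open>\<Omega>\<^sub>0\<^sup>2\<close> the terms containing
\<open>\<Omega>\<^sub>0\<^sup>2\<close> itself vanish on the vectors under consideration, and \<open>\<Omega>\<^sub>0\<^sup>1 \<and> \<Omega>\<^sub>1\<^sup>2\<close> remains.\<close>

lemma product_symbol_frame:
  fixes g :: "'a::plane_algebra^3^3"
  assumes "is_frame g"
  shows "product_symbol (Omega 0 2) (Omega 0 1) (Omega 1 2 g) g"
proof -
  have inv: "invertible g" by (rule frame_invertible[OF assms])
  let ?\<eta> = "\<lambda>h. matrix_inv g ** h"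
  have lin: "linear (Omega \<alpha> \<beta> g)" for \<alpha> \<beta>
    unfolding Omega_def
    by (intro linearI) (simp_all only: linear_add[OF linear_matrix_mult_left]
        linear_cmul[OF linear_matrix_mult_left] vector_add_component vector_scaleR_component)
  have mult_20: "(A ** B) $ 2 $ 0 = A $ 2 $ 0 * B $ 0 $ 0 + A $ 2 $ 1 * B $ 1 $ 0 + A $ 2 $ 2 * B $ 2 $ 0"
    for A B :: "'a^3^3"
  proof -
    have three: "(3::3) = 0" by simp
    have "(\<Sum>k\<in>UNIV. f k) = f 0 + f 1 + f (2::3)" for f :: "3 \<Rightarrow> 'a"
      using sum_3[of f] unfolding three by (simp add: algebra_simps)
    then show ?thesis by (simp only: matrix_matrix_mult_def vec_lambda_beta)
  qed
  show ?thesis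
  proof (rule product_symbol.intro)
    show "linear (Omega 0 2 g)" "linear (Omega 0 1 g)" "linear (Omega 1 2 g)" by (rule lin)+
    show "surj (\<lambda>h. (Omega 0 2 g h, Omega 0 1 g h, Omega 1 2 g h))"
      unfolding surj_def
    proof safe
      fix t x y :: 'a
      define M :: "'a^3^3" where
        "M = (\<chi> i j. if i = 2 \<and> j = 0 then t else if i = 1 \<and> j = 0 then x else y)"
      have "?\<eta> (g ** M) = M" by (simp add: matrix_mul_assoc matrix_inv_both[OF inv])
      then have "(t, x, y) = (Omega 0 2 g (g ** M), Omega 0 1 g (g ** M), Omega 1 2 g (g ** M))"
        by (simp add: Omega_def M_def)
      then show "\<exists>h. (t, x, y) = (Omega 0 2 g h, Omega 0 1 g h, Omega 1 2 g h)" by blast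
    qed
    fix h k assume "Omega 0 2 g h = 0" "Omega 0 2 g k = 0"
    then show "ext_d (Omega 0 2) g h k = Omega 0 1 g h * Omega 1 2 g k - Omega 1 2 g h * Omega 0 1 g k"
      unfolding ext_d_def frechet_derivative_Omega[OF inv] mult_20[of "?\<eta> h" "?\<eta> k"]
        mult_20[of "?\<eta> k" "?\<eta> h"]
      by (simp add: Omega_def mult.commute)
  qed
qed

lemma smooth_lines_depend_on_two_functions:
  "depends_on_two_functions_of_one_variable TYPE('a::plane_algebra)"
  unfolding depends_on_two_functions_of_one_variable_def
proof (intro allI impI conjI ballI)
  fix g :: "'a^3^3" assume "is_frame g"
  then interpret product_symbol "Omega 0 2" "Omega 0 1" "Omega 1 2 g" g by (rule product_symbol_frame)
  show "in_involution (Omega 0 2) (Omega 0 1) g" by (rule in_involution_product_symbol)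
  fix L assume "L \<in> integral_elements (Omega 0 2) (Omega 0 1) g"
  then show "cartan_character (Omega 0 2) g L 1 = 2" "cartan_character (Omega 0 2) g L 2 = 0"
    by (rule cartan_character_1 cartan_character_2)+
qed

theorem theorem3:
  shows
  "(\<forall>\<gamma> :: (complex^3) set. smooth_line \<gamma> \<longrightarrow>
      tangentially_degenerate \<gamma> \<and>
      (tangentially_degenerate_of_rank 2 \<gamma> \<longleftrightarrow> nondegenerate \<gamma>) \<and>
      no_real_singular_points \<gamma>)
   \<and>
   (\<forall>\<gamma> :: (double_num^3) set. smooth_line \<gamma> \<longrightarrow>
      tangentially_degenerate \<gamma> \<and>
      (tangentially_degenerate_of_rank 2 \<gamma> \<longleftrightarrow> nondegenerate \<gamma>) \<and>
      (\<exists>\<pi>\<^sub>1 \<pi>\<^sub>2. two_plane \<pi>\<^sub>1 \<and> two_plane \<pi>\<^sub>2 \<and> \<pi>\<^sub>1 \<inter> \<pi>\<^sub>2 = {0} \<and>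
        (\<forall>X\<in>\<gamma>. \<exists>\<gamma>\<^sub>0. open_part \<gamma> \<gamma>\<^sub>0 \<and> X \<in> \<gamma>\<^sub>0 \<and>
          (\<exists>I c J d. plane_curve \<pi>\<^sub>1 I c \<and> plane_curve \<pi>\<^sub>2 J d \<and>
             generator ` \<gamma>\<^sub>0 = connecting_lines I c J d \<and>
             ruled \<gamma>\<^sub>0 = join_of I c J d))))
   \<and>
   (\<forall>\<gamma> :: (dual_num^3) set. smooth_line \<gamma> \<longrightarrow>
      tangentially_degenerate \<gamma> \<and>
      (tangentially_degenerate_of_rank 2 \<gamma> \<longleftrightarrow> nondegenerate \<gamma>) \<and>
      (\<exists>\<pi>. two_plane \<pi> \<and>
        (\<forall>X\<in>\<gamma>. \<exists>\<gamma>\<^sub>0. open_part \<gamma> \<gamma>\<^sub>0 \<and> X \<in> \<gamma>\<^sub>0 \<and>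
          (\<exists>I c. plane_curve \<pi> I c \<and> generator ` \<gamma>\<^sub>0 \<subseteq> lines_meeting I c))))
   \<and>
   depends_on_two_functions_of_one_variable TYPE(complex) \<and>
   depends_on_two_functions_of_one_variable TYPE(double_num) \<and>
   depends_on_two_functions_of_one_variable TYPE(dual_num)"
proof (intro conjI allI impI smooth_lines_depend_on_two_functions)
  fix \<gamma> :: "(complex^3) set" assume sl: "smooth_line \<gamma>"
  show "tangentially_degenerate \<gamma>" "tangentially_degenerate_of_rank 2 \<gamma> \<longleftrightarrow> nondegenerate \<gamma>"
    by (rule smooth_line_tangentially_degenerate[OF sl] smooth_line_rank_two_iff_nondegenerate[OF sl])+
  show "no_real_singular_points \<gamma>"
    by (rule no_real_singular_points_if_field[OF sl]) (simp add: regular_def)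
next
  fix \<gamma> :: "(double_num^3) set" assume sl: "smooth_line \<gamma>"
  show "tangentially_degenerate \<gamma>" "tangentially_degenerate_of_rank 2 \<gamma> \<longleftrightarrow> nondegenerate \<gamma>"
    by (rule smooth_line_tangentially_degenerate[OF sl] smooth_line_rank_two_iff_nondegenerate[OF sl])+
  let ?c = "Double (1/2) (1/2)" and ?d = "Double (1/2) (-1/2)"
  note cd = one_dim_ideal_double
  have one: "?c + ?d = 1" and zero: "?c * ?d = 0" by (simp_all add: double_num_ring_defs)
  show "\<exists>\<pi>\<^sub>1 \<pi>\<^sub>2. two_plane \<pi>\<^sub>1 \<and> two_plane \<pi>\<^sub>2 \<and> \<pi>\<^sub>1 \<inter> \<pi>\<^sub>2 = {0} \<and>
        (\<forall>X\<in>\<gamma>. \<exists>\<gamma>\<^sub>0. open_part \<gamma> \<gamma>\<^sub>0 \<and> X \<in> \<gamma>\<^sub>0 \<and>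
          (\<exists>I c J d. plane_curve \<pi>\<^sub>1 I c \<and> plane_curve \<pi>\<^sub>2 J d \<and>
             generator ` \<gamma>\<^sub>0 = connecting_lines I c J d \<and> ruled \<gamma>\<^sub>0 = join_of I c J d))"
    by (intro exI[of _ "ideal_plane ?c"] exI[of _ "ideal_plane ?d"] conjI ballI
        two_plane_ideal_plane cd ideal_plane_disjoint one zero
        smooth_line_join_of_plane_curves[OF cd one zero sl])
next
  fix \<gamma> :: "(dual_num^3) set" assume sl: "smooth_line \<gamma>"
  show "tangentially_degenerate \<gamma>" "tangentially_degenerate_of_rank 2 \<gamma> \<longleftrightarrow> nondegenerate \<gamma>"
    by (rule smooth_line_tangentially_degenerate[OF sl] smooth_line_rank_two_iff_nondegenerate[OF sl])+
  show "\<exists>\<pi>. two_plane \<pi> \<and>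
        (\<forall>X\<in>\<gamma>. \<exists>\<gamma>\<^sub>0. open_part \<gamma> \<gamma>\<^sub>0 \<and> X \<in> \<gamma>\<^sub>0 \<and>
          (\<exists>I c. plane_curve \<pi> I c \<and> generator ` \<gamma>\<^sub>0 \<subseteq> lines_meeting I c))"
    by (intro exI[of _ "ideal_plane (Dual 0 1)"] conjI ballI two_plane_ideal_plane one_dim_ideal_dual
        smooth_line_meets_plane_curve[OF one_dim_ideal_dual sl])
qed

end
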